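(* Let $R$ be a commutative unital ring and let $\mathcal{D}$ be an $R$-linear triangulated category closed with respect to small coproducts. Assume that $\mathcal{D}=\mathcal{T}^{\coprod}$, where $\mathcal{T}\subset\mathcal{D}$ is an essentially small triangulated subcategory whose objects are compact in $\mathcal{D}$, and that a semi-orthogonal decomposition of $\mathcal{T}$ is given. Let $\underline{A}$ be an exact abelian subcategory of the category $R\text{-Mod}^{\mathbb{Z}}$ of $\mathbb{Z}$-graded $R$-modules that is stable with respect to shifts (that is, $M=\bigoplus M^i$ belongs to $\underline{A}$ if and only if $M[1]=\bigoplus M^{i+1}$ does), and let $\mathcal{T}_{\underline{A}}$ be the full subcategory of $\mathcal{D}$ of those $N$ such that for any $M\in\operatorname{Obj}\mathcal{T}$ the graded module $S_N(M)=\bigoplus_j\mathcal{D}(M[-j],N)$ belongs to $\underline{A}$. Assume that $F:\mathcal{D}\to\mathcal{D}'$ is an exact functor of triangulated categories that respects coproducts and suppose that $\mathcal{T}\subset\mathcal{T}_{\underline{A}}$. Let $T$ be a subcategory of $\mathcal{D}'$ that contains the essential image $F(\mathcal{T}_{\underline{A}})$. For any objects $M$ of $\mathcal{D}$ and $N$ of $\mathcal{D}'$ endow the abelian group $\mathcal{D}'(F(M),N)$ with the structure of an $R$-module in which multiplication by $r\in R$ is composition with $F(r\operatorname{id}_M)$. Then the restriction of $F$ to a functor $F_T:\mathcal{T}_{\underline{A}}\to T$ possesses a right adjoint if and only if for any $M\in\operatorname{Obj}\mathcal{T}$ and $N\in\operatorname{Obj}T$ the graded module $$S'_N(F(M))=\bigoplus_{i\in\mathbb{Z}}\mathcal{D}'(F(M[-i]),N)$$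 belongs to $\underline{A}$. Moreover, this adjoint is exact if $T$ is a triangulated subcategory of $\mathcal{D}'$.
   Context: All subcategories are strictly full. $\mathcal{D}(X,Y)$ denotes the set of morphisms from $X$ to $Y$ in $\mathcal{D}$. An object $M$ of $\mathcal{D}$ is compact if $\mathcal{D}(M,-)$ respects small coproducts. $\mathcal{T}^{\coprod}$ is the smallest strictly full triangulated subcategory of $\mathcal{D}$ closed with respect to $\mathcal{D}$-coproducts and containing $\mathcal{T}$. A semi-orthogonal decomposition of $\mathcal{T}$ is a couple $(\mathcal{LO},\mathcal{RO})$ of strictly full triangulated subcategories of $\mathcal{T}$ such that there are no non-zero morphisms from objects of $\mathcal{LO}$ to objects of $\mathcal{RO}$ and each $M\in\operatorname{Obj}\mathcal{T}$ fits into a distinguished triangle $L\to M\to R\to L[1]$ with $L\in\mathcal{LO}$, $R\in\mathcal{RO}$. "Exact abelian subcategory" of an abelian category means a strictly full subcategory closed under kernels, cokernels, and extensions. *)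

theory Defs
  imports "HOL-Algebra.Module"
begin

unbundle cardinal_syntax

section \<open>Smallness\<close>

text \<open>
  HOL has no class/set distinction, so "small" is taken relative to a type \<^typ>\<open>'u\<close> whose
  cardinality plays the role of the cardinality of a Grothendieck universe: a set is small if its
  cardinality is less than that of \<^typ>\<open>'u\<close>. Uncountability and regularity say that countable
  sets are small and that small unions of small sets are small. Strongly inaccessible
  cardinals, i.e. genuine Grothendieck universes, are among the cardinals allowed.
\<close>

definition small :: "'u itself \<Rightarrow> 'a set \<Rightarrow> bool" where
  "small U A \<longleftrightarrow> |A| <o |UNIV :: 'u set|"

definition universe :: "'u itself \<Rightarrow> bool" where
  "universe U \<longleftrightarrow> natLeq <o |UNIV :: 'u set| \<and> regularCard |UNIV :: 'u set|"


section \<open>Categories\<close>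

record ('o, 'm) cat =
  Obj :: "'o set"
  Arr :: "'m set"
  Dom :: "'m \<Rightarrow> 'o"
  Cod :: "'m \<Rightarrow> 'o"
  Ide :: "'o \<Rightarrow> 'm"
  Comp :: "'m \<Rightarrow> 'm \<Rightarrow> 'm"  (infixl \<open>\<cdot>\<index>\<close> 70)

definition Hom :: "('o, 'm, 'z) cat_scheme \<Rightarrow> 'o \<Rightarrow> 'o \<Rightarrow> 'm set" where
  "Hom C X Y = {f \<in> Arr C. Dom C f = X \<and> Cod C f = Y}"

locale category =
  fixes C :: "('o, 'm, 'z) cat_scheme" (structure)
  assumes Dom_in_Obj: "f \<in> Arr C \<Longrightarrow> Dom C f \<in> Obj C"
    and Cod_in_Obj: "f \<in> Arr C \<Longrightarrow> Cod C f \<in> Obj C"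
    and Ide_in_Hom: "X \<in> Obj C \<Longrightarrow> Ide C X \<in> Hom C X X"
    and Comp_in_Hom: "\<lbrakk>f \<in> Hom C X Y; g \<in> Hom C Y Z\<rbrakk> \<Longrightarrow> g \<cdot> f \<in> Hom C X Z"
    and Comp_Ide: "f \<in> Hom C X Y \<Longrightarrow> f \<cdot> Ide C X = f"
    and Ide_Comp: "f \<in> Hom C X Y \<Longrightarrow> Ide C Y \<cdot> f = f"
    and Comp_assoc: "\<lbrakk>f \<in> Hom C X Y; g \<in> Hom C Y Z; h \<in> Hom C Z W\<rbrakk>
      \<Longrightarrow> (h \<cdot> g) \<cdot> f = h \<cdot> (g \<cdot> f)"

definition Iso :: "('o, 'm, 'z) cat_scheme \<Rightarrow> 'o \<Rightarrow> 'o \<Rightarrow> 'm set" where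
  "Iso C X Y =
    {f \<in> Hom C X Y. \<exists>g \<in> Hom C Y X. g \<cdot>\<^bsub>C\<^esub> f = Ide C X \<and> f \<cdot>\<^bsub>C\<^esub> g = Ide C Y}"

definition isomorphic :: "('o, 'm, 'z) cat_scheme \<Rightarrow> 'o \<Rightarrow> 'o \<Rightarrow> bool" where
  "isomorphic C X Y \<longleftrightarrow> Iso C X Y \<noteq> {}"

definition locally_small :: "'u itself \<Rightarrow> ('o, 'm, 'z) cat_scheme \<Rightarrow> bool" where
  "locally_small U C \<longleftrightarrow> (\<forall>X \<in> Obj C. \<forall>Y \<in> Obj C. small U (Hom C X Y))"

text \<open>Strictly full subcategories are given by their sets of objects.\<close>

definition strictly_full :: "('o, 'm, 'z) cat_scheme \<Rightarrow> 'o set \<Rightarrow> bool" where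
  "strictly_full C S \<longleftrightarrow>
    S \<subseteq> Obj C \<and> (\<forall>X \<in> S. \<forall>Y \<in> Obj C. isomorphic C X Y \<longrightarrow> Y \<in> S)"

definition essentially_small :: "'u itself \<Rightarrow> ('o, 'm, 'z) cat_scheme \<Rightarrow> 'o set \<Rightarrow> bool" where
  "essentially_small U C S \<longleftrightarrow>
    (\<exists>S0 \<subseteq> S. small U S0 \<and> (\<forall>X \<in> S. \<exists>Y \<in> S0. isomorphic C X Y)) \<and>
    (\<forall>X \<in> S. \<forall>Y \<in> S. small U (Hom C X Y))"

definition is_coproduct ::
  "('o, 'm, 'z) cat_scheme \<Rightarrow> 'i set \<Rightarrow> ('i \<Rightarrow> 'o) \<Rightarrow> 'o \<Rightarrow> ('i \<Rightarrow> 'm) \<Rightarrow> bool" where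
  "is_coproduct C I X P \<iota> \<longleftrightarrow>
    P \<in> Obj C \<and> (\<forall>i \<in> I. X i \<in> Obj C \<and> \<iota> i \<in> Hom C (X i) P) \<and>
    (\<forall>Y \<in> Obj C. \<forall>f. (\<forall>i \<in> I. f i \<in> Hom C (X i) Y) \<longrightarrow>
      (\<exists>!g. g \<in> Hom C P Y \<and> (\<forall>i \<in> I. g \<cdot>\<^bsub>C\<^esub> \<iota> i = f i)))"

text \<open>Every small set is equipotent to a subset of \<^typ>\<open>'u\<close>, so it suffices to index
  small coproducts by such subsets.\<close>

definition has_small_coproducts :: "'u itself \<Rightarrow> ('o, 'm, 'z) cat_scheme \<Rightarrow> bool" where
  "has_small_coproducts U C \<longleftrightarrow>
    (\<forall>(I :: 'u set) X. small U I \<and> (\<forall>i \<in> I. X i \<in> Obj C) \<longrightarrow> (\<exists>P \<iota>. is_coproduct C I X P \<iota>))"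

definition coproduct_closed :: "'u itself \<Rightarrow> ('o, 'm, 'z) cat_scheme \<Rightarrow> 'o set \<Rightarrow> bool" where
  "coproduct_closed U C S \<longleftrightarrow>
    (\<forall>(I :: 'u set) X P \<iota>. small U I \<and> (\<forall>i \<in> I. X i \<in> S) \<and> is_coproduct C I X P \<iota> \<longrightarrow> P \<in> S)"


subsection \<open>Functors and adjoints\<close>

record ('o, 'm, 'p, 'n) func =
  omap :: "'o \<Rightarrow> 'p"
  amap :: "'m \<Rightarrow> 'n"

definition is_functor ::
  "('o, 'm, 'z) cat_scheme \<Rightarrow> ('p, 'n, 'y) cat_scheme \<Rightarrow> ('o, 'm, 'p, 'n) func \<Rightarrow> bool" where
  "is_functor C C' F \<longleftrightarrow>
    (\<forall>X \<in> Obj C. omap F X \<in> Obj C') \<and>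
    (\<forall>X \<in> Obj C. \<forall>Y \<in> Obj C. \<forall>f \<in> Hom C X Y. amap F f \<in> Hom C' (omap F X) (omap F Y)) \<and>
    (\<forall>X \<in> Obj C. amap F (Ide C X) = Ide C' (omap F X)) \<and>
    (\<forall>X Y Z. \<forall>f \<in> Hom C X Y. \<forall>g \<in> Hom C Y Z.
      amap F (g \<cdot>\<^bsub>C\<^esub> f) = amap F g \<cdot>\<^bsub>C'\<^esub> amap F f)"

definition respects_coproducts ::
  "'u itself \<Rightarrow> ('o, 'm, 'z) cat_scheme \<Rightarrow> ('p, 'n, 'y) cat_scheme \<Rightarrow>
    ('o, 'm, 'p, 'n) func \<Rightarrow> bool" where
  "respects_coproducts U C C' F \<longleftrightarrow>
    (\<forall>(I :: 'u set) X P \<iota>. small U I \<and> is_coproduct C I X P \<iota> \<longrightarrow>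
      is_coproduct C' I (\<lambda>i. omap F (X i)) (omap F P) (\<lambda>i. amap F (\<iota> i)))"

definition essential_image ::
  "('p, 'n, 'y) cat_scheme \<Rightarrow> ('o, 'm, 'p, 'n) func \<Rightarrow> 'o set \<Rightarrow> 'p set" where
  "essential_image C' F S = {Y \<in> Obj C'. \<exists>X \<in> S. isomorphic C' (omap F X) Y}"

definition is_right_adjoint ::
  "('o, 'm, 'z) cat_scheme \<Rightarrow> ('p, 'n, 'y) cat_scheme \<Rightarrow>
    ('o, 'm, 'p, 'n) func \<Rightarrow> ('p, 'n, 'o, 'm) func \<Rightarrow> bool" where
  "is_right_adjoint C C' F G \<longleftrightarrow>
    is_functor C C' F \<and> is_functor C' C G \<and>
    (\<exists>\<phi>.
      (\<forall>X \<in> Obj C. \<forall>Y \<in> Obj C'.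
        bij_betw (\<phi> X Y) (Hom C' (omap F X) Y) (Hom C X (omap G Y))) \<and>
      (\<forall>X \<in> Obj C. \<forall>X' \<in> Obj C. \<forall>Y \<in> Obj C'. \<forall>Y' \<in> Obj C'.
        \<forall>h \<in> Hom C X' X. \<forall>f \<in> Hom C' (omap F X) Y. \<forall>g \<in> Hom C' Y Y'.
          \<phi> X' Y' (g \<cdot>\<^bsub>C'\<^esub> f \<cdot>\<^bsub>C'\<^esub> amap F h) = amap G g \<cdot>\<^bsub>C\<^esub> \<phi> X Y f \<cdot>\<^bsub>C\<^esub> h))"


section \<open>Additive categories\<close>

record ('o, 'm) addcat = "('o, 'm) cat" +
  Add :: "'m \<Rightarrow> 'm \<Rightarrow> 'm"
  Zero :: "'o \<Rightarrow> 'o \<Rightarrow> 'm"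

text \<open>The fields \<^const>\<open>mult\<close> and \<^const>\<open>one\<close> play no role for abelian groups and modules.\<close>

definition hom_group :: "('o, 'm, 'z) addcat_scheme \<Rightarrow> 'o \<Rightarrow> 'o \<Rightarrow> 'm ring" where
  "hom_group C X Y =
    \<lparr>carrier = Hom C X Y, mult = undefined, one = undefined, zero = Zero C X Y, add = Add C\<rparr>"

definition zero_object :: "('o, 'm, 'z) addcat_scheme \<Rightarrow> 'o \<Rightarrow> bool" where
  "zero_object C Z \<longleftrightarrow> Z \<in> Obj C \<and> Ide C Z = Zero C Z Z"

locale additive_category = category C
  for C :: "('o, 'm, 'z) addcat_scheme" (structure) +
  assumes Hom_abelian_group: "\<lbrakk>X \<in> Obj C; Y \<in> Obj C\<rbrakk> \<Longrightarrow> abelian_group (hom_group C X Y)"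
    and Comp_Add_left: "\<lbrakk>f \<in> Hom C X Y; g \<in> Hom C Y Z; g' \<in> Hom C Y Z\<rbrakk>
      \<Longrightarrow> Add C g g' \<cdot> f = Add C (g \<cdot> f) (g' \<cdot> f)"
    and Comp_Add_right: "\<lbrakk>f \<in> Hom C X Y; f' \<in> Hom C X Y; g \<in> Hom C Y Z\<rbrakk>
      \<Longrightarrow> g \<cdot> Add C f f' = Add C (g \<cdot> f) (g \<cdot> f')"
    and ex_zero_object: "\<exists>Z. zero_object C Z"
    and ex_biproduct: "\<lbrakk>X \<in> Obj C; Y \<in> Obj C\<rbrakk> \<Longrightarrow>
      \<exists>P \<in> Obj C. \<exists>i \<in> Hom C X P. \<exists>j \<in> Hom C Y P. \<exists>p \<in> Hom C P X. \<exists>q \<in> Hom C P Y.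
        p \<cdot> i = Ide C X \<and> q \<cdot> j = Ide C Y \<and> p \<cdot> j = Zero C Y X \<and> q \<cdot> i = Zero C X Y \<and>
        Add C (i \<cdot> p) (j \<cdot> q) = Ide C P"

definition additive_functor ::
  "('o, 'm, 'z) addcat_scheme \<Rightarrow> ('p, 'n, 'y) addcat_scheme \<Rightarrow>
    ('o, 'm, 'p, 'n) func \<Rightarrow> bool" where
  "additive_functor C C' F \<longleftrightarrow> is_functor C C' F \<and>
    (\<forall>X \<in> Obj C. \<forall>Y \<in> Obj C. \<forall>f \<in> Hom C X Y. \<forall>g \<in> Hom C X Y.
      amap F (Add C f g) = Add C' (amap F f) (amap F g))"

text \<open>\<open>M\<close> is compact if for each small coproduct \<open>P\<close> of objects \<open>X i\<close> the canonical map from the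
  direct sum of the groups \<open>Hom C M (X i)\<close> (families of finite support) to \<open>Hom C M P\<close>
  is bijective.\<close>

definition compact_object :: "'u itself \<Rightarrow> ('o, 'm, 'z) addcat_scheme \<Rightarrow> 'o \<Rightarrow> bool" where
  "compact_object U C M \<longleftrightarrow> M \<in> Obj C \<and>
    (\<forall>(I :: 'u set) X P \<iota>. small U I \<and> is_coproduct C I X P \<iota> \<longrightarrow>
      bij_betw
        (\<lambda>f. finsum (hom_group C M P) (\<lambda>i. \<iota> i \<cdot>\<^bsub>C\<^esub> f i) {i \<in> I. f i \<noteq> Zero C M (X i)})
        {f \<in> (\<Pi>\<^sub>E i\<in>I. Hom C M (X i)). finite {i \<in> I. f i \<noteq> Zero C M (X i)}}
        (Hom C M P))"


section \<open>Triangulated categories\<close>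

text \<open>\<open>(f, g, h) \<in> Dist C\<close> stands for a distinguished triangle
  \<open>X \<rightarrow> Y \<rightarrow> Z \<rightarrow> X[1]\<close> with morphisms \<open>f\<close>, \<open>g\<close>, \<open>h\<close>.\<close>

record ('o, 'm) tricat = "('o, 'm) addcat" +
  Shift :: "('o, 'm, 'o, 'm) func"
  Dist :: "('m \<times> 'm \<times> 'm) set"

abbreviation shO :: "('o, 'm, 'z) tricat_scheme \<Rightarrow> 'o \<Rightarrow> 'o" where
  "shO C \<equiv> omap (Shift C)"

abbreviation shA :: "('o, 'm, 'z) tricat_scheme \<Rightarrow> 'm \<Rightarrow> 'm" where
  "shA C \<equiv> amap (Shift C)"

text \<open>The shift is an automorphism of the category (not merely an autoequivalence), so that
  \<open>M[j]\<close> is defined on the nose for negative \<open>j\<close> as well.\<close>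

definition shift_by :: "('o, 'm, 'z) tricat_scheme \<Rightarrow> int \<Rightarrow> 'o \<Rightarrow> 'o" where
  "shift_by C j X =
    (if 0 \<le> j then (shO C ^^ nat j) X else (inv_into (Obj C) (shO C) ^^ nat (- j)) X)"

locale triangulated_category = additive_category C
  for C :: "('o, 'm, 'z) tricat_scheme" (structure) +
  assumes Shift_functor: "additive_functor C C (Shift C)"
    and Shift_bij_Obj: "bij_betw (shO C) (Obj C) (Obj C)"
    and Shift_bij_Arr: "bij_betw (shA C) (Arr C) (Arr C)"
    and Dist_triangle: "(f, g, h) \<in> Dist C \<Longrightarrow>
      \<exists>X Y Z. f \<in> Hom C X Y \<and> g \<in> Hom C Y Z \<and> h \<in> Hom C Z (shO C X)"
    and TR1_Ide: "\<lbrakk>X \<in> Obj C; zero_object C Z\<rbrakk> \<Longrightarrow>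
      (Ide C X, Zero C X Z, Zero C Z (shO C X)) \<in> Dist C"
    and TR1_Iso: "\<lbrakk>(f, g, h) \<in> Dist C;
        f \<in> Hom C X Y; g \<in> Hom C Y Z; h \<in> Hom C Z (shO C X);
        f' \<in> Hom C X' Y'; g' \<in> Hom C Y' Z'; h' \<in> Hom C Z' (shO C X');
        a \<in> Iso C X X'; b \<in> Iso C Y Y'; c \<in> Iso C Z Z';
        b \<cdot> f = f' \<cdot> a; c \<cdot> g = g' \<cdot> b; shA C a \<cdot> h = h' \<cdot> c\<rbrakk> \<Longrightarrow>
      (f', g', h') \<in> Dist C"
    and TR1_cone: "f \<in> Hom C X Y \<Longrightarrow> \<exists>g h. (f, g, h) \<in> Dist C"
    and TR2: "\<lbrakk>f \<in> Hom C X Y; g \<in> Hom C Y Z; h \<in> Hom C Z (shO C X)\<rbrakk> \<Longrightarrow>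
      (f, g, h) \<in> Dist C \<longleftrightarrow> (g, h, \<ominus>\<^bsub>hom_group C (shO C X) (shO C Y)\<^esub> shA C f) \<in> Dist C"
    and TR3: "\<lbrakk>(f, g, h) \<in> Dist C; (f', g', h') \<in> Dist C;
        f \<in> Hom C X Y; g \<in> Hom C Y Z; h \<in> Hom C Z (shO C X);
        f' \<in> Hom C X' Y'; g' \<in> Hom C Y' Z'; h' \<in> Hom C Z' (shO C X');
        a \<in> Hom C X X'; b \<in> Hom C Y Y'; b \<cdot> f = f' \<cdot> a\<rbrakk> \<Longrightarrow>
      \<exists>c \<in> Hom C Z Z'. c \<cdot> g = g' \<cdot> b \<and> shA C a \<cdot> h = h' \<cdot> c"
    and TR4: "\<lbrakk>f \<in> Hom C X Y; g \<in> Hom C Y Z;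
        (f, a, b) \<in> Dist C; a \<in> Hom C Y U; b \<in> Hom C U (shO C X);
        (g, c, d) \<in> Dist C; c \<in> Hom C Z V; d \<in> Hom C V (shO C Y);
        (g \<cdot> f, e, k) \<in> Dist C; e \<in> Hom C Z W; k \<in> Hom C W (shO C X)\<rbrakk> \<Longrightarrow>
      \<exists>u \<in> Hom C U W. \<exists>v \<in> Hom C W V.
        (u, v, shA C a \<cdot> d) \<in> Dist C \<and>
        u \<cdot> a = e \<cdot> g \<and> k \<cdot> u = b \<and> v \<cdot> e = c \<and> d \<cdot> v = shA C f \<cdot> k"

text \<open>The full subcategory on a set of objects, with the restricted structure; it is
  meaningful as a triangulated category only if the set is closed under shifts and cones.\<close>

definition full_sub :: "('o, 'm) tricat \<Rightarrow> 'o set \<Rightarrow> ('o, 'm) tricat" where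
  "full_sub C S = C\<lparr>
    Obj := Obj C \<inter> S,
    Arr := {f \<in> Arr C. Dom C f \<in> S \<and> Cod C f \<in> S},
    Dist := {(f, g, h) \<in> Dist C. Dom C f \<in> S \<and> Cod C f \<in> S \<and> Cod C g \<in> S}\<rparr>"

definition triangulated_subcategory :: "('o, 'm, 'z) tricat_scheme \<Rightarrow> 'o set \<Rightarrow> bool" where
  "triangulated_subcategory C S \<longleftrightarrow>
    strictly_full C S \<and> S \<noteq> {} \<and>
    (\<forall>X \<in> Obj C. X \<in> S \<longleftrightarrow> shO C X \<in> S) \<and>
    (\<forall>f g h. (f, g, h) \<in> Dist C \<and> Dom C f \<in> S \<and> Cod C f \<in> S \<longrightarrow> Cod C g \<in> S)"

definition coproduct_closure ::
  "'u itself \<Rightarrow> ('o, 'm, 'z) tricat_scheme \<Rightarrow> 'o set \<Rightarrow> 'o set" where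
  "coproduct_closure U C T =
    \<Inter>{S. triangulated_subcategory C S \<and> coproduct_closed U C S \<and> T \<subseteq> S}"

definition semi_orthogonal_decomposition ::
  "('o, 'm, 'z) tricat_scheme \<Rightarrow> 'o set \<Rightarrow> 'o set \<Rightarrow> bool" where
  "semi_orthogonal_decomposition C LO RO \<longleftrightarrow>
    triangulated_subcategory C LO \<and> triangulated_subcategory C RO \<and>
    (\<forall>L \<in> LO. \<forall>N \<in> RO. Hom C L N = {Zero C L N}) \<and>
    (\<forall>M \<in> Obj C. \<exists>L \<in> LO. \<exists>N \<in> RO. \<exists>f g h.
      (f, g, h) \<in> Dist C \<and> f \<in> Hom C L M \<and> g \<in> Hom C M N \<and> h \<in> Hom C N (shO C L))"

definition exact_functor ::
  "('o, 'm, 'z) tricat_scheme \<Rightarrow> ('p, 'n, 'y) tricat_scheme \<Rightarrow>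
    ('o, 'm, 'p, 'n) func \<Rightarrow> bool" where
  "exact_functor C C' F \<longleftrightarrow>
    triangulated_category C \<and> triangulated_category C' \<and> additive_functor C C' F \<and>
    (\<exists>\<theta>.
      (\<forall>X \<in> Obj C. \<theta> X \<in> Iso C' (omap F (shO C X)) (shO C' (omap F X))) \<and>
      (\<forall>X \<in> Obj C. \<forall>Y \<in> Obj C. \<forall>f \<in> Hom C X Y.
        \<theta> Y \<cdot>\<^bsub>C'\<^esub> amap F (shA C f) = shA C' (amap F f) \<cdot>\<^bsub>C'\<^esub> \<theta> X) \<and>
      (\<forall>f g h. (f, g, h) \<in> Dist C \<longrightarrow>
        (amap F f, amap F g, \<theta> (Dom C f) \<cdot>\<^bsub>C'\<^esub> amap F h) \<in> Dist C'))"


subsection \<open>Linear triangulated categories\<close>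

text \<open>\<open>s r f\<close> is the product of the morphism \<open>f\<close> by the scalar \<open>r\<close>.\<close>

definition hom_module ::
  "('o, 'm, 'z) addcat_scheme \<Rightarrow> ('r \<Rightarrow> 'm \<Rightarrow> 'm) \<Rightarrow> 'o \<Rightarrow> 'o \<Rightarrow> ('r, 'm) module" where
  "hom_module C s X Y =
    \<lparr>carrier = Hom C X Y, mult = undefined, one = undefined, zero = Zero C X Y, add = Add C,
     smult = s\<rparr>"

locale linear_triangulated_category = R: cring R + triangulated_category C
  for R :: "'r ring" and C :: "('o, 'm, 'z) tricat_scheme" +
  fixes s :: "'r \<Rightarrow> 'm \<Rightarrow> 'm"
  assumes Hom_module: "\<lbrakk>X \<in> Obj C; Y \<in> Obj C\<rbrakk> \<Longrightarrow> module R (hom_module C s X Y)"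
    and Comp_smult_left: "\<lbrakk>r \<in> carrier R; f \<in> Hom C X Y; g \<in> Hom C Y Z\<rbrakk>
      \<Longrightarrow> s r g \<cdot>\<^bsub>C\<^esub> f = s r (g \<cdot>\<^bsub>C\<^esub> f)"
    and Comp_smult_right: "\<lbrakk>r \<in> carrier R; f \<in> Hom C X Y; g \<in> Hom C Y Z\<rbrakk>
      \<Longrightarrow> g \<cdot>\<^bsub>C\<^esub> s r f = s r (g \<cdot>\<^bsub>C\<^esub> f)"
    and Shift_smult: "\<lbrakk>r \<in> carrier R; f \<in> Hom C X Y\<rbrakk> \<Longrightarrow> shA C (s r f) = s r (shA C f)"


section \<open>Graded modules\<close>

text \<open>A \<open>\<int>\<close>-graded module is the family of its homogeneous components. The category
  \<open>R-Mod\<^sup>\<int>\<close> consists of the graded modules with small components carried by \<^typ>\<open>'u\<close>;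
  up to isomorphism these are all the graded modules with small components.\<close>

definition linear_maps ::
  "'r ring \<Rightarrow> ('r, 'a) module \<Rightarrow> ('r, 'b) module \<Rightarrow> ('a \<Rightarrow> 'b) set" where
  "linear_maps R M N = {f \<in> carrier M \<rightarrow> carrier N.
    (\<forall>x \<in> carrier M. \<forall>y \<in> carrier M. f (x \<oplus>\<^bsub>M\<^esub> y) = f x \<oplus>\<^bsub>N\<^esub> f y) \<and>
    (\<forall>r \<in> carrier R. \<forall>x \<in> carrier M. f (r \<odot>\<^bsub>M\<^esub> x) = r \<odot>\<^bsub>N\<^esub> f x)}"

definition graded_modules :: "'r ring \<Rightarrow> (int \<Rightarrow> ('r, 'u) module) set" where
  "graded_modules R = {M. \<forall>i. module R (M i) \<and> small TYPE('u) (carrier (M i))}"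

definition graded_maps ::
  "'r ring \<Rightarrow> (int \<Rightarrow> ('r, 'a) module) \<Rightarrow> (int \<Rightarrow> ('r, 'b) module) \<Rightarrow> (int \<Rightarrow> 'a \<Rightarrow> 'b) set" where
  "graded_maps R M N = {f. \<forall>i. f i \<in> linear_maps R (M i) (N i)}"

definition graded_inj :: "(int \<Rightarrow> ('r, 'a) module) \<Rightarrow> (int \<Rightarrow> 'a \<Rightarrow> 'b) \<Rightarrow> bool" where
  "graded_inj M f \<longleftrightarrow> (\<forall>i. inj_on (f i) (carrier (M i)))"

definition graded_surj ::
  "(int \<Rightarrow> ('r, 'a) module) \<Rightarrow> (int \<Rightarrow> ('r, 'b) module) \<Rightarrow> (int \<Rightarrow> 'a \<Rightarrow> 'b) \<Rightarrow> bool" where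
  "graded_surj M N f \<longleftrightarrow> (\<forall>i. f i ` carrier (M i) = carrier (N i))"

definition graded_exact_at ::
  "(int \<Rightarrow> ('r, 'a) module) \<Rightarrow> (int \<Rightarrow> ('r, 'b) module) \<Rightarrow> (int \<Rightarrow> ('r, 'c) module) \<Rightarrow>
    (int \<Rightarrow> 'a \<Rightarrow> 'b) \<Rightarrow> (int \<Rightarrow> 'b \<Rightarrow> 'c) \<Rightarrow> bool" where
  "graded_exact_at L M N f g \<longleftrightarrow>
    (\<forall>i. f i ` carrier (L i) = {y \<in> carrier (M i). g i y = \<zero>\<^bsub>N i\<^esub>})"

definition graded_isomorphic ::
  "'r ring \<Rightarrow> (int \<Rightarrow> ('r, 'a) module) \<Rightarrow> (int \<Rightarrow> ('r, 'b) module) \<Rightarrow> bool" where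
  "graded_isomorphic R M N \<longleftrightarrow> (\<exists>f \<in> graded_maps R M N. graded_inj M f \<and> graded_surj M N f)"

definition exact_abelian_subcategory ::
  "'r ring \<Rightarrow> (int \<Rightarrow> ('r, 'u) module) set \<Rightarrow> bool" where
  "exact_abelian_subcategory R A \<longleftrightarrow>
    A \<subseteq> graded_modules R \<and> A \<noteq> {} \<and>
    \<comment> \<open>strictness\<close>
    (\<forall>M \<in> A. \<forall>N \<in> graded_modules R. graded_isomorphic R M N \<longrightarrow> N \<in> A) \<and>
    \<comment> \<open>kernels: \<open>0 \<rightarrow> K \<rightarrow> M \<rightarrow> N\<close> exact\<close>
    (\<forall>M \<in> A. \<forall>N \<in> A. \<forall>K \<in> graded_modules R.
      \<forall>k \<in> graded_maps R K M. \<forall>f \<in> graded_maps R M N.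
        graded_inj K k \<and> graded_exact_at K M N k f \<longrightarrow> K \<in> A) \<and>
    \<comment> \<open>cokernels: \<open>M \<rightarrow> N \<rightarrow> Q \<rightarrow> 0\<close> exact\<close>
    (\<forall>M \<in> A. \<forall>N \<in> A. \<forall>Q \<in> graded_modules R.
      \<forall>f \<in> graded_maps R M N. \<forall>q \<in> graded_maps R N Q.
        graded_exact_at M N Q f q \<and> graded_surj N Q q \<longrightarrow> Q \<in> A) \<and>
    \<comment> \<open>extensions: \<open>0 \<rightarrow> M \<rightarrow> E \<rightarrow> N \<rightarrow> 0\<close> exact\<close>
    (\<forall>M \<in> A. \<forall>N \<in> A. \<forall>E \<in> graded_modules R.
      \<forall>f \<in> graded_maps R M E. \<forall>g \<in> graded_maps R E N.
        graded_inj M f \<and> graded_exact_at M E N f g \<and> graded_surj E N g \<longrightarrow> E \<in> A)"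

definition shift_stable :: "'r ring \<Rightarrow> (int \<Rightarrow> ('r, 'u) module) set \<Rightarrow> bool" where
  "shift_stable R A \<longleftrightarrow> (\<forall>M \<in> graded_modules R. M \<in> A \<longleftrightarrow> (\<lambda>i. M (i + 1)) \<in> A)"

text \<open>A graded module carried by an arbitrary type belongs to the strict subcategory \<open>A\<close>
  if it is isomorphic to a member of \<open>A\<close>.\<close>

definition belongs_to ::
  "'r ring \<Rightarrow> (int \<Rightarrow> ('r, 'a) module) \<Rightarrow> (int \<Rightarrow> ('r, 'u) module) set \<Rightarrow> bool" where
  "belongs_to R S A \<longleftrightarrow> (\<exists>M \<in> A. graded_isomorphic R S M)"


subsection \<open>Graded modules of morphisms\<close>

definition S_mod ::
  "('o, 'm, 'z) tricat_scheme \<Rightarrow> ('r \<Rightarrow> 'm \<Rightarrow> 'm) \<Rightarrow> 'o \<Rightarrow> 'o \<Rightarrow> int \<Rightarrow> ('r, 'm) module" where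
  "S_mod D s N M = (\<lambda>j. hom_module D s (shift_by D (- j) M) N)"

definition T_sub ::
  "'r ring \<Rightarrow> ('o, 'm, 'z) tricat_scheme \<Rightarrow> ('r \<Rightarrow> 'm \<Rightarrow> 'm) \<Rightarrow> 'o set \<Rightarrow>
    (int \<Rightarrow> ('r, 'u) module) set \<Rightarrow> 'o set" where
  "T_sub R D s \<T> A = {N \<in> Obj D. \<forall>M \<in> \<T>. belongs_to R (S_mod D s N M) A}"

text \<open>\<open>Hom D' (F M) N\<close>, on which \<open>r\<close> acts by precomposition with \<open>F (r id\<^sub>M)\<close>.\<close>

definition F_hom_module ::
  "('o, 'm, 'z) cat_scheme \<Rightarrow> ('r \<Rightarrow> 'm \<Rightarrow> 'm) \<Rightarrow> ('p, 'n, 'y) addcat_scheme \<Rightarrow>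
    ('o, 'm, 'p, 'n) func \<Rightarrow> 'o \<Rightarrow> 'p \<Rightarrow> ('r, 'n) module" where
  "F_hom_module D s D' F M N =
    hom_module D' (\<lambda>r f. f \<cdot>\<^bsub>D'\<^esub> amap F (s r (Ide D M))) (omap F M) N"

definition S'_mod ::
  "('o, 'm, 'z) tricat_scheme \<Rightarrow> ('r \<Rightarrow> 'm \<Rightarrow> 'm) \<Rightarrow> ('p, 'n, 'y) addcat_scheme \<Rightarrow>
    ('o, 'm, 'p, 'n) func \<Rightarrow> 'p \<Rightarrow> 'o \<Rightarrow> int \<Rightarrow> ('r, 'n) module" where
  "S'_mod D s D' F N M = (\<lambda>i. F_hom_module D s D' F (shift_by D (- i) M) N)"

end

theory Submission
  imports Defs "HOL-Algebra.AbelCoset"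
begin

text \<open>
  A right adjoint of \<open>F\<^sub>T\<close> amounts to a universal arrow \<open>e : F L \<rightarrow> N\<close> with \<open>L\<close> in \<open>\<T>\<^sub>A\<close> for each \<open>N\<close> in
  \<open>T\<close>, and \<open>g \<mapsto> e \<circ> F g\<close> then identifies \<open>S\<^sub>L(M)\<close> with \<open>S'\<^sub>N(F M)\<close>. This gives necessity of the
  condition. Conversely, Brown representability provides a universal arrow from an object \<open>L\<close> of \<open>D\<close>, and
  by the same identification the condition says that \<open>L\<close> lies in \<open>\<T>\<^sub>A\<close>.

  For Brown representability, start from a coproduct \<open>X\<^sub>0\<close> of objects of \<open>\<T>\<close> that covers all morphisms
  \<open>F M \<rightarrow> N\<close>, kill step by step the morphisms from \<open>\<T>\<close> that become zero, and take the homotopy colimit;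
  the objects \<open>W\<close> on whose shifts the resulting \<open>e : F L \<rightarrow> N\<close> is universal form a triangulated
  subcategory that contains \<open>\<T>\<close> and is closed under coproducts.

  A right adjoint \<open>G\<close> is exact: the five lemma shows that the cone of \<open>G f\<close> has the universal property of
  \<open>G\<close> applied to the cone of \<open>f\<close>. The subcategory \<open>\<T>\<^sub>A\<close> is triangulated since the middle term of a five
  term exact sequence is an extension of a kernel by a cokernel.
\<close>

section \<open>Categories\<close>

text \<open>The restricted functor lands in \<open>full_sub D' T\<close>, where \<open>T\<close> is
  only strictly full, so neither additivity nor triangles are available in the target. Existence of
  the adjoint is therefore a statement about plain categories, decided one object at a time by
  universal arrows; triangles in \<open>T\<close> enter only for exactness. The object
  \<open>L\<close> is constructed in all of \<open>D\<close>, and universality against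
  \<open>D\<close> restricts to any full subcategory that contains \<open>L\<close>, so membership
  of \<open>L\<close> in \<open>\<T>\<^sub>A\<close> is the sole issue. Killing the unwanted
  morphisms into \<open>X n\<close> may create new ones into \<open>X (Suc n)\<close>; they
  disappear only in the homotopy colimit. That is no genuine colimit, just the cone of a map of
  coproducts, and the obstruction to lifting a morphism from \<open>M\<close> to a finite stage
  lives on the desuspension of \<open>M\<close>. Hence both \<open>M\<close> and its desuspension
  have to be compact, which shift stability of \<open>\<T>\<close> grants. The universal map is
  additive on hom groups, so the five lemma applies in two directions: in the test object, to pass
  from the generators to all of \<open>D\<close>, and in the target, to compare the cone of
  \<open>G f\<close> with \<open>G\<close> of the cone.\<close>

lemma Hom_iff: "f \<in> Hom C X Y \<longleftrightarrow> f \<in> Arr C \<and> Dom C f = X \<and> Cod C f = Y"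
  by (simp add: Hom_def)

context category
begin

declare Dom_in_Obj [simp] Cod_in_Obj [simp]

lemma HomD:
  "f \<in> Hom C X Y \<Longrightarrow> f \<in> Arr C \<and> Dom C f = X \<and> Cod C f = Y \<and> X \<in> Obj C \<and> Y \<in> Obj C"
  by (auto simp: Hom_iff)

lemma arr_Ide [simp]:
  assumes "X \<in> Obj C"
  shows "Ide C X \<in> Arr C" "Dom C (Ide C X) = X" "Cod C (Ide C X) = X"
  using Ide_in_Hom[OF assms] by (auto simp: Hom_iff)

text \<open>Hom-set membership is split into \<open>Arr\<close>, \<open>Dom\<close> and
  \<open>Cod\<close> because these are computed by rewriting, whereas \<open>Comp_in_Hom\<close>
  would require the middle object to be guessed. The proofs below convert with \<open>HomD\<close>
  and \<open>Hom_iff\<close> and leave composability to the simplifier.\<close>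

lemma arr_Comp [simp]:
  assumes "f \<in> Arr C" "g \<in> Arr C" "Dom C g = Cod C f"
  shows "g \<cdot> f \<in> Arr C" "Dom C (g \<cdot> f) = Dom C f" "Cod C (g \<cdot> f) = Cod C g"
  using Comp_in_Hom[of f "Dom C f" "Cod C f" g "Cod C g"] assms by (auto simp: Hom_iff)

lemma Comp_Ide_arr [simp]: "\<lbrakk>f \<in> Arr C; Dom C f = X\<rbrakk> \<Longrightarrow> f \<cdot> Ide C X = f"
  using Comp_Ide[of f X "Cod C f"] by (simp add: Hom_iff)

lemma Ide_Comp_arr [simp]: "\<lbrakk>f \<in> Arr C; Cod C f = Y\<rbrakk> \<Longrightarrow> Ide C Y \<cdot> f = f"
  using Ide_Comp[of f "Dom C f" Y] by (simp add: Hom_iff)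

lemma Comp_assoc_arr [simp]:
  "\<lbrakk>f \<in> Arr C; g \<in> Arr C; h \<in> Arr C; Dom C g = Cod C f; Dom C h = Cod C g\<rbrakk>
    \<Longrightarrow> (h \<cdot> g) \<cdot> f = h \<cdot> (g \<cdot> f)"
  by (rule Comp_assoc[of f "Dom C f" "Cod C f" g "Cod C g" h "Cod C h"]) (auto simp: Hom_iff)

text \<open>Simplification brackets composites to the right, which hides \<open>g \<cdot> f\<close>
  once something is composed on the right of \<open>f\<close>. An equation between composites is
  applied inside a longer one through this form.\<close>

lemma Comp_reassoc:
  assumes "g \<cdot> f = k" "f \<in> Arr C" "g \<in> Arr C" "Dom C g = Cod C f" "e \<in> Arr C" "Cod C e = Dom C f"
  shows "g \<cdot> (f \<cdot> e) = k \<cdot> e"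
  using Comp_assoc_arr[of e f g] assms by simp

lemma Iso_cases:
  assumes "a \<in> Iso C X Y"
  obtains b where "a \<in> Hom C X Y" "b \<in> Hom C Y X" "b \<cdot> a = Ide C X" "a \<cdot> b = Ide C Y"
    "b \<in> Iso C Y X"
  using assms unfolding Iso_def by auto

lemma IsoI:
  "\<lbrakk>a \<in> Hom C X Y; b \<in> Hom C Y X; b \<cdot> a = Ide C X; a \<cdot> b = Ide C Y\<rbrakk> \<Longrightarrow> a \<in> Iso C X Y"
  by (auto simp: Iso_def)

lemma Ide_Iso: "X \<in> Obj C \<Longrightarrow> Ide C X \<in> Iso C X X"
  using IsoI[of "Ide C X" X X "Ide C X"] by (simp add: Hom_iff)

lemma isomorphic_sym: "isomorphic C X Y \<Longrightarrow> isomorphic C Y X"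
  unfolding isomorphic_def by (metis Iso_cases ex_in_conv)

lemma isomorphicI:
  "\<lbrakk>a \<in> Hom C X Y; b \<in> Hom C Y X; b \<cdot> a = Ide C X; a \<cdot> b = Ide C Y\<rbrakk> \<Longrightarrow> isomorphic C X Y"
  unfolding isomorphic_def using IsoI by blast

lemma isomorphicE:
  assumes "isomorphic C X Y"
  obtains a b where "a \<in> Hom C X Y" "b \<in> Hom C Y X" "b \<cdot> a = Ide C X" "a \<cdot> b = Ide C Y"
  using assms unfolding isomorphic_def Iso_def by blast

lemma bij_betw_Comp_Iso:
  assumes "a \<in> Iso C X Y" "W \<in> Obj C"
  shows "bij_betw (\<lambda>f. a \<cdot> f) (Hom C W X) (Hom C W Y)"
proof -
  obtain b where b: "a \<in> Hom C X Y" "b \<in> Hom C Y X" "b \<cdot> a = Ide C X" "a \<cdot> b = Ide C Y"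
    using assms(1) by (rule Iso_cases)
  note d = HomD[OF b(1)] HomD[OF b(2)]
  show ?thesis
    by (rule bij_betw_byWitness[where f' = "\<lambda>f. b \<cdot> f"])
      (use d b in \<open>auto simp: Hom_iff Comp_reassoc[OF b(3)] Comp_reassoc[OF b(4)]\<close>)
qed

end


section \<open>Additive categories\<close>

text \<open>Source and target are read off the morphism, so negation needs no object arguments and
  rewrites like composition; \<open>a_inv_Neg\<close> ties it to the group inverse in the
  axioms.\<close>

definition Neg :: "('o, 'm, 'z) addcat_scheme \<Rightarrow> 'm \<Rightarrow> 'm" where
  "Neg C f = \<ominus>\<^bsub>hom_group C (Dom C f) (Cod C f)\<^esub> f"

lemma hom_group_simps [simp]:
  "carrier (hom_group C X Y) = Hom C X Y"
  "zero (hom_group C X Y) = Zero C X Y"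
  "add (hom_group C X Y) = Add C"
  by (simp_all add: hom_group_def)

lemma abelian_group_homI':
  assumes "abelian_group G" "abelian_group H"
    and "\<And>x. x \<in> carrier G \<Longrightarrow> h x \<in> carrier H"
    and "\<And>x y. \<lbrakk>x \<in> carrier G; y \<in> carrier G\<rbrakk> \<Longrightarrow> h (x \<oplus>\<^bsub>G\<^esub> y) = h x \<oplus>\<^bsub>H\<^esub> h y"
  shows "abelian_group_hom G H h"
  by (rule abelian_group_homI[OF assms(1,2)])
    (use assms in \<open>auto simp: group_hom_def group_hom_axioms_def hom_def
      intro!: abelian_group.a_group\<close>)

lemma abelian_group_hom_inj_on:
  assumes "abelian_group_hom G H h"
    and "\<And>x. \<lbrakk>x \<in> carrier G; h x = \<zero>\<^bsub>H\<^esub>\<rbrakk> \<Longrightarrow> x = \<zero>\<^bsub>G\<^esub>"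
  shows "inj_on h (carrier G)"
proof -
  interpret abelian_group_hom G H h by fact
  show ?thesis
  proof (rule inj_onI)
    fix x y assume xy: "x \<in> carrier G" "y \<in> carrier G" "h x = h y"
    have "h (x \<oplus>\<^bsub>G\<^esub> \<ominus>\<^bsub>G\<^esub> y) = \<zero>\<^bsub>H\<^esub>"
      using xy by (simp add: H.r_neg)
    then have "x \<oplus>\<^bsub>G\<^esub> \<ominus>\<^bsub>G\<^esub> y = \<zero>\<^bsub>G\<^esub>" using assms(2) xy by simp
    then show "x = y" using xy by (metis G.minus_equality G.minus_minus G.a_inv_closed)
  qed
qed

context additive_category
begin

lemma a_inv_Neg: "f \<in> Hom C X Y \<Longrightarrow> \<ominus>\<^bsub>hom_group C X Y\<^esub> f = Neg C f"
  by (auto simp: Neg_def Hom_iff)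

lemma arr_Zero [simp]:
  assumes "X \<in> Obj C" "Y \<in> Obj C"
  shows "Zero C X Y \<in> Arr C" "Dom C (Zero C X Y) = X" "Cod C (Zero C X Y) = Y"
proof -
  interpret abelian_group "hom_group C X Y" using Hom_abelian_group assms .
  show "Zero C X Y \<in> Arr C" "Dom C (Zero C X Y) = X" "Cod C (Zero C X Y) = Y"
    using zero_closed by (auto simp: Hom_iff)
qed

lemma arr_Add [simp]:
  assumes "f \<in> Arr C" "g \<in> Arr C" "Dom C g = Dom C f" "Cod C g = Cod C f"
  shows "Add C f g \<in> Arr C" "Dom C (Add C f g) = Dom C f" "Cod C (Add C f g) = Cod C f"
proof -
  interpret abelian_group "hom_group C (Dom C f) (Cod C f)" using Hom_abelian_group assms by simp
  show "Add C f g \<in> Arr C" "Dom C (Add C f g) = Dom C f" "Cod C (Add C f g) = Cod C f"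
    using add.m_closed[of f g] assms by (auto simp: Hom_iff)
qed

lemma arr_Neg [simp]:
  assumes "f \<in> Arr C"
  shows "Neg C f \<in> Arr C" "Dom C (Neg C f) = Dom C f" "Cod C (Neg C f) = Cod C f"
proof -
  interpret abelian_group "hom_group C (Dom C f) (Cod C f)" using Hom_abelian_group assms by simp
  show "Neg C f \<in> Arr C" "Dom C (Neg C f) = Dom C f" "Cod C (Neg C f) = Cod C f"
    using a_inv_closed[of f] assms by (auto simp: Hom_iff Neg_def)
qed

lemma Add_commute:
  assumes "f \<in> Arr C" "g \<in> Arr C" "Dom C g = Dom C f" "Cod C g = Cod C f"
  shows "Add C f g = Add C g f"
proof -
  interpret abelian_group "hom_group C (Dom C f) (Cod C f)" using Hom_abelian_group assms by simp
  show ?thesis using a_comm[of f g] assms by (auto simp: Hom_iff)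
qed

lemma Add_Zero [simp]:
  assumes "f \<in> Arr C" "Dom C f = X" "Cod C f = Y"
  shows "Add C f (Zero C X Y) = f" "Add C (Zero C X Y) f = f"
proof -
  interpret abelian_group "hom_group C (Dom C f) (Cod C f)"
    using Hom_abelian_group assms(1) by simp
  show "Add C f (Zero C X Y) = f" "Add C (Zero C X Y) f = f"
    using r_zero[of f] l_zero[of f] assms by (auto simp: Hom_iff)
qed

lemma Add_Neg [simp]:
  assumes "f \<in> Arr C"
  shows "Add C f (Neg C f) = Zero C (Dom C f) (Cod C f)"
    "Add C (Neg C f) f = Zero C (Dom C f) (Cod C f)"
proof -
  interpret abelian_group "hom_group C (Dom C f) (Cod C f)" using Hom_abelian_group assms by simp
  show "Add C f (Neg C f) = Zero C (Dom C f) (Cod C f)"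
    "Add C (Neg C f) f = Zero C (Dom C f) (Cod C f)"
    using r_neg[of f] l_neg[of f] assms by (auto simp: Hom_iff Neg_def)
qed

lemma Neg_Neg [simp]:
  assumes "f \<in> Arr C"
  shows "Neg C (Neg C f) = f"
proof -
  interpret abelian_group "hom_group C (Dom C f) (Cod C f)" using Hom_abelian_group assms by simp
  show ?thesis
    using minus_minus[of f] assms a_inv_closed[of f] by (auto simp: Hom_iff Neg_def)
qed

lemma Neg_unique:
  assumes "f \<in> Arr C" "g \<in> Arr C" "Dom C g = Dom C f" "Cod C g = Cod C f"
    "Add C f g = Zero C (Dom C f) (Cod C f)"
  shows "g = Neg C f"
proof -
  interpret abelian_group "hom_group C (Dom C f) (Cod C f)" using Hom_abelian_group assms by simp
  show ?thesis
    using minus_equality[of g f] assms Add_commute[of f g] by (auto simp: Hom_iff Neg_def)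
qed

lemma Comp_Add_arr [simp]:
  assumes "f \<in> Arr C" "f' \<in> Arr C" "g \<in> Arr C" "Dom C f' = Dom C f" "Cod C f' = Cod C f"
    "Dom C g = Cod C f"
  shows "g \<cdot> Add C f f' = Add C (g \<cdot> f) (g \<cdot> f')"
  using Comp_Add_right[of f "Dom C f" "Cod C f" f' g "Cod C g"] assms by (simp add: Hom_iff)

lemma Add_Comp_arr [simp]:
  assumes "f \<in> Arr C" "g' \<in> Arr C" "g \<in> Arr C" "Dom C g' = Dom C g" "Cod C g' = Cod C g"
    "Dom C g = Cod C f"
  shows "Add C g g' \<cdot> f = Add C (g \<cdot> f) (g' \<cdot> f)"
  using Comp_Add_left[of f "Dom C f" "Cod C f" g "Cod C g" g'] assms by (simp add: Hom_iff)

lemma post_comp_hom: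
  assumes "g \<in> Hom C Y Z" "X \<in> Obj C"
  shows "abelian_group_hom (hom_group C X Y) (hom_group C X Z) (\<lambda>f. g \<cdot> f)"
proof (rule abelian_group_homI')
qed (use assms HomD[OF assms(1)] in \<open>simp_all add: Hom_abelian_group Hom_iff\<close>)

lemma pre_comp_hom:
  assumes "f \<in> Hom C X Y" "Z \<in> Obj C"
  shows "abelian_group_hom (hom_group C Y Z) (hom_group C X Z) (\<lambda>g. g \<cdot> f)"
proof (rule abelian_group_homI')
qed (use assms HomD[OF assms(1)] in \<open>simp_all add: Hom_abelian_group Hom_iff\<close>)

lemma Comp_Zero_arr [simp]:
  assumes "g \<in> Arr C" "X \<in> Obj C" "Dom C g = Y"
  shows "g \<cdot> Zero C X Y = Zero C X (Cod C g)"
  using abelian_group_hom.hom_zero[OF post_comp_hom[of g Y "Cod C g" X]] assms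
  by (simp add: Hom_iff)

lemma Zero_Comp_arr [simp]:
  assumes "f \<in> Arr C" "Z \<in> Obj C" "Cod C f = Y"
  shows "Zero C Y Z \<cdot> f = Zero C (Dom C f) Z"
  using abelian_group_hom.hom_zero[OF pre_comp_hom[of f "Dom C f" Y Z]] assms
  by (simp add: Hom_iff)

lemma Comp_Neg_arr [simp]:
  assumes "f \<in> Arr C" "g \<in> Arr C" "Dom C g = Cod C f"
  shows "g \<cdot> Neg C f = Neg C (g \<cdot> f)"
  using Neg_unique[of "g \<cdot> f" "g \<cdot> Neg C f"] Comp_Add_arr[of f "Neg C f" g] assms by simp

lemma Neg_Comp_arr [simp]:
  assumes "f \<in> Arr C" "g \<in> Arr C" "Dom C g = Cod C f"
  shows "Neg C g \<cdot> f = Neg C (g \<cdot> f)"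
  using Neg_unique[of "g \<cdot> f" "Neg C g \<cdot> f"] Add_Comp_arr[of f "Neg C g" g] assms by simp

lemma Neg_Zero [simp]: "\<lbrakk>X \<in> Obj C; Y \<in> Obj C\<rbrakk> \<Longrightarrow> Neg C (Zero C X Y) = Zero C X Y"
  by (rule Neg_unique[symmetric]) simp_all

lemma Neg_eq_Zero_iff:
  assumes "f \<in> Arr C" "Dom C f = X" "Cod C f = Y"
  shows "Neg C f = Zero C X Y \<longleftrightarrow> f = Zero C X Y"
  using assms Neg_Neg[of f] Neg_Zero[of X Y] Dom_in_Obj[of f] Cod_in_Obj[of f] by metis

lemma eq_if_diff_Zero:
  assumes "f \<in> Arr C" "g \<in> Arr C" "Dom C g = Dom C f" "Cod C g = Cod C f"
    "Add C f (Neg C g) = Zero C (Dom C f) (Cod C f)"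
  shows "f = g"
  using Neg_unique[of f "Neg C g"] assms by (metis Neg_Neg arr_Neg)

text \<open>Rotating a triangle changes the sign of a map. Exactness is phrased through images, and
  since \<open>y\<close> may be replaced by its negative, the image does not see the sign.\<close>

lemma image_Comp_Neg:
  assumes "f \<in> Hom C X Y"
  shows "(\<lambda>y. y \<cdot> Neg C f) ` Hom C Y W = (\<lambda>y. y \<cdot> f) ` Hom C Y W"
proof safe
  note f = HomD[OF assms]
  fix y assume y: "y \<in> Hom C Y W"
  note y' = HomD[OF y]
  show "y \<cdot> Neg C f \<in> (\<lambda>y. y \<cdot> f) ` Hom C Y W"
    by (rule image_eqI[of _ _ "Neg C y"]) (use f y' in \<open>simp_all add: Hom_iff\<close>)
  show "y \<cdot> f \<in> (\<lambda>y. y \<cdot> Neg C f) ` Hom C Y W"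
    by (rule image_eqI[of _ _ "Neg C y"]) (use f y' in \<open>simp_all add: Hom_iff\<close>)
qed

end

text \<open>Stated outside every locale so that it serves both the shift of one category and a
  functor between two. Zero morphisms and negatives are preserved because the functor is a group
  homomorphism on each hom group.\<close>

lemma additive_functor_arr:
  assumes "additive_functor C C' F" "additive_category C" "additive_category C'"
  shows "X \<in> Obj C \<Longrightarrow> omap F X \<in> Obj C'"
    "f \<in> Arr C \<Longrightarrow> amap F f \<in> Arr C'"
    "f \<in> Arr C \<Longrightarrow> Dom C' (amap F f) = omap F (Dom C f)"
    "f \<in> Arr C \<Longrightarrow> Cod C' (amap F f) = omap F (Cod C f)"
    "X \<in> Obj C \<Longrightarrow> amap F (Ide C X) = Ide C' (omap F X)"
    "\<lbrakk>f \<in> Arr C; g \<in> Arr C; Dom C g = Cod C f\<rbrakk>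
      \<Longrightarrow> amap F (g \<cdot>\<^bsub>C\<^esub> f) = amap F g \<cdot>\<^bsub>C'\<^esub> amap F f"
    "\<lbrakk>f \<in> Arr C; g \<in> Arr C; Dom C g = Dom C f; Cod C g = Cod C f\<rbrakk>
      \<Longrightarrow> amap F (Add C f g) = Add C' (amap F f) (amap F g)"
    "\<lbrakk>X \<in> Obj C; Y \<in> Obj C\<rbrakk> \<Longrightarrow> amap F (Zero C X Y) = Zero C' (omap F X) (omap F Y)"
    "f \<in> Arr C \<Longrightarrow> amap F (Neg C f) = Neg C' (amap F f)"
proof -
  interpret C: additive_category C by fact
  interpret C': additive_category C' by fact
  have fn: "is_functor C C' F" using assms(1) by (simp add: additive_functor_def)
  show O: "X \<in> Obj C \<Longrightarrow> omap F X \<in> Obj C'" for X using fn by (simp add: is_functor_def)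
  have H: "f \<in> Arr C \<Longrightarrow> amap F f \<in> Hom C' (omap F (Dom C f)) (omap F (Cod C f))" for f
  proof -
    assume f: "f \<in> Arr C"
    then have "f \<in> Hom C (Dom C f) (Cod C f)" by (simp add: Hom_iff)
    with f fn show ?thesis
      unfolding is_functor_def using C.Dom_in_Obj C.Cod_in_Obj by blast
  qed
  show arr: "f \<in> Arr C \<Longrightarrow> amap F f \<in> Arr C'"
    "f \<in> Arr C \<Longrightarrow> Dom C' (amap F f) = omap F (Dom C f)"
    "f \<in> Arr C \<Longrightarrow> Cod C' (amap F f) = omap F (Cod C f)" for f
    using H[of f] by (auto simp: Hom_iff)
  show "X \<in> Obj C \<Longrightarrow> amap F (Ide C X) = Ide C' (omap F X)"
    using fn by (simp add: is_functor_def)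
  show "amap F (g \<cdot>\<^bsub>C\<^esub> f) = amap F g \<cdot>\<^bsub>C'\<^esub> amap F f"
    if "f \<in> Arr C" "g \<in> Arr C" "Dom C g = Cod C f"
  proof -
    have "f \<in> Hom C (Dom C f) (Cod C f)" "g \<in> Hom C (Cod C f) (Cod C g)"
      using that by (auto simp: Hom_iff)
    then show ?thesis using fn unfolding is_functor_def by blast
  qed
  show A: "amap F (Add C f g) = Add C' (amap F f) (amap F g)"
    if "f \<in> Arr C" "g \<in> Arr C" "Dom C g = Dom C f" "Cod C g = Cod C f" for f g
  proof -
    have "f \<in> Hom C (Dom C f) (Cod C f)" "g \<in> Hom C (Dom C f) (Cod C f)"
      using that by (auto simp: Hom_iff)
    then show ?thesis
      using assms(1) that C.Dom_in_Obj C.Cod_in_Obj unfolding additive_functor_def by blast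
  qed
  show Z: "amap F (Zero C X Y) = Zero C' (omap F X) (omap F Y)"
    if "X \<in> Obj C" "Y \<in> Obj C" for X Y
  proof -
    have *: "abelian_group_hom (hom_group C X Y) (hom_group C' (omap F X) (omap F Y)) (amap F)"
      using that arr A O
      by (intro abelian_group_homI' C.Hom_abelian_group C'.Hom_abelian_group) (auto simp: Hom_iff)
    then show ?thesis using abelian_group_hom.hom_zero[OF *] by simp
  qed
  show "f \<in> Arr C \<Longrightarrow> amap F (Neg C f) = Neg C' (amap F f)"
    by (rule C'.Neg_unique) (simp_all add: arr A[symmetric] Z)
qed

section \<open>Triangulated categories\<close>

text \<open>The usual diagram chase. The outer vertical maps are just bijections that commute with
  the horizontal ones; all the additivity that the chase takes from them is that \<open>t4\<close>
  and \<open>t5\<close> preserve zero. Exactness has the shape of \<open>contra_exact\<close> and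
  \<open>cov_exact\<close>, which feed it.\<close>

lemma five_lemma:
  assumes a: "abelian_group_hom A1 A2 a1" "abelian_group_hom A2 A3 a2" "abelian_group_hom A3 A4 a3"
    "abelian_group_hom A4 A5 a4"
    and b: "abelian_group_hom B1 B2 b1" "abelian_group_hom B2 B3 b2" "abelian_group_hom B3 B4 b3"
    "abelian_group_hom B4 B5 b4"
    and t3: "abelian_group_hom A3 B3 t3"
    and t: "bij_betw t1 (carrier A1) (carrier B1)" "bij_betw t2 (carrier A2) (carrier B2)"
    "bij_betw t4 (carrier A4) (carrier B4)" "bij_betw t5 (carrier A5) (carrier B5)"
    and sq: "\<And>x. x \<in> carrier A1 \<Longrightarrow> t2 (a1 x) = b1 (t1 x)"
    "\<And>x. x \<in> carrier A2 \<Longrightarrow> t3 (a2 x) = b2 (t2 x)"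
    "\<And>x. x \<in> carrier A3 \<Longrightarrow> t4 (a3 x) = b3 (t3 x)"
    "\<And>x. x \<in> carrier A4 \<Longrightarrow> t5 (a4 x) = b4 (t4 x)"
    and t_zero: "t4 \<zero>\<^bsub>A4\<^esub> = \<zero>\<^bsub>B4\<^esub>" "t5 \<zero>\<^bsub>A5\<^esub> = \<zero>\<^bsub>B5\<^esub>"
    and exA: "\<And>x. x \<in> carrier A2 \<Longrightarrow> a2 x = \<zero>\<^bsub>A3\<^esub> \<longleftrightarrow> x \<in> a1 ` carrier A1"
    "\<And>x. x \<in> carrier A3 \<Longrightarrow> a3 x = \<zero>\<^bsub>A4\<^esub> \<longleftrightarrow> x \<in> a2 ` carrier A2"
    "\<And>x. x \<in> carrier A4 \<Longrightarrow> a4 x = \<zero>\<^bsub>A5\<^esub> \<longleftrightarrow> x \<in> a3 ` carrier A3"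
    and exB: "\<And>x. x \<in> carrier B2 \<Longrightarrow> b2 x = \<zero>\<^bsub>B3\<^esub> \<longleftrightarrow> x \<in> b1 ` carrier B1"
    "\<And>x. x \<in> carrier B3 \<Longrightarrow> b3 x = \<zero>\<^bsub>B4\<^esub> \<longleftrightarrow> x \<in> b2 ` carrier B2"
    "\<And>x. x \<in> carrier B4 \<Longrightarrow> b4 x = \<zero>\<^bsub>B5\<^esub> \<longleftrightarrow> x \<in> b3 ` carrier B3"
  shows "bij_betw t3 (carrier A3) (carrier B3)"
proof -
  interpret a1: abelian_group_hom A1 A2 a1 by fact
  interpret a2: abelian_group_hom A2 A3 a2 by fact
  interpret a3: abelian_group_hom A3 A4 a3 by fact
  interpret a4: abelian_group_hom A4 A5 a4 by fact
  interpret b1: abelian_group_hom B1 B2 b1 by fact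
  interpret b2: abelian_group_hom B2 B3 b2 by fact
  interpret b3: abelian_group_hom B3 B4 b3 by fact
  interpret b4: abelian_group_hom B4 B5 b4 by fact
  interpret t3: abelian_group_hom A3 B3 t3 by fact
  have inj: "inj_on t3 (carrier A3)"
  proof (rule abelian_group_hom_inj_on[OF t3])
    fix x assume x: "x \<in> carrier A3" "t3 x = \<zero>\<^bsub>B3\<^esub>"
    have "t4 (a3 x) = t4 \<zero>\<^bsub>A4\<^esub>" using x sq(3) t_zero by simp
    then have "a3 x = \<zero>\<^bsub>A4\<^esub>"
      using t(3) x a3.H.zero_closed unfolding bij_betw_def inj_on_def by auto
    then obtain y where y: "y \<in> carrier A2" "x = a2 y" using exA(2) x by blast
    have ty: "t2 y \<in> carrier B2" using y t(2) by (auto simp: bij_betw_def)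
    moreover have "b2 (t2 y) = \<zero>\<^bsub>B3\<^esub>" using sq(2) x y by simp
    ultimately obtain z where z: "z \<in> carrier B1" "t2 y = b1 z" using exB(1) by blast
    then obtain w where "w \<in> carrier A1" "z = t1 w"
      using t(1) unfolding bij_betw_def by blast
    with z have w: "w \<in> carrier A1" "t2 y = b1 (t1 w)" by auto
    then have "t2 y = t2 (a1 w)" using sq(1) by simp
    then have "y = a1 w" using t(2) y w by (auto simp: bij_betw_def inj_on_def)
    then show "x = \<zero>\<^bsub>A3\<^esub>" using exA(1) y w by auto
  qed
  have "z \<in> t3 ` carrier A3" if z: "z \<in> carrier B3" for z
  proof -
    obtain w where w: "w \<in> carrier A4" "b3 z = t4 w"
      using t(3) b3.hom_closed[OF z] unfolding bij_betw_def by blast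
    have "b4 (b3 z) = \<zero>\<^bsub>B5\<^esub>" using exB(3) z by auto
    then have "t5 (a4 w) = t5 \<zero>\<^bsub>A5\<^esub>" using sq(4) w t_zero by simp
    then have "a4 w = \<zero>\<^bsub>A5\<^esub>"
      using t(4) w a4.H.zero_closed unfolding bij_betw_def inj_on_def by auto
    then obtain v where v: "v \<in> carrier A3" "w = a3 v" using exA(3) w by blast
    \<comment> \<open>The lift \<open>v\<close> of the image of \<open>z\<close> is off by
      \<open>?d\<close>, which dies in \<open>B4\<close>, hence comes from \<open>B2\<close> and
      through \<open>t2\<close> from \<open>A2\<close>.\<close>
    let ?d = "z \<oplus>\<^bsub>B3\<^esub> \<ominus>\<^bsub>B3\<^esub> t3 v"
    have "b3 ?d = \<zero>\<^bsub>B4\<^esub>"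
      using v z w sq(3) by (simp add: b3.H.r_neg)
    then obtain y where y: "y \<in> carrier B2" "?d = b2 y"
      using exB(2)[of ?d] z v by auto
    then obtain y' where y': "y' \<in> carrier A2" "y = t2 y'"
      using t(2) unfolding bij_betw_def by blast
    have "t3 (a2 y' \<oplus>\<^bsub>A3\<^esub> v) = ?d \<oplus>\<^bsub>B3\<^esub> t3 v" using y y' v sq(2) by simp
    also have "\<dots> = z" using z v by (simp add: b2.H.a_assoc b2.H.l_neg)
    finally show ?thesis using y' v by (metis a2.H.a_closed a2.hom_closed imageI)
  qed
  with inj show ?thesis by (auto simp: bij_betw_def)
qed

text \<open>\<open>Dist\<close> stores bare morphism triples; with the vertices as arguments,
  rotations, maps of triangles and hom sequences can be stated without recovering them.\<close>

definition triangle ::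
  "('o, 'm, 'z) tricat_scheme \<Rightarrow> 'o \<Rightarrow> 'o \<Rightarrow> 'o \<Rightarrow> 'm \<Rightarrow> 'm \<Rightarrow> 'm \<Rightarrow> bool" where
  "triangle C X Y Z f g h \<longleftrightarrow>
    (f, g, h) \<in> Dist C \<and> f \<in> Hom C X Y \<and> g \<in> Hom C Y Z \<and> h \<in> Hom C Z (shO C X)"

section \<open>Rotation and long exact hom sequences\<close>

context triangulated_category
begin

lemmas Shift_arr [simp] =
  additive_functor_arr[OF Shift_functor additive_category_axioms additive_category_axioms]

lemma shO_inj: "\<lbrakk>shO C X = shO C Y; X \<in> Obj C; Y \<in> Obj C\<rbrakk> \<Longrightarrow> X = Y"
  using Shift_bij_Obj by (auto simp: bij_betw_def inj_on_def)

lemma shO_surj: "Y \<in> Obj C \<Longrightarrow> \<exists>X \<in> Obj C. Y = shO C X"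
  using Shift_bij_Obj by (auto simp: bij_betw_def)

lemma shA_inj: "\<lbrakk>shA C f = shA C g; f \<in> Arr C; g \<in> Arr C\<rbrakk> \<Longrightarrow> f = g"
  using Shift_bij_Arr by (auto simp: bij_betw_def inj_on_def)

text \<open>Bijectivity on arrows yields a preimage with unknown ends; injectivity of the shift on
  objects identifies them with \<open>X\<close> and \<open>Y\<close>. This is what allows a morphism
  to be desuspended.\<close>

lemma shA_surj:
  assumes "g \<in> Hom C (shO C X) (shO C Y)" "X \<in> Obj C" "Y \<in> Obj C"
  shows "\<exists>f \<in> Hom C X Y. g = shA C f"
proof -
  obtain f where f: "f \<in> Arr C" "g = shA C f"
    using assms(1) Shift_bij_Arr by (auto simp: bij_betw_def Hom_iff)
  then show ?thesis
    using assms shO_inj[of "Dom C f" X] shO_inj[of "Cod C f" Y] by (auto simp: Hom_iff)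
qed

lemma bij_betw_shA:
  assumes "X \<in> Obj C" "Y \<in> Obj C"
  shows "bij_betw (shA C) (Hom C X Y) (Hom C (shO C X) (shO C Y))"
  unfolding bij_betw_def
proof
  show "inj_on (shA C) (Hom C X Y)" by (auto intro!: inj_onI shA_inj simp: Hom_iff)
  show "shA C ` Hom C X Y = Hom C (shO C X) (shO C Y)"
    using shA_surj[OF _ assms] by (auto simp: Hom_iff image_iff Bex_def)
qed

lemma shA_eq_Zero:
  "\<lbrakk>f \<in> Hom C X Y; shA C f = Zero C (shO C X) (shO C Y)\<rbrakk> \<Longrightarrow> f = Zero C X Y"
  using shA_inj[of f "Zero C X Y"] HomD[of f X Y] by simp

lemma zero_object_shO: "zero_object C Z \<Longrightarrow> zero_object C (shO C Z)"
  unfolding zero_object_def using Shift_arr(5)[of Z] by simp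

lemma triangleD:
  assumes "triangle C X Y Z f g h"
  shows "(f, g, h) \<in> Dist C" "f \<in> Hom C X Y" "g \<in> Hom C Y Z" "h \<in> Hom C Z (shO C X)"
    "f \<in> Arr C" "g \<in> Arr C" "h \<in> Arr C" "Dom C f = X" "Cod C f = Y" "Dom C g = Y" "Cod C g = Z"
    "Dom C h = Z" "Cod C h = shO C X" "X \<in> Obj C" "Y \<in> Obj C" "Z \<in> Obj C"
proof -
  have t: "(f, g, h) \<in> Dist C" "f \<in> Hom C X Y" "g \<in> Hom C Y Z" "h \<in> Hom C Z (shO C X)"
    using assms by (auto simp: triangle_def)
  show "(f, g, h) \<in> Dist C" "f \<in> Hom C X Y" "g \<in> Hom C Y Z" "h \<in> Hom C Z (shO C X)"
    "f \<in> Arr C" "g \<in> Arr C" "h \<in> Arr C" "Dom C f = X" "Cod C f = Y" "Dom C g = Y" "Cod C g = Z"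
    "Dom C h = Z" "Cod C h = shO C X" "X \<in> Obj C" "Y \<in> Obj C" "Z \<in> Obj C"
    using t HomD[OF t(2)] HomD[OF t(3)] HomD[OF t(4)] by blast+
qed

lemma Dist_iff_triangle: "(f, g, h) \<in> Dist C \<longleftrightarrow> (\<exists>X Y Z. triangle C X Y Z f g h)"
  using Dist_triangle[of f g h] by (auto simp: triangle_def)

lemma triangle_cone: "f \<in> Hom C X Y \<Longrightarrow> \<exists>Z g h. triangle C X Y Z f g h"
  using TR1_cone[of f X Y] Dist_triangle unfolding triangle_def Hom_iff by metis

lemma triangle_rotate_iff:
  assumes "f \<in> Hom C X Y" "g \<in> Hom C Y Z" "h \<in> Hom C Z (shO C X)"
  shows "triangle C X Y Z f g h \<longleftrightarrow> triangle C Y Z (shO C X) g h (Neg C (shA C f))"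
proof -
  have "shA C f \<in> Hom C (shO C X) (shO C Y)" using assms by (auto simp: Hom_iff)
  then show ?thesis
    using TR2[OF assms] assms a_inv_Neg[of "shA C f" "shO C X" "shO C Y"]
    by (auto simp: triangle_def Hom_iff)
qed

lemma triangle_rotate:
  "triangle C X Y Z f g h \<Longrightarrow> triangle C Y Z (shO C X) g h (Neg C (shA C f))"
  using triangle_rotate_iff[of f X Y g Z h] triangleD(2,3,4) by blast

lemma triangle_Ide:
  "\<lbrakk>X \<in> Obj C; zero_object C Z\<rbrakk> \<Longrightarrow> triangle C X X Z (Ide C X) (Zero C X Z) (Zero C Z (shO C X))"
  using TR1_Ide[of X Z] by (simp add: triangle_def Hom_iff zero_object_def)

text \<open>The rotation of this triangle is the identity triangle on \<open>X\<close> with third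
  vertex \<open>shO C Z\<close>, again a zero object.\<close>

lemma triangle_Ide':
  assumes "X \<in> Obj C" "zero_object C Z"
  shows "triangle C Z X X (Zero C Z X) (Ide C X) (Zero C X (shO C Z))"
proof -
  have Z: "Z \<in> Obj C" using assms by (simp add: zero_object_def)
  have "triangle C X X (shO C Z) (Ide C X) (Zero C X (shO C Z)) (Zero C (shO C Z) (shO C X))"
    using triangle_Ide[OF assms(1) zero_object_shO[OF assms(2)]] .
  then show ?thesis
    using assms Z by (subst triangle_rotate_iff) (auto simp: Hom_iff)
qed

lemma triangle_map:
  assumes "triangle C X Y Z f g h" "triangle C X' Y' Z' f' g' h'"
    and "a \<in> Hom C X X'" "b \<in> Hom C Y Y'" "b \<cdot> f = f' \<cdot> a"
  shows "\<exists>c \<in> Hom C Z Z'. c \<cdot> g = g' \<cdot> b \<and> shA C a \<cdot> h = h' \<cdot> c"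
  using assms TR3[of f g h f' g' h' X Y Z X' Y' Z' a b] by (auto simp: triangle_def)

text \<open>The pair \<open>Ide C X\<close>, \<open>f\<close> maps the identity triangle on
  \<open>X\<close> to the given one, so \<open>g \<cdot> f\<close> factors through a zero
  object.\<close>

lemma triangle_Comp_Zero:
  assumes "triangle C X Y Z f g h"
  shows "g \<cdot> f = Zero C X Z"
proof -
  note t = triangleD[OF assms]
  obtain N where N: "zero_object C N" using ex_zero_object by blast
  then have N': "N \<in> Obj C" by (simp add: zero_object_def)
  obtain c where "c \<in> Hom C N Z" "c \<cdot> Zero C X N = g \<cdot> f"
    using triangle_map[OF triangle_Ide[OF t(14) N] assms, of "Ide C X" f] t
    by (auto simp: Hom_iff)
  then show ?thesis using t N' by (auto simp: Hom_iff)
qed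

text \<open>If \<open>y \<cdot> f\<close> vanishes, then a zero map and \<open>y\<close> are the
  first two components of a map to the triangle of \<open>triangle_Ide'\<close> on \<open>W\<close>;
  the third component, from TR3, is the wanted factorization through \<open>g\<close>.\<close>

lemma contra_exact:
  assumes "triangle C X Y Z f g h" "y \<in> Hom C Y W"
  shows "y \<cdot> f = Zero C X W \<longleftrightarrow> y \<in> (\<lambda>z. z \<cdot> g) ` Hom C Z W"
proof
  note t = triangleD[OF assms(1)]
  note y = HomD[OF assms(2)]
  assume *: "y \<cdot> f = Zero C X W"
  obtain N where N: "zero_object C N" using ex_zero_object by blast
  then have N': "N \<in> Obj C" by (simp add: zero_object_def)
  have W: "W \<in> Obj C" using y by simp
  have "Zero C X N \<in> Hom C X N" "y \<cdot> f = Zero C N W \<cdot> Zero C X N"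
    using t(14) N' W * by (simp_all add: Hom_iff)
  then obtain c where "c \<in> Hom C Z W" "c \<cdot> g = Ide C W \<cdot> y"
    using triangle_map[OF assms(1) triangle_Ide'[OF W N], of "Zero C X N" y] assms(2) by blast
  then show "y \<in> (\<lambda>z. z \<cdot> g) ` Hom C Z W" using y by auto
next
  note t = triangleD[OF assms(1)]
  assume "y \<in> (\<lambda>z. z \<cdot> g) ` Hom C Z W"
  then obtain z where "z \<in> Hom C Z W" "y = z \<cdot> g" by blast
  then show "y \<cdot> f = Zero C X W"
    using t HomD[of z Z W] triangle_Comp_Zero[OF assms(1)] by simp
qed

text \<open>TR3 supplies the third component of a map of triangles, while here the first is wanted.
  Rotating the identity triangle on \<open>W\<close> and the given triangle puts the missing map in
  third place, in shifted form, and \<open>shA_surj\<close> shifts it back.\<close>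

lemma cov_exact:
  assumes "triangle C X Y Z f g h" "y \<in> Hom C W Y"
  shows "g \<cdot> y = Zero C W Z \<longleftrightarrow> y \<in> (\<lambda>x. f \<cdot> x) ` Hom C W X"
proof
  note t = triangleD[OF assms(1)]
  note y = HomD[OF assms(2)]
  assume *: "g \<cdot> y = Zero C W Z"
  obtain N where N: "zero_object C N" using ex_zero_object by blast
  then have N': "N \<in> Obj C" by (simp add: zero_object_def)
  have W: "W \<in> Obj C" using y by simp
  have "Zero C N Z \<in> Hom C N Z" "Zero C N Z \<cdot> Zero C W N = g \<cdot> y"
    using t(16) N' W * by (simp_all add: Hom_iff)
  then obtain c where c: "c \<in> Hom C (shO C W) (shO C X)"
      "shA C y \<cdot> Neg C (shA C (Ide C W)) = Neg C (shA C f) \<cdot> c"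
    using triangle_map[OF triangle_rotate[OF triangle_Ide[OF W N]] triangle_rotate[OF assms(1)],
        of y "Zero C N Z"] assms(2) by blast
  obtain x where x: "x \<in> Hom C W X" "c = shA C x"
    using shA_surj[OF c(1)] t y by auto
  have x': "x \<in> Arr C" "Dom C x = W" "Cod C x = X" using x by (auto simp: Hom_iff)
  have "Neg C (shA C y) = Neg C (shA C (f \<cdot> x))"
    using c(2) x(2) x' t y by simp
  then have "shA C y = shA C (f \<cdot> x)"
    using t x' y by (metis Neg_Neg arr_Comp(1) Shift_arr(2))
  then have "y = f \<cdot> x" by (rule shA_inj) (use t x' y in auto)
  then show "y \<in> (\<lambda>x. f \<cdot> x) ` Hom C W X" using x by blast
next
  note t = triangleD[OF assms(1)]
  assume "y \<in> (\<lambda>x. f \<cdot> x) ` Hom C W X"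
  then obtain x where x: "x \<in> Hom C W X" "y = f \<cdot> x" by blast
  then show "g \<cdot> y = Zero C W Z"
    using t HomD[of x W X] Comp_reassoc[OF triangle_Comp_Zero[OF assms(1)], of x] by simp
qed

text \<open>Two further places of the same sequence, obtained by rotating. The second rotation
  introduces the negative of \<open>shA C f\<close>, which has the same kernel as
  \<open>shA C f\<close>.\<close>

lemma cov_exact':
  assumes "triangle C X Y Z f g h"
  shows "z \<in> Hom C W Z \<Longrightarrow> h \<cdot> z = Zero C W (shO C X) \<longleftrightarrow> z \<in> (\<lambda>y. g \<cdot> y) ` Hom C W Y"
    and "x \<in> Hom C W (shO C X) \<Longrightarrow>
      shA C f \<cdot> x = Zero C W (shO C Y) \<longleftrightarrow> x \<in> (\<lambda>z. h \<cdot> z) ` Hom C W Z"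
proof -
  note t = triangleD[OF assms]
  show "z \<in> Hom C W Z \<Longrightarrow> h \<cdot> z = Zero C W (shO C X) \<longleftrightarrow> z \<in> (\<lambda>y. g \<cdot> y) ` Hom C W Y"
    using cov_exact[OF triangle_rotate[OF assms], of z W] .
  assume x: "x \<in> Hom C W (shO C X)"
  have "shA C f \<cdot> x = Zero C W (shO C Y) \<longleftrightarrow> Neg C (shA C f) \<cdot> x = Zero C W (shO C Y)"
    using t HomD[OF x] by (simp add: Neg_eq_Zero_iff)
  then show "shA C f \<cdot> x = Zero C W (shO C Y) \<longleftrightarrow> x \<in> (\<lambda>z. h \<cdot> z) ` Hom C W Z"
    using cov_exact[OF triangle_rotate[OF triangle_rotate[OF assms]] x] by simp
qed

lemma contra_exact':
  assumes "triangle C X Y Z f g h"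
  shows "z \<in> Hom C Z W \<Longrightarrow> z \<cdot> g = Zero C Y W \<longleftrightarrow> z \<in> (\<lambda>x. x \<cdot> h) ` Hom C (shO C X) W"
    and "x \<in> Hom C (shO C X) W \<Longrightarrow>
      x \<cdot> h = Zero C Z W \<longleftrightarrow> x \<in> (\<lambda>y. y \<cdot> shA C f) ` Hom C (shO C Y) W"
proof -
  note t = triangleD[OF assms]
  show "z \<in> Hom C Z W \<Longrightarrow> z \<cdot> g = Zero C Y W \<longleftrightarrow> z \<in> (\<lambda>x. x \<cdot> h) ` Hom C (shO C X) W"
    using contra_exact[OF triangle_rotate[OF assms], of z W] .
  assume x: "x \<in> Hom C (shO C X) W"
  have "shA C f \<in> Hom C (shO C X) (shO C Y)" using t by (simp add: Hom_iff)
  then show "x \<cdot> h = Zero C Z W \<longleftrightarrow> x \<in> (\<lambda>y. y \<cdot> shA C f) ` Hom C (shO C Y) W"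
    using contra_exact[OF triangle_rotate[OF triangle_rotate[OF assms]] x]
    by (simp add: image_Comp_Neg)
qed

text \<open>The biproducts of the additive structure come without a triangle, yet closure of a
  subcategory is known only for shifts and cones. So a biproduct of \<open>X\<close> and
  \<open>shO C Y\<close> is built here from the cone of the zero map from \<open>Y\<close> to
  \<open>X\<close>; exactness splits both \<open>i\<close> and \<open>q\<close>.\<close>

lemma biproduct_triangle:
  assumes X: "X \<in> Obj C" and Y: "Y \<in> Obj C"
  shows "\<exists>P i j p q.
    triangle C X P (shO C Y) i q (Zero C (shO C Y) (shO C X)) \<and>
    i \<in> Hom C X P \<and> j \<in> Hom C (shO C Y) P \<and> p \<in> Hom C P X \<and> q \<in> Hom C P (shO C Y) \<and>
    p \<cdot> i = Ide C X \<and> q \<cdot> j = Ide C (shO C Y) \<and>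
    p \<cdot> j = Zero C (shO C Y) X \<and> q \<cdot> i = Zero C X (shO C Y) \<and>
    Add C (i \<cdot> p) (j \<cdot> q) = Ide C P"
proof -
  obtain P i q where T: "triangle C Y X P (Zero C Y X) i q"
    using triangle_cone[of "Zero C Y X" Y X] X Y by (auto simp: Hom_iff)
  have T': "triangle C X P (shO C Y) i q (Zero C (shO C Y) (shO C X))"
    using triangle_rotate[OF T] X Y by simp
  note t = triangleD[OF T]
  have qi: "q \<cdot> i = Zero C X (shO C Y)" using triangle_Comp_Zero[OF T'] .
  obtain p where p: "p \<in> Hom C P X" "p \<cdot> i = Ide C X"
    using contra_exact[OF T, of "Ide C X" X] X Y by (auto simp: Hom_iff)
  obtain k where k: "k \<in> Hom C (shO C Y) P" "q \<cdot> k = Ide C (shO C Y)"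
    using cov_exact[OF triangle_rotate[OF T'], of "Ide C (shO C Y)" "shO C Y"]
      cov_exact'(1)[OF T', of "Ide C (shO C Y)" "shO C Y"] X Y by (auto simp: Hom_iff)
  note h = HomD[OF p(1)] HomD[OF k(1)]
  \<comment> \<open>A section \<open>k\<close> of \<open>q\<close> need not be killed by
    \<open>p\<close>; subtracting its component along \<open>i\<close> corrects this without
    changing \<open>q \<cdot> k\<close>, because \<open>q \<cdot> i\<close> vanishes.\<close>
  let ?j = "Add C k (Neg C (i \<cdot> (p \<cdot> k)))"
  have j: "?j \<in> Hom C (shO C Y) P" using h t by (auto simp: Hom_iff)
  have pj: "p \<cdot> ?j = Zero C (shO C Y) X"
    using h t p Comp_reassoc[OF p(2), of "p \<cdot> k"] by simp
  have qj: "q \<cdot> ?j = Ide C (shO C Y)"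
    using h t k qi Comp_reassoc[OF qi, of "p \<cdot> k"] X Y by simp
  define e where "e = Add C (i \<cdot> p) (?j \<cdot> q)"
  have e: "e \<in> Hom C P P" using h t j by (auto simp: Hom_iff e_def)
  have j': "?j \<in> Arr C" "Dom C ?j = shO C Y" "Cod C ?j = P" using HomD[OF j] by auto
  have e': "e = Add C (i \<cdot> p) (?j \<cdot> q)" "e \<in> Arr C" "Dom C e = P" "Cod C e = P"
    using HomD[OF e] by (auto simp: e_def)
  have qe: "q \<cdot> e = q" and pe: "p \<cdot> e = p"
  proof -
    have "q \<cdot> e = Add C (q \<cdot> (i \<cdot> p)) (q \<cdot> (?j \<cdot> q))"
      unfolding e'(1) using h t j' by (intro Comp_Add_arr) auto
    also have "q \<cdot> (i \<cdot> p) = Zero C P (shO C Y)" using Comp_reassoc[OF qi, of p] h t by simp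
    also have "q \<cdot> (?j \<cdot> q) = q" using Comp_reassoc[OF qj, of q] h t j' by simp
    finally show "q \<cdot> e = q" using t by simp
    have "p \<cdot> e = Add C (p \<cdot> (i \<cdot> p)) (p \<cdot> (?j \<cdot> q))"
      unfolding e'(1) using h t j' by (intro Comp_Add_arr) auto
    also have "p \<cdot> (i \<cdot> p) = p" using Comp_reassoc[OF p(2), of p] h t by simp
    also have "p \<cdot> (?j \<cdot> q) = Zero C P X" using Comp_reassoc[OF pj, of q] h t j' by simp
    finally show "p \<cdot> e = p" using h by simp
  qed
  \<comment> \<open>The difference \<open>?d\<close> is killed by \<open>q\<close>, hence factors
    through \<open>i\<close>; it is also killed by \<open>p\<close>, which splits \<open>i\<close>,
    so the factor is zero.\<close>
  have "Ide C P = e"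
  proof -
    let ?d = "Add C (Ide C P) (Neg C e)"
    have d: "?d \<in> Hom C P P" using t e' by (simp add: Hom_iff)
    have "q \<cdot> ?d = Zero C P (shO C Y)" using qe t e' by simp
    then obtain r where r: "r \<in> Hom C P X" "i \<cdot> r = ?d"
      using cov_exact[OF T' d] by auto
    note r' = HomD[OF r(1)]
    have "p \<cdot> (i \<cdot> r) = p \<cdot> ?d" using r by simp
    moreover have "p \<cdot> ?d = Zero C P X" using pe h t e' by simp
    ultimately have "r = Zero C P X" using Comp_reassoc[OF p(2), of r] r' h t by simp
    then have "?d = Zero C P P" using r t(15) t(16) t(14) HomD[OF triangleD(2)[OF T']] by simp
    then show ?thesis using eq_if_diff_Zero[of "Ide C P" e] t(16) e'(2-4) by simp
  qed
  then have "Add C (i \<cdot> p) (?j \<cdot> q) = Ide C P" using e'(1) by simp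
  then show ?thesis
    using T' triangleD(2,3)[OF T'] p j pj qj qi by blast
qed

end

section \<open>Full triangulated subcategories\<close>

lemma full_sub_simps [simp]:
  "Obj (full_sub C S) = Obj C \<inter> S"
  "Arr (full_sub C S) = {f \<in> Arr C. Dom C f \<in> S \<and> Cod C f \<in> S}"
  "Dom (full_sub C S) = Dom C" "Cod (full_sub C S) = Cod C" "Ide (full_sub C S) = Ide C"
  "Comp (full_sub C S) = Comp C" "Add (full_sub C S) = Add C" "Zero (full_sub C S) = Zero C"
  "Shift (full_sub C S) = Shift C"
  "Dist (full_sub C S) = {(f, g, h) \<in> Dist C. Dom C f \<in> S \<and> Cod C f \<in> S \<and> Cod C g \<in> S}"
  by (simp_all add: full_sub_def)

lemma Hom_full_sub: "Hom (full_sub C S) X Y = (if X \<in> S \<and> Y \<in> S then Hom C X Y else {})"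
  by (auto simp: Hom_iff)

lemma Hom_full_sub_iff: "f \<in> Hom (full_sub C S) X Y \<longleftrightarrow> f \<in> Hom C X Y \<and> X \<in> S \<and> Y \<in> S"
  by (simp add: Hom_full_sub)

lemma Iso_full_sub_iff: "f \<in> Iso (full_sub C S) X Y \<longleftrightarrow> f \<in> Iso C X Y \<and> X \<in> S \<and> Y \<in> S"
  by (auto simp: Iso_def Hom_full_sub)

lemma hom_group_full_sub:
  "\<lbrakk>X \<in> S; Y \<in> S\<rbrakk> \<Longrightarrow> hom_group (full_sub C S) X Y = hom_group C X Y"
  by (simp add: hom_group_def Hom_full_sub)

lemma zero_object_full_sub: "zero_object (full_sub C S) Z \<longleftrightarrow> zero_object C Z \<and> Z \<in> S"
  by (auto simp: zero_object_def)

lemma category_full_sub: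
  fixes C :: "('o, 'm) tricat"
  assumes "category C"
  shows "category (full_sub C S)"
proof -
  interpret category C by fact
  show ?thesis
  proof
    fix f X Y g Z h W
    assume "f \<in> Hom (full_sub C S) X Y" "g \<in> Hom (full_sub C S) Y Z"
      "h \<in> Hom (full_sub C S) Z W"
    then show "h \<cdot>\<^bsub>full_sub C S\<^esub> g \<cdot>\<^bsub>full_sub C S\<^esub> f =
      h \<cdot>\<^bsub>full_sub C S\<^esub> (g \<cdot>\<^bsub>full_sub C S\<^esub> f)"
      using Comp_assoc by (auto simp: Hom_full_sub_iff)
  qed (auto simp: Hom_full_sub_iff Hom_iff)
qed

locale triangulated_subcat = triangulated_category C for C :: "('o, 'm) tricat" (structure) +
  fixes S :: "'o set"
  assumes sub: "triangulated_subcategory C S"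
begin

lemma sub_Obj [simp]: "X \<in> S \<Longrightarrow> X \<in> Obj C"
  using sub unfolding triangulated_subcategory_def strictly_full_def by blast

lemma Obj_Int [simp]: "Obj C \<inter> S = S"
  by auto

lemma sub_shift_iff: "X \<in> Obj C \<Longrightarrow> shO C X \<in> S \<longleftrightarrow> X \<in> S"
  using sub unfolding triangulated_subcategory_def by blast

lemma sub_shift [simp]: "X \<in> S \<Longrightarrow> shO C X \<in> S"
  by (simp add: sub_shift_iff)

lemma sub_cone: "\<lbrakk>triangle C X Y Z f g h; X \<in> S; Y \<in> S\<rbrakk> \<Longrightarrow> Z \<in> S"
  using sub triangleD[of X Y Z f g h] unfolding triangulated_subcategory_def by metis

text \<open>A zero object is the cone of an identity morphism, and \<open>S\<close> is
  nonempty.\<close>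

lemma sub_zero_object: "zero_object C Z \<Longrightarrow> Z \<in> S"
proof -
  assume Z: "zero_object C Z"
  obtain X where X: "X \<in> S" using sub by (auto simp: triangulated_subcategory_def)
  show ?thesis using sub_cone[OF triangle_Ide[OF _ Z] X X] X by simp
qed

text \<open>Writing \<open>Y\<close> as a shift makes \<open>biproduct_triangle\<close> applicable.
  Two rotations exhibit \<open>shO C P\<close> as the cone of a map from \<open>Y\<close> to
  \<open>shO C X\<close>; stability of \<open>S\<close> under the inverse shift then gives
  \<open>P\<close>.\<close>

lemma sub_biproduct:
  assumes "X \<in> S" "Y \<in> S"
  shows "\<exists>P \<in> S. \<exists>i \<in> Hom C X P. \<exists>j \<in> Hom C Y P. \<exists>p \<in> Hom C P X. \<exists>q \<in> Hom C P Y.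
    p \<cdot> i = Ide C X \<and> q \<cdot> j = Ide C Y \<and> p \<cdot> j = Zero C Y X \<and> q \<cdot> i = Zero C X Y \<and>
    Add C (i \<cdot> p) (j \<cdot> q) = Ide C P"
proof -
  obtain Y' where Y': "Y' \<in> Obj C" "Y = shO C Y'" using shO_surj[of Y] assms by auto
  then have "Y' \<in> S" using sub_shift_iff assms by auto
  obtain P i j p q where P:
    "triangle C X P Y i q (Zero C Y (shO C X))"
    "i \<in> Hom C X P" "j \<in> Hom C Y P" "p \<in> Hom C P X" "q \<in> Hom C P Y"
    "p \<cdot> i = Ide C X" "q \<cdot> j = Ide C Y" "p \<cdot> j = Zero C Y X" "q \<cdot> i = Zero C X Y"
    "Add C (i \<cdot> p) (j \<cdot> q) = Ide C P"
    using biproduct_triangle[of X Y'] assms Y' by auto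
  have "triangle C Y (shO C X) (shO C P) (Zero C Y (shO C X)) (Neg C (shA C i)) (Neg C (shA C q))"
    using triangle_rotate[OF triangle_rotate[OF P(1)]] .
  then have "shO C P \<in> S" using sub_cone assms sub_shift by blast
  then have "P \<in> S" using sub_shift_iff triangleD(15)[OF P(1)] by simp
  with P show ?thesis by blast
qed

lemma Dist_full_sub_iff:
  assumes "f \<in> Hom C X Y" "g \<in> Hom C Y Z"
  shows "(f, g, h) \<in> Dist (full_sub C S) \<longleftrightarrow> (f, g, h) \<in> Dist C \<and> X \<in> S \<and> Y \<in> S \<and> Z \<in> S"
  using assms by (auto simp: Hom_iff)

text \<open>Morphisms provided by the axioms run between objects already in \<open>S\<close>, so
  most axioms restrict at once. Closure of \<open>S\<close> matters for zero objects, biproducts and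
  cones, and for the shift to restrict to a bijection.\<close>

theorem triangulated_full_sub: "triangulated_category (full_sub C S)"
proof -
  let ?S = "full_sub C S"
  interpret S: category ?S using category_full_sub category_axioms .
  have "additive_category ?S"
  proof (rule additive_category.intro[OF S.category_axioms], rule additive_category_axioms.intro)
    fix X Y assume "X \<in> Obj ?S" "Y \<in> Obj ?S"
    then show "abelian_group (hom_group ?S X Y)"
      using Hom_abelian_group by (simp add: hom_group_full_sub)
  next
    show "\<exists>Z. zero_object ?S Z"
      using ex_zero_object sub_zero_object by (auto simp: zero_object_full_sub)
  next
    fix X Y assume XY: "X \<in> Obj ?S" "Y \<in> Obj ?S"
    then have "X \<in> S" "Y \<in> S" by auto
    with sub_biproduct[OF this]
    show "\<exists>P \<in> Obj ?S. \<exists>i \<in> Hom ?S X P. \<exists>j \<in> Hom ?S Y P. \<exists>p \<in> Hom ?S P X. \<exists>q \<in> Hom ?S P Y.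
      p \<cdot>\<^bsub>?S\<^esub> i = Ide ?S X \<and> q \<cdot>\<^bsub>?S\<^esub> j = Ide ?S Y \<and>
      p \<cdot>\<^bsub>?S\<^esub> j = Zero ?S Y X \<and> q \<cdot>\<^bsub>?S\<^esub> i = Zero ?S X Y \<and>
      Add ?S (i \<cdot>\<^bsub>?S\<^esub> p) (j \<cdot>\<^bsub>?S\<^esub> q) = Ide ?S P"
      by (simp add: Hom_full_sub cong: bex_cong)
  qed (auto simp: Hom_full_sub_iff Comp_Add_left Comp_Add_right)
  then interpret S: additive_category ?S .
  have fn: "is_functor C C (Shift C)" using Shift_functor by (simp add: additive_functor_def)
  show ?thesis
  proof
    show "additive_functor ?S ?S (Shift ?S)"
      unfolding additive_functor_def is_functor_def
      by (auto simp: Hom_full_sub_iff Hom_iff)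
    show "bij_betw (shO ?S) (Obj ?S) (Obj ?S)"
      unfolding bij_betw_def
    proof
      show "inj_on (shO ?S) (Obj ?S)" by (auto intro!: inj_onI shO_inj)
      have "Y \<in> shO C ` S" if "Y \<in> S" for Y
        using shO_surj[of Y] sub_shift_iff that by auto
      then show "shO ?S ` Obj ?S = Obj ?S" by auto
    qed
    show "bij_betw (shA ?S) (Arr ?S) (Arr ?S)"
      unfolding bij_betw_def
    proof
      show "inj_on (shA ?S) (Arr ?S)" by (auto intro!: inj_onI shA_inj)
      have "g \<in> shA C ` Arr ?S" if g: "g \<in> Arr C" "Dom C g \<in> S" "Cod C g \<in> S" for g
      proof -
        obtain f where f: "f \<in> Arr C" "g = shA C f"
          using g Shift_bij_Arr by (auto simp: bij_betw_def)
        then show ?thesis using g sub_shift_iff by (intro image_eqI[of _ _ f]) simp_all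
      qed
      then show "shA ?S ` Arr ?S = Arr ?S" by auto
    qed
  next
    fix f g h assume *: "(f, g, h) \<in> Dist ?S"
    then have D: "(f, g, h) \<in> Dist C" "Dom C f \<in> S" "Cod C f \<in> S" "Cod C g \<in> S" by auto
    obtain X Y Z where t: "f \<in> Hom C X Y" "g \<in> Hom C Y Z" "h \<in> Hom C Z (shO C X)"
      using Dist_triangle[OF D(1)] by blast
    then have "X \<in> S" "Y \<in> S" "Z \<in> S" using D by (auto simp: Hom_iff)
    then have "f \<in> Hom ?S X Y" "g \<in> Hom ?S Y Z" "h \<in> Hom ?S Z (shO ?S X)"
      using t by (simp_all add: Hom_full_sub_iff)
    then show "\<exists>X Y Z. f \<in> Hom ?S X Y \<and> g \<in> Hom ?S Y Z \<and> h \<in> Hom ?S Z (shO ?S X)" by blast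
  next
    fix X Z assume "X \<in> Obj ?S" "zero_object ?S Z"
    then show "(Ide ?S X, Zero ?S X Z, Zero ?S Z (shO ?S X)) \<in> Dist ?S"
      using TR1_Ide[of X Z] by (simp add: zero_object_full_sub)
  next
    fix f g h X Y Z f' X' Y' g' Z' h' a b c
    assume *: "(f, g, h) \<in> Dist ?S" "f \<in> Hom ?S X Y" "g \<in> Hom ?S Y Z" "h \<in> Hom ?S Z (shO ?S X)"
      "f' \<in> Hom ?S X' Y'" "g' \<in> Hom ?S Y' Z'" "h' \<in> Hom ?S Z' (shO ?S X')"
      "a \<in> Iso ?S X X'" "b \<in> Iso ?S Y Y'" "c \<in> Iso ?S Z Z'"
      "b \<cdot>\<^bsub>?S\<^esub> f = f' \<cdot>\<^bsub>?S\<^esub> a" "c \<cdot>\<^bsub>?S\<^esub> g = g' \<cdot>\<^bsub>?S\<^esub> b"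
      "shA ?S a \<cdot>\<^bsub>?S\<^esub> h = h' \<cdot>\<^bsub>?S\<^esub> c"
    have **: "(f, g, h) \<in> Dist C" "f \<in> Hom C X Y" "g \<in> Hom C Y Z" "h \<in> Hom C Z (shO C X)"
      "f' \<in> Hom C X' Y'" "g' \<in> Hom C Y' Z'" "h' \<in> Hom C Z' (shO C X')"
      "a \<in> Iso C X X'" "b \<in> Iso C Y Y'" "c \<in> Iso C Z Z'"
      "b \<cdot> f = f' \<cdot> a" "c \<cdot> g = g' \<cdot> b" "shA C a \<cdot> h = h' \<cdot> c"
      using * by (simp_all add: Hom_full_sub_iff Iso_full_sub_iff)
    then have "(f', g', h') \<in> Dist C" by (rule TR1_Iso)
    then show "(f', g', h') \<in> Dist ?S"
      using *(5,6) by (subst Dist_full_sub_iff[OF **(5,6)]) (simp add: Hom_full_sub_iff)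
  next
    fix f X Y assume f: "f \<in> Hom ?S X Y"
    then obtain Z g h where "triangle C X Y Z f g h"
      using triangle_cone[of f X Y] by (auto simp: Hom_full_sub_iff)
    moreover from this f have "Z \<in> S" using sub_cone by (auto simp: Hom_full_sub_iff)
    ultimately show "\<exists>g h. (f, g, h) \<in> Dist ?S"
      using f triangleD[of X Y Z f g h] by (auto simp: Hom_full_sub_iff)
  next
    fix f X Y g Z h
    assume *: "f \<in> Hom ?S X Y" "g \<in> Hom ?S Y Z" "h \<in> Hom ?S Z (shO ?S X)"
    then have h: "f \<in> Hom C X Y" "g \<in> Hom C Y Z" "h \<in> Hom C Z (shO C X)" and
      S: "X \<in> S" "Y \<in> S" "Z \<in> S" by (auto simp: Hom_full_sub_iff)
    show "(f, g, h) \<in> Dist ?S \<longleftrightarrow>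
      (g, h, \<ominus>\<^bsub>hom_group ?S (shO ?S X) (shO ?S Y)\<^esub> shA ?S f) \<in> Dist ?S"
      unfolding Dist_full_sub_iff[OF h(1,2)] Dist_full_sub_iff[OF h(2,3)]
      using TR2[OF h] S by (simp add: hom_group_full_sub)
  next
    fix f g h f' g' h' X Y Z X' Y' Z' a b
    assume *: "(f, g, h) \<in> Dist ?S" "(f', g', h') \<in> Dist ?S"
      "f \<in> Hom ?S X Y" "g \<in> Hom ?S Y Z" "h \<in> Hom ?S Z (shO ?S X)"
      "f' \<in> Hom ?S X' Y'" "g' \<in> Hom ?S Y' Z'" "h' \<in> Hom ?S Z' (shO ?S X')"
      "a \<in> Hom ?S X X'" "b \<in> Hom ?S Y Y'" "b \<cdot>\<^bsub>?S\<^esub> f = f' \<cdot>\<^bsub>?S\<^esub> a"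
    have "\<exists>c \<in> Hom C Z Z'. c \<cdot> g = g' \<cdot> b \<and> shA C a \<cdot> h = h' \<cdot> c"
      by (rule TR3[of f g h f' g' h' X Y Z X' Y' Z' a b]) (use * in \<open>simp_all add: Hom_full_sub_iff\<close>)
    moreover have "Z \<in> S" "Z' \<in> S" using *(5,8) by (simp_all add: Hom_full_sub_iff)
    ultimately show "\<exists>c \<in> Hom ?S Z Z'.
      c \<cdot>\<^bsub>?S\<^esub> g = g' \<cdot>\<^bsub>?S\<^esub> b \<and> shA ?S a \<cdot>\<^bsub>?S\<^esub> h = h' \<cdot>\<^bsub>?S\<^esub> c"
      by (simp add: Hom_full_sub)
  next
    fix f X Y g Z a b U c d V e k W
    assume *: "f \<in> Hom ?S X Y" "g \<in> Hom ?S Y Z"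
      "(f, a, b) \<in> Dist ?S" "a \<in> Hom ?S Y U" "b \<in> Hom ?S U (shO ?S X)"
      "(g, c, d) \<in> Dist ?S" "c \<in> Hom ?S Z V" "d \<in> Hom ?S V (shO ?S Y)"
      "(g \<cdot>\<^bsub>?S\<^esub> f, e, k) \<in> Dist ?S" "e \<in> Hom ?S Z W" "k \<in> Hom ?S W (shO ?S X)"
    have S: "U \<in> S" "V \<in> S" "W \<in> S" using * by (auto simp: Hom_full_sub_iff)
    have "\<exists>u \<in> Hom C U W. \<exists>v \<in> Hom C W V.
        (u, v, shA C a \<cdot> d) \<in> Dist C \<and>
        u \<cdot> a = e \<cdot> g \<and> k \<cdot> u = b \<and> v \<cdot> e = c \<and> d \<cdot> v = shA C f \<cdot> k"
      by (rule TR4[of f X Y g Z a b U c d V e k W]) (use * in \<open>simp_all add: Hom_full_sub_iff\<close>)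
    then obtain u v where uv: "u \<in> Hom C U W" "v \<in> Hom C W V" "(u, v, shA C a \<cdot> d) \<in> Dist C"
      "u \<cdot> a = e \<cdot> g" "k \<cdot> u = b" "v \<cdot> e = c" "d \<cdot> v = shA C f \<cdot> k" by blast
    have "(u, v, shA C a \<cdot> d) \<in> Dist ?S"
      using uv S by (subst Dist_full_sub_iff[OF uv(1,2)]) simp
    with uv S show "\<exists>u \<in> Hom ?S U W. \<exists>v \<in> Hom ?S W V.
        (u, v, shA ?S a \<cdot>\<^bsub>?S\<^esub> d) \<in> Dist ?S \<and>
        u \<cdot>\<^bsub>?S\<^esub> a = e \<cdot>\<^bsub>?S\<^esub> g \<and> k \<cdot>\<^bsub>?S\<^esub> u = b \<and>
        v \<cdot>\<^bsub>?S\<^esub> e = c \<and> d \<cdot>\<^bsub>?S\<^esub> v = shA ?S f \<cdot>\<^bsub>?S\<^esub> k"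
      by (intro bexI[of _ u] bexI[of _ v]) (simp_all add: Hom_full_sub_iff)
  qed
qed

end

section \<open>Adjoints of exact functors\<close>

text \<open>A terminal object of the comma category of \<open>F\<close> over \<open>Y\<close>: the
  value at \<open>Y\<close> of a right adjoint together with its counit. Universality is phrased as
  bijectivity of maps of hom sets, which is the form that the five lemma proves.\<close>

definition universal_arrow ::
  "('o, 'm, 'z) cat_scheme \<Rightarrow> ('p, 'n, 'y) cat_scheme \<Rightarrow> ('o, 'm, 'p, 'n) func \<Rightarrow>
    'p \<Rightarrow> 'o \<Rightarrow> 'n \<Rightarrow> bool" where
  "universal_arrow C C' F Y X e \<longleftrightarrow> X \<in> Obj C \<and> Y \<in> Obj C' \<and> e \<in> Hom C' (omap F X) Y \<and>
    (\<forall>W \<in> Obj C. bij_betw (\<lambda>g. e \<cdot>\<^bsub>C'\<^esub> amap F g) (Hom C W X) (Hom C' (omap F W) Y))"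

lemma (in category) bij_betw_Iso_Comp:
  assumes "a \<in> Iso C X Y" "W \<in> Obj C"
  shows "bij_betw (\<lambda>f. f \<cdot> a) (Hom C Y W) (Hom C X W)"
proof -
  obtain b where b: "a \<in> Hom C X Y" "b \<in> Hom C Y X" "b \<cdot> a = Ide C X" "a \<cdot> b = Ide C Y"
    using assms(1) by (rule Iso_cases)
  note d = HomD[OF b(1)] HomD[OF b(2)]
  show ?thesis
    by (rule bij_betw_byWitness[where f' = "\<lambda>f. f \<cdot> b"])
      (use d b in \<open>auto simp: Hom_iff\<close>)
qed

text \<open>No additive structure is assumed, since the functor is also considered with target
  \<open>full_sub D' T\<close>, which need not have biproducts for a strictly full
  \<open>T\<close>.\<close>

locale functor_between = C: category C + C': category C'
  for C :: "('o, 'm, 'z) cat_scheme" (structure) and C' :: "('p, 'n, 'y) cat_scheme" +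
  fixes F :: "('o, 'm, 'p, 'n) func"
  assumes F_functor: "is_functor C C' F"
begin

lemma F_Obj [simp]: "X \<in> Obj C \<Longrightarrow> omap F X \<in> Obj C'"
  using F_functor by (simp add: is_functor_def)

lemma F_Hom: "f \<in> Hom C X Y \<Longrightarrow> amap F f \<in> Hom C' (omap F X) (omap F Y)"
  using F_functor C.HomD[of f X Y] unfolding is_functor_def by blast

lemma F_arr [simp]:
  assumes "f \<in> Arr C"
  shows "amap F f \<in> Arr C'" "Dom C' (amap F f) = omap F (Dom C f)"
    "Cod C' (amap F f) = omap F (Cod C f)"
  using F_Hom[of f "Dom C f" "Cod C f"] assms by (simp_all add: Hom_iff)

lemma F_Ide [simp]: "X \<in> Obj C \<Longrightarrow> amap F (Ide C X) = Ide C' (omap F X)"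
  using F_functor by (simp add: is_functor_def)

lemma F_Comp [simp]:
  assumes "f \<in> Arr C" "g \<in> Arr C" "Dom C g = Cod C f"
  shows "amap F (g \<cdot> f) = amap F g \<cdot>\<^bsub>C'\<^esub> amap F f"
proof -
  have "f \<in> Hom C (Dom C f) (Cod C f)" "g \<in> Hom C (Cod C f) (Cod C g)"
    using assms by (auto simp: Hom_iff)
  then show ?thesis using F_functor unfolding is_functor_def by blast
qed

lemma universalD:
  assumes "universal_arrow C C' F Y X e"
  shows "X \<in> Obj C" "Y \<in> Obj C'" "e \<in> Hom C' (omap F X) Y"
    "e \<in> Arr C'" "Dom C' e = omap F X" "Cod C' e = Y"
  using assms by (simp_all add: universal_arrow_def Hom_iff)

lemma universal_bij:
  "\<lbrakk>universal_arrow C C' F Y X e; W \<in> Obj C\<rbrakk>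
    \<Longrightarrow> bij_betw (\<lambda>g. e \<cdot>\<^bsub>C'\<^esub> amap F g) (Hom C W X) (Hom C' (omap F W) Y)"
  by (simp add: universal_arrow_def)

lemma universal_ex:
  assumes "universal_arrow C C' F Y X e" "f \<in> Hom C' (omap F W) Y" "W \<in> Obj C"
  shows "\<exists>g \<in> Hom C W X. e \<cdot>\<^bsub>C'\<^esub> amap F g = f"
proof -
  obtain g where "g \<in> Hom C W X" "f = e \<cdot>\<^bsub>C'\<^esub> amap F g"
    using universal_bij[OF assms(1,3)] assms(2) unfolding bij_betw_def by blast
  then show ?thesis by blast
qed

lemma universal_eq:
  assumes "universal_arrow C C' F Y X e" "g \<in> Hom C W X" "h \<in> Hom C W X"
    "e \<cdot>\<^bsub>C'\<^esub> amap F g = e \<cdot>\<^bsub>C'\<^esub> amap F h"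
  shows "g = h"
proof -
  have "W \<in> Obj C" using C.HomD[OF assms(2)] by simp
  then have "inj_on (\<lambda>g. e \<cdot>\<^bsub>C'\<^esub> amap F g) (Hom C W X)"
    using universal_bij[OF assms(1)] by (simp add: bij_betw_def)
  then show ?thesis using assms(2-4) unfolding inj_on_def by blast
qed

lemma universal_Iso:
  assumes A: "universal_arrow C C' F Y A a" and B: "universal_arrow C C' F Y B b"
  shows "\<exists>u \<in> Iso C A B. b \<cdot>\<^bsub>C'\<^esub> amap F u = a"
proof -
  note A' = universalD[OF A]
  note B' = universalD[OF B]
  obtain u where u: "u \<in> Hom C A B" "b \<cdot>\<^bsub>C'\<^esub> amap F u = a"
    using universal_ex[OF B A'(3,1)] by blast
  obtain v where v: "v \<in> Hom C B A" "a \<cdot>\<^bsub>C'\<^esub> amap F v = b"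
    using universal_ex[OF A B'(3,1)] by blast
  have u': "u \<in> Arr C" "Dom C u = A" "Cod C u = B" and v': "v \<in> Arr C" "Dom C v = B" "Cod C v = A"
    using u v by (simp_all add: Hom_iff)
  have "v \<cdot> u = Ide C A"
  proof (rule universal_eq[OF A])
    show "v \<cdot> u \<in> Hom C A A" "Ide C A \<in> Hom C A A" using u' v' A'(1) by (simp_all add: Hom_iff)
    show "a \<cdot>\<^bsub>C'\<^esub> amap F (v \<cdot> u) = a \<cdot>\<^bsub>C'\<^esub> amap F (Ide C A)"
      using u' v' A' u(2) C'.Comp_reassoc[OF v(2), of "amap F u"] by simp
  qed
  moreover have "u \<cdot> v = Ide C B"
  proof (rule universal_eq[OF B])
    show "u \<cdot> v \<in> Hom C B B" "Ide C B \<in> Hom C B B" using u' v' B'(1) by (simp_all add: Hom_iff)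
    show "b \<cdot>\<^bsub>C'\<^esub> amap F (u \<cdot> v) = b \<cdot>\<^bsub>C'\<^esub> amap F (Ide C B)"
      using u' v' B' v(2) C'.Comp_reassoc[OF u(2), of "amap F v"] by simp
  qed
  ultimately have "u \<in> Iso C A B" using C.IsoI u(1) v(1) by blast
  then show ?thesis using u(2) by blast
qed

lemma right_adjoint_counit:
  assumes "is_right_adjoint C C' F G"
  obtains \<epsilon> where "\<And>Y. Y \<in> Obj C' \<Longrightarrow> universal_arrow C C' F Y (omap G Y) (\<epsilon> Y)"
    "\<And>Y Y' g. g \<in> Hom C' Y Y' \<Longrightarrow> \<epsilon> Y' \<cdot>\<^bsub>C'\<^esub> amap F (amap G g) = g \<cdot>\<^bsub>C'\<^esub> \<epsilon> Y"
proof -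
  interpret G: functor_between C' C G
    by unfold_locales (use assms in \<open>simp add: is_right_adjoint_def\<close>)
  obtain \<phi> where bij: "\<And>X Y. \<lbrakk>X \<in> Obj C; Y \<in> Obj C'\<rbrakk>
      \<Longrightarrow> bij_betw (\<phi> X Y) (Hom C' (omap F X) Y) (Hom C X (omap G Y))"
    and nat: "\<And>X X' Y Y' h f g. \<lbrakk>X \<in> Obj C; X' \<in> Obj C; Y \<in> Obj C'; Y' \<in> Obj C';
        h \<in> Hom C X' X; f \<in> Hom C' (omap F X) Y; g \<in> Hom C' Y Y'\<rbrakk> \<Longrightarrow>
          \<phi> X' Y' (g \<cdot>\<^bsub>C'\<^esub> f \<cdot>\<^bsub>C'\<^esub> amap F h) = amap G g \<cdot> \<phi> X Y f \<cdot> h"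
    using assms unfolding is_right_adjoint_def by blast
  \<comment> \<open>The counit is the transpose of an identity, that is, the morphism that
    \<open>\<phi>\<close> sends to it.\<close>
  define \<epsilon> where "\<epsilon> Y = inv_into (Hom C' (omap F (omap G Y)) Y) (\<phi> (omap G Y) Y) (Ide C (omap G Y))" for Y
  have \<epsilon>: "\<epsilon> Y \<in> Hom C' (omap F (omap G Y)) Y" "\<phi> (omap G Y) Y (\<epsilon> Y) = Ide C (omap G Y)"
    if Y: "Y \<in> Obj C'" for Y
  proof -
    have "Ide C (omap G Y) \<in> \<phi> (omap G Y) Y ` Hom C' (omap F (omap G Y)) Y"
      using bij[of "omap G Y" Y] Y by (simp add: bij_betw_def Hom_iff)
    then show "\<epsilon> Y \<in> Hom C' (omap F (omap G Y)) Y" "\<phi> (omap G Y) Y (\<epsilon> Y) = Ide C (omap G Y)"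
      unfolding \<epsilon>_def by (rule inv_into_into, rule f_inv_into_f)
  qed
  \<comment> \<open>Naturality in the first argument, applied at the counit, shows that
    \<open>\<phi>\<close> undoes the map of the universal property.\<close>
  have \<phi>: "\<phi> W Y (\<epsilon> Y \<cdot>\<^bsub>C'\<^esub> amap F h) = h" if "Y \<in> Obj C'" "h \<in> Hom C W (omap G Y)" for W Y h
  proof -
    note h = C.HomD[OF that(2)]
    note e = C'.HomD[OF \<epsilon>(1)[OF that(1)]]
    have "\<phi> W Y (Ide C' Y \<cdot>\<^bsub>C'\<^esub> \<epsilon> Y \<cdot>\<^bsub>C'\<^esub> amap F h) = amap G (Ide C' Y) \<cdot> \<phi> (omap G Y) Y (\<epsilon> Y) \<cdot> h"
      using nat[of "omap G Y" W Y Y h "\<epsilon> Y" "Ide C' Y"] that \<epsilon>(1)[OF that(1)] h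
      by (simp add: Hom_iff)
    then show ?thesis using that(1) h e \<epsilon>(2) by simp
  qed
  have "universal_arrow C C' F Y (omap G Y) (\<epsilon> Y)" if Y: "Y \<in> Obj C'" for Y
    unfolding universal_arrow_def
  proof (intro conjI ballI)
    fix W assume W: "W \<in> Obj C"
    note e = C'.HomD[OF \<epsilon>(1)[OF Y]]
    have in_Hom: "\<epsilon> Y \<cdot>\<^bsub>C'\<^esub> amap F h \<in> Hom C' (omap F W) Y" if "h \<in> Hom C W (omap G Y)" for h
      using C.HomD[OF that] e by (simp add: Hom_iff)
    show "bij_betw (\<lambda>g. \<epsilon> Y \<cdot>\<^bsub>C'\<^esub> amap F g) (Hom C W (omap G Y)) (Hom C' (omap F W) Y)"
    proof (rule bij_betw_byWitness[where f' = "\<phi> W Y"])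
      show "\<forall>h\<in>Hom C W (omap G Y). \<phi> W Y (\<epsilon> Y \<cdot>\<^bsub>C'\<^esub> amap F h) = h"
        using \<phi>[OF Y] by blast
      show "\<forall>f\<in>Hom C' (omap F W) Y. \<epsilon> Y \<cdot>\<^bsub>C'\<^esub> amap F (\<phi> W Y f) = f"
      proof
        fix f assume f: "f \<in> Hom C' (omap F W) Y"
        then have pf: "\<phi> W Y f \<in> Hom C W (omap G Y)"
          using bij[OF W Y] unfolding bij_betw_def by blast
        show "\<epsilon> Y \<cdot>\<^bsub>C'\<^esub> amap F (\<phi> W Y f) = f"
          using inj_onD[OF bij_betw_imp_inj_on[OF bij[OF W Y]] \<phi>[OF Y pf] in_Hom[OF pf] f] .
      qed
      show "(\<lambda>g. \<epsilon> Y \<cdot>\<^bsub>C'\<^esub> amap F g) ` Hom C W (omap G Y) \<subseteq> Hom C' (omap F W) Y"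
        using in_Hom by blast
      show "\<phi> W Y ` Hom C' (omap F W) Y \<subseteq> Hom C W (omap G Y)"
        using bij[OF W Y] unfolding bij_betw_def by blast
    qed
  qed (use Y \<epsilon>(1) in auto)
  moreover have "\<epsilon> Y' \<cdot>\<^bsub>C'\<^esub> amap F (amap G g) = g \<cdot>\<^bsub>C'\<^esub> \<epsilon> Y" if g: "g \<in> Hom C' Y Y'" for Y Y' g
  proof -
    note g' = C'.HomD[OF g]
    then have Y: "Y \<in> Obj C'" "Y' \<in> Obj C'" by auto
    note e = C'.HomD[OF \<epsilon>(1)[OF Y(1)]] C'.HomD[OF \<epsilon>(1)[OF Y(2)]]
    have Gg: "amap G g \<in> Hom C (omap G Y) (omap G Y')" using G.F_Hom[OF g] .
    have "\<phi> (omap G Y) Y' (g \<cdot>\<^bsub>C'\<^esub> \<epsilon> Y \<cdot>\<^bsub>C'\<^esub> amap F (Ide C (omap G Y))) =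
        amap G g \<cdot> \<phi> (omap G Y) Y (\<epsilon> Y) \<cdot> Ide C (omap G Y)"
      using nat[of "omap G Y" "omap G Y" Y Y' "Ide C (omap G Y)" "\<epsilon> Y" g] Y \<epsilon>(1)[OF Y(1)] g
      by (simp add: Hom_iff)
    then have "\<phi> (omap G Y) Y' (g \<cdot>\<^bsub>C'\<^esub> \<epsilon> Y) = amap G g"
      using Y e g' \<epsilon>(2)[OF Y(1)] by simp
    also have "\<dots> = \<phi> (omap G Y) Y' (\<epsilon> Y' \<cdot>\<^bsub>C'\<^esub> amap F (amap G g))"
      using \<phi>[OF Y(2) Gg] by simp
    finally have "g \<cdot>\<^bsub>C'\<^esub> \<epsilon> Y = \<epsilon> Y' \<cdot>\<^bsub>C'\<^esub> amap F (amap G g)"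
    proof (rule inj_onD[OF bij_betw_imp_inj_on[OF bij[of "omap G Y" Y']], rotated 2])
      show "g \<cdot>\<^bsub>C'\<^esub> \<epsilon> Y \<in> Hom C' (omap F (omap G Y)) Y'" using g' e by (simp add: Hom_iff)
      show "\<epsilon> Y' \<cdot>\<^bsub>C'\<^esub> amap F (amap G g) \<in> Hom C' (omap F (omap G Y)) Y'"
        using C.HomD[OF Gg] e by (simp add: Hom_iff)
    qed (use Y in simp_all)
    then show ?thesis by simp
  qed
  ultimately show ?thesis using that by blast
qed

lemma right_adjoint_ex:
  assumes "\<And>Y. Y \<in> Obj C' \<Longrightarrow> \<exists>X e. universal_arrow C C' F Y X e"
  shows "\<exists>G. is_right_adjoint C C' F G"
proof -
  obtain GO \<epsilon> where U: "\<And>Y. Y \<in> Obj C' \<Longrightarrow> universal_arrow C C' F Y (GO Y) (\<epsilon> Y)"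
    using assms by metis
  note U' = universalD[OF U]
  define \<phi> where "\<phi> X Y = inv_into (Hom C X (GO Y)) (\<lambda>g. \<epsilon> Y \<cdot>\<^bsub>C'\<^esub> amap F g)" for X Y
  have bij: "bij_betw (\<phi> X Y) (Hom C' (omap F X) Y) (Hom C X (GO Y))"
    if "X \<in> Obj C" "Y \<in> Obj C'" for X Y
    unfolding \<phi>_def using bij_betw_inv_into[OF universal_bij[OF U[OF that(2)] that(1)]] .
  have \<phi>_Hom: "\<phi> X Y f \<in> Hom C X (GO Y)"
    if "X \<in> Obj C" "Y \<in> Obj C'" "f \<in> Hom C' (omap F X) Y" for X Y f
    using bij[OF that(1,2)] that(3) unfolding bij_betw_def by blast
  have \<phi>: "\<epsilon> Y \<cdot>\<^bsub>C'\<^esub> amap F (\<phi> X Y f) = f"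
    if "X \<in> Obj C" "Y \<in> Obj C'" "f \<in> Hom C' (omap F X) Y" for X Y f
    unfolding \<phi>_def
    using bij_betw_inv_into_right[OF universal_bij[OF U[OF that(2)] that(1)] that(3)] .
  \<comment> \<open>On a morphism \<open>g\<close> the functor is forced by naturality of the
    counit: it is the unique solution of the equation \<open>G_eq\<close>. Functoriality then
    follows from \<open>universal_eq\<close>.\<close>
  define G where "G = \<lparr>omap = GO, amap = \<lambda>g. \<phi> (GO (Dom C' g)) (Cod C' g) (g \<cdot>\<^bsub>C'\<^esub> \<epsilon> (Dom C' g))\<rparr>"
  have G_omap [simp]: "omap G = GO" by (simp add: G_def)
  have G_Hom: "amap G g \<in> Hom C (GO Y) (GO Y')"
    and G_eq: "\<epsilon> Y' \<cdot>\<^bsub>C'\<^esub> amap F (amap G g) = g \<cdot>\<^bsub>C'\<^esub> \<epsilon> Y" if "g \<in> Hom C' Y Y'" for g Y Y'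
  proof -
    note g = C'.HomD[OF that]
    then have Y: "Y \<in> Obj C'" "Y' \<in> Obj C'" by auto
    have H: "g \<cdot>\<^bsub>C'\<^esub> \<epsilon> Y \<in> Hom C' (omap F (GO Y)) Y'"
      using g U'[OF Y(1)] by (simp add: Hom_iff)
    show "amap G g \<in> Hom C (GO Y) (GO Y')"
      using \<phi>_Hom[OF U'(1)[OF Y(1)] Y(2) H] g by (simp add: G_def)
    show "\<epsilon> Y' \<cdot>\<^bsub>C'\<^esub> amap F (amap G g) = g \<cdot>\<^bsub>C'\<^esub> \<epsilon> Y"
      using \<phi>[OF U'(1)[OF Y(1)] Y(2) H] g by (simp add: G_def)
  qed
  have "is_functor C' C G"
    unfolding is_functor_def
  proof (intro conjI ballI allI)
    fix Y assume Y: "Y \<in> Obj C'"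
    show "omap G Y \<in> Obj C" using U'(1)[OF Y] by simp
    have I: "Ide C' Y \<in> Hom C' Y Y" using Y by (simp add: Hom_iff)
    have "amap G (Ide C' Y) = Ide C (GO Y)"
    proof (rule universal_eq[OF U[OF Y] G_Hom[OF I]])
      show "Ide C (GO Y) \<in> Hom C (GO Y) (GO Y)" using U'(1)[OF Y] by (simp add: Hom_iff)
      show "\<epsilon> Y \<cdot>\<^bsub>C'\<^esub> amap F (amap G (Ide C' Y)) = \<epsilon> Y \<cdot>\<^bsub>C'\<^esub> amap F (Ide C (GO Y))"
        using G_eq[OF I] U'[OF Y] by simp
    qed
    then show "amap G (Ide C' Y) = Ide C (omap G Y)" by simp
  next
    fix X Y f assume "f \<in> Hom C' X Y"
    then show "amap G f \<in> Hom C (omap G X) (omap G Y)" using G_Hom by simp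
  next
    fix X Y Z f g assume f: "f \<in> Hom C' X Y" and g: "g \<in> Hom C' Y Z"
    note f' = C'.HomD[OF f] and g' = C'.HomD[OF g]
    then have Y: "X \<in> Obj C'" "Y \<in> Obj C'" "Z \<in> Obj C'" by auto
    note Gf = C.HomD[OF G_Hom[OF f]] and Gg = C.HomD[OF G_Hom[OF g]]
    have gf: "g \<cdot>\<^bsub>C'\<^esub> f \<in> Hom C' X Z" using f' g' by (simp add: Hom_iff)
    show "amap G (g \<cdot>\<^bsub>C'\<^esub> f) = amap G g \<cdot> amap G f"
    proof (rule universal_eq[OF U[OF Y(3)] G_Hom[OF gf]])
      show "amap G g \<cdot> amap G f \<in> Hom C (GO X) (GO Z)" using Gf Gg by (simp add: Hom_iff)
      show "\<epsilon> Z \<cdot>\<^bsub>C'\<^esub> amap F (amap G (g \<cdot>\<^bsub>C'\<^esub> f)) = \<epsilon> Z \<cdot>\<^bsub>C'\<^esub> amap F (amap G g \<cdot> amap G f)"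
        using G_eq[OF gf] G_eq[OF f] C'.Comp_reassoc[OF G_eq[OF g], of "amap F (amap G f)"]
          Gf Gg f' g' U'[OF Y(1)] U'[OF Y(2)] U'[OF Y(3)] by simp
    qed
  qed
  moreover have "\<phi> X' Y' (g \<cdot>\<^bsub>C'\<^esub> f \<cdot>\<^bsub>C'\<^esub> amap F h) = amap G g \<cdot> \<phi> X Y f \<cdot> h"
    if X: "X \<in> Obj C" "X' \<in> Obj C" "Y \<in> Obj C'" "Y' \<in> Obj C'"
      and h: "h \<in> Hom C X' X" and f: "f \<in> Hom C' (omap F X) Y" and g: "g \<in> Hom C' Y Y'"
    for X X' Y Y' h f g
  proof (rule universal_eq[OF U[OF X(4)]])
    note h' = C.HomD[OF h] and f' = C'.HomD[OF f] and g' = C'.HomD[OF g]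
      and Gg = C.HomD[OF G_Hom[OF g]] and pf = C.HomD[OF \<phi>_Hom[OF X(1,3) f]]
    have H: "g \<cdot>\<^bsub>C'\<^esub> f \<cdot>\<^bsub>C'\<^esub> amap F h \<in> Hom C' (omap F X') Y'"
      using h' f' g' by (simp add: Hom_iff)
    show "\<phi> X' Y' (g \<cdot>\<^bsub>C'\<^esub> f \<cdot>\<^bsub>C'\<^esub> amap F h) \<in> Hom C X' (GO Y')"
      using \<phi>_Hom[OF X(2,4) H] .
    show "amap G g \<cdot> \<phi> X Y f \<cdot> h \<in> Hom C X' (GO Y')"
      using Gg pf h' by (simp add: Hom_iff)
    show "\<epsilon> Y' \<cdot>\<^bsub>C'\<^esub> amap F (\<phi> X' Y' (g \<cdot>\<^bsub>C'\<^esub> f \<cdot>\<^bsub>C'\<^esub> amap F h)) =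
        \<epsilon> Y' \<cdot>\<^bsub>C'\<^esub> amap F (amap G g \<cdot> \<phi> X Y f \<cdot> h)"
      using \<phi>[OF X(2,4) H] C'.Comp_reassoc[OF G_eq[OF g], of "amap F (\<phi> X Y f) \<cdot>\<^bsub>C'\<^esub> amap F h"]
        C'.Comp_reassoc[OF \<phi>[OF X(1,3) f], of "amap F h"] h' f' g' Gg pf
        U'[OF X(3)] U'[OF X(4)] by simp
  qed
  ultimately have "is_right_adjoint C C' F G"
    unfolding is_right_adjoint_def using bij F_functor by (intro conjI exI[of _ \<phi>]) auto
  then show ?thesis by blast
qed

end

section \<open>Universal arrows along exact functors and exactness of the adjoint\<close>

locale exact_between = C: triangulated_category C + C': triangulated_category C'
  for C :: "('o, 'm, 'z) tricat_scheme" (structure) and C' :: "('p, 'n, 'y) tricat_scheme" +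
  fixes F :: "('o, 'm, 'p, 'n) func" and \<theta> :: "'o \<Rightarrow> 'n"
  assumes F_additive: "additive_functor C C' F"
    and \<theta>_Iso: "X \<in> Obj C \<Longrightarrow> \<theta> X \<in> Iso C' (omap F (shO C X)) (shO C' (omap F X))"
    and \<theta>_natural: "f \<in> Hom C X Y \<Longrightarrow>
      \<theta> Y \<cdot>\<^bsub>C'\<^esub> amap F (shA C f) = shA C' (amap F f) \<cdot>\<^bsub>C'\<^esub> \<theta> X"
    and F_Dist: "(f, g, h) \<in> Dist C \<Longrightarrow>
      (amap F f, amap F g, \<theta> (Dom C f) \<cdot>\<^bsub>C'\<^esub> amap F h) \<in> Dist C'"
begin

sublocale functor_between C C' F
  by unfold_locales (use F_additive in \<open>simp add: additive_functor_def\<close>)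

lemmas F_Add [simp] = additive_functor_arr(7-9)[OF F_additive C.additive_category_axioms
    C'.additive_category_axioms]

lemma \<theta>_arr [simp]:
  assumes "X \<in> Obj C"
  shows "\<theta> X \<in> Arr C'" "Dom C' (\<theta> X) = omap F (shO C X)" "Cod C' (\<theta> X) = shO C' (omap F X)"
  using \<theta>_Iso[OF assms] by (simp_all add: Iso_def Hom_iff)

lemma F_triangle:
  assumes "triangle C X Y Z f g h"
  shows "triangle C' (omap F X) (omap F Y) (omap F Z) (amap F f) (amap F g)
    (\<theta> X \<cdot>\<^bsub>C'\<^esub> amap F h)"
  using F_Dist[of f g h] C.triangleD[OF assms] by (simp add: triangle_def Hom_iff)

text \<open>Only the first two maps of the image of a (rotated) triangle are involved, and the
  comparison \<open>\<theta>\<close> enters just the third; hence the sequence is stated with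
  \<open>F\<close> of the shift and never mentions \<open>\<theta>\<close>.\<close>

lemma F_contra_exact:
  assumes "triangle C X Y Z f g h"
  shows "y \<in> Hom C' (omap F Y) N \<Longrightarrow> y \<cdot>\<^bsub>C'\<^esub> amap F f = Zero C' (omap F X) N \<longleftrightarrow>
      y \<in> (\<lambda>z. z \<cdot>\<^bsub>C'\<^esub> amap F g) ` Hom C' (omap F Z) N"
    and "z \<in> Hom C' (omap F Z) N \<Longrightarrow> z \<cdot>\<^bsub>C'\<^esub> amap F g = Zero C' (omap F Y) N \<longleftrightarrow>
      z \<in> (\<lambda>x. x \<cdot>\<^bsub>C'\<^esub> amap F h) ` Hom C' (omap F (shO C X)) N"
    and "x \<in> Hom C' (omap F (shO C X)) N \<Longrightarrow> x \<cdot>\<^bsub>C'\<^esub> amap F h = Zero C' (omap F Z) N \<longleftrightarrow>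
      x \<in> (\<lambda>y. y \<cdot>\<^bsub>C'\<^esub> amap F (shA C f)) ` Hom C' (omap F (shO C Y)) N"
proof -
  note t = C.triangleD[OF assms]
  show "y \<in> Hom C' (omap F Y) N \<Longrightarrow> y \<cdot>\<^bsub>C'\<^esub> amap F f = Zero C' (omap F X) N \<longleftrightarrow>
      y \<in> (\<lambda>z. z \<cdot>\<^bsub>C'\<^esub> amap F g) ` Hom C' (omap F Z) N"
    by (rule C'.contra_exact[OF F_triangle[OF assms]])
  show "z \<in> Hom C' (omap F Z) N \<Longrightarrow> z \<cdot>\<^bsub>C'\<^esub> amap F g = Zero C' (omap F Y) N \<longleftrightarrow>
      z \<in> (\<lambda>x. x \<cdot>\<^bsub>C'\<^esub> amap F h) ` Hom C' (omap F (shO C X)) N"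
    by (rule C'.contra_exact[OF F_triangle[OF C.triangle_rotate[OF assms]]])
  have *: "amap F (shA C f) \<in> Hom C' (omap F (shO C X)) (omap F (shO C Y))"
    using t by (simp add: Hom_iff)
  show "x \<in> Hom C' (omap F (shO C X)) N \<Longrightarrow> x \<cdot>\<^bsub>C'\<^esub> amap F h = Zero C' (omap F Z) N \<longleftrightarrow>
      x \<in> (\<lambda>y. y \<cdot>\<^bsub>C'\<^esub> amap F (shA C f)) ` Hom C' (omap F (shO C Y)) N"
    using C'.contra_exact[OF F_triangle[OF C.triangle_rotate[OF C.triangle_rotate[OF assms]]], of x N]
      t C'.image_Comp_Neg[OF *, of N] by simp
qed

lemma universal_map_hom:
  assumes "e \<in> Hom C' (omap F X) Y" "X \<in> Obj C" "W \<in> Obj C"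
  shows "abelian_group_hom (hom_group C W X) (hom_group C' (omap F W) Y) (\<lambda>g. e \<cdot>\<^bsub>C'\<^esub> amap F g)"
proof (rule abelian_group_homI')
  note e = C'.HomD[OF assms(1)]
  show "abelian_group (hom_group C W X)" "abelian_group (hom_group C' (omap F W) Y)"
    using e assms C.Hom_abelian_group C'.Hom_abelian_group by auto
  fix g assume "g \<in> carrier (hom_group C W X)"
  then have g: "g \<in> Arr C" "Dom C g = W" "Cod C g = X" by (simp_all add: Hom_iff)
  show "e \<cdot>\<^bsub>C'\<^esub> amap F g \<in> carrier (hom_group C' (omap F W) Y)"
    using e g by (simp add: Hom_iff)
  fix h assume "h \<in> carrier (hom_group C W X)"
  then have h: "h \<in> Arr C" "Dom C h = W" "Cod C h = X" by (simp_all add: Hom_iff)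
  show "e \<cdot>\<^bsub>C'\<^esub> amap F (g \<oplus>\<^bsub>hom_group C W X\<^esub> h) =
      e \<cdot>\<^bsub>C'\<^esub> amap F g \<oplus>\<^bsub>hom_group C' (omap F W) Y\<^esub> e \<cdot>\<^bsub>C'\<^esub> amap F h"
    using e g h by simp
qed

text \<open>The five lemma in the test object. The shifts appear among the test objects because in
  the contravariant hom sequence the term of \<open>W3\<close> is preceded by those of
  \<open>shO C W2\<close> and \<open>shO C W1\<close>.\<close>

lemma universal_cone_contra:
  assumes T: "triangle C W1 W2 W3 f g h" and e: "e \<in> Hom C' (omap F X) N" and X: "X \<in> Obj C"
    and bij: "\<And>W. W \<in> {W1, W2, shO C W1, shO C W2} \<Longrightarrow>
      bij_betw (\<lambda>g. e \<cdot>\<^bsub>C'\<^esub> amap F g) (Hom C W X) (Hom C' (omap F W) N)"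
  shows "bij_betw (\<lambda>g. e \<cdot>\<^bsub>C'\<^esub> amap F g) (Hom C W3 X) (Hom C' (omap F W3) N)"
proof -
  note t = C.triangleD[OF T]
  note e' = C'.HomD[OF e]
  have N: "N \<in> Obj C'" using e' by simp
  have f1: "shA C f \<in> Hom C (shO C W1) (shO C W2)" using t by (simp add: Hom_iff)
  let ?H = "\<lambda>W. hom_group C W X" and ?H' = "\<lambda>W. hom_group C' (omap F W) N"
  have "bij_betw (\<lambda>g. e \<cdot>\<^bsub>C'\<^esub> amap F g) (carrier (?H W3))
      (carrier (?H' W3))"
  proof (rule five_lemma)
    show "abelian_group_hom (?H (shO C W2)) (?H (shO C W1)) (\<lambda>y. y \<cdot> shA C f)"
      "abelian_group_hom (?H (shO C W1)) (?H W3) (\<lambda>y. y \<cdot> h)"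
      "abelian_group_hom (?H W3) (?H W2) (\<lambda>y. y \<cdot> g)"
      "abelian_group_hom (?H W2) (?H W1) (\<lambda>y. y \<cdot> f)"
      using C.pre_comp_hom f1 t(2-4) X by blast+
    show "abelian_group_hom (?H' (shO C W2)) (?H' (shO C W1))
        (\<lambda>y. y \<cdot>\<^bsub>C'\<^esub> amap F (shA C f))"
      "abelian_group_hom (?H' (shO C W1)) (?H' W3)
        (\<lambda>y. y \<cdot>\<^bsub>C'\<^esub> amap F h)"
      "abelian_group_hom (?H' W3) (?H' W2)
        (\<lambda>y. y \<cdot>\<^bsub>C'\<^esub> amap F g)"
      "abelian_group_hom (?H' W2) (?H' W1)
        (\<lambda>y. y \<cdot>\<^bsub>C'\<^esub> amap F f)"
      using C'.pre_comp_hom[OF F_Hom] f1 t(2-4) N by blast+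
    show "abelian_group_hom (?H W3) (?H' W3)
        (\<lambda>g. e \<cdot>\<^bsub>C'\<^esub> amap F g)"
      using universal_map_hom[OF e X t(16)] .
    show "bij_betw (\<lambda>g. e \<cdot>\<^bsub>C'\<^esub> amap F g) (carrier (?H (shO C W2)))
        (carrier (?H' (shO C W2)))"
      "bij_betw (\<lambda>g. e \<cdot>\<^bsub>C'\<^esub> amap F g) (carrier (?H (shO C W1)))
        (carrier (?H' (shO C W1)))"
      "bij_betw (\<lambda>g. e \<cdot>\<^bsub>C'\<^esub> amap F g) (carrier (?H W2))
        (carrier (?H' W2))"
      "bij_betw (\<lambda>g. e \<cdot>\<^bsub>C'\<^esub> amap F g) (carrier (?H W1))
        (carrier (?H' W1))"
      using bij by simp_all
    show "e \<cdot>\<^bsub>C'\<^esub> amap F \<zero>\<^bsub>?H W2\<^esub> = \<zero>\<^bsub>?H' W2\<^esub>"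
      "e \<cdot>\<^bsub>C'\<^esub> amap F \<zero>\<^bsub>?H W1\<^esub> = \<zero>\<^bsub>?H' W1\<^esub>"
      using e' t X by simp_all
  qed (use t e' in \<open>simp_all add: C.contra_exact[OF T] C.contra_exact'[OF T] F_contra_exact[OF T] Hom_iff\<close>)
  then show ?thesis by simp
qed

text \<open>The five lemma in the target. A filler \<open>c\<close> from TR3 is not unique, but any
  one that makes the squares commute is universal, because its four neighbours are
  bijective.\<close>

lemma universal_cone:
  assumes T: "triangle C A B K u v w" and T': "triangle C' X Y Z f g h"
    and a: "universal_arrow C C' F X A a" and b: "universal_arrow C C' F Y B b"
    and a1: "universal_arrow C C' F (shO C' X) (shO C A) (shA C' a \<cdot>\<^bsub>C'\<^esub> \<theta> A)"
    and b1: "universal_arrow C C' F (shO C' Y) (shO C B) (shA C' b \<cdot>\<^bsub>C'\<^esub> \<theta> B)"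
    and c: "c \<in> Hom C' (omap F K) Z"
    and sq: "b \<cdot>\<^bsub>C'\<^esub> amap F u = f \<cdot>\<^bsub>C'\<^esub> a" "c \<cdot>\<^bsub>C'\<^esub> amap F v = g \<cdot>\<^bsub>C'\<^esub> b"
      "shA C' a \<cdot>\<^bsub>C'\<^esub> (\<theta> A \<cdot>\<^bsub>C'\<^esub> amap F w) = h \<cdot>\<^bsub>C'\<^esub> c"
  shows "universal_arrow C C' F Z K c"
  unfolding universal_arrow_def
proof (intro conjI ballI)
  note t = C.triangleD[OF T] and t' = C'.triangleD[OF T']
  note a' = universalD[OF a] and b' = universalD[OF b] and c' = C'.HomD[OF c]
  show "K \<in> Obj C" "Z \<in> Obj C'" "c \<in> Hom C' (omap F K) Z" using t t' c by auto
  fix W assume W: "W \<in> Obj C"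
  have FW: "omap F W \<in> Obj C'" using W by simp
  \<comment> \<open>The fourth square is the shift of the first; naturality of
    \<open>\<theta>\<close> moves \<open>F\<close> past the shift.\<close>
  have sq4: "shA C' b \<cdot>\<^bsub>C'\<^esub> (\<theta> B \<cdot>\<^bsub>C'\<^esub> amap F (shA C u)) = shA C' f \<cdot>\<^bsub>C'\<^esub> (shA C' a \<cdot>\<^bsub>C'\<^esub> \<theta> A)"
  proof -
    have "shA C' b \<cdot>\<^bsub>C'\<^esub> (\<theta> B \<cdot>\<^bsub>C'\<^esub> amap F (shA C u)) = shA C' (b \<cdot>\<^bsub>C'\<^esub> amap F u) \<cdot>\<^bsub>C'\<^esub> \<theta> A"
      using \<theta>_natural[OF t(2)] t b' by simp
    also have "\<dots> = shA C' f \<cdot>\<^bsub>C'\<^esub> (shA C' a \<cdot>\<^bsub>C'\<^esub> \<theta> A)"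
      unfolding sq(1) using t t' a' by simp
    finally show ?thesis .
  qed
  have u1: "shA C u \<in> Hom C (shO C A) (shO C B)" using t by (simp add: Hom_iff)
  have f1: "shA C' f \<in> Hom C' (shO C' X) (shO C' Y)" using t' by (simp add: Hom_iff)
  let ?H = "hom_group C W" and ?H' = "hom_group C' (omap F W)"
  have "bij_betw (\<lambda>g. c \<cdot>\<^bsub>C'\<^esub> amap F g) (carrier (?H K))
      (carrier (?H' Z))"
  proof (rule five_lemma)
    show "abelian_group_hom (?H A) (?H B) (\<lambda>x. u \<cdot> x)"
      "abelian_group_hom (?H B) (?H K) (\<lambda>x. v \<cdot> x)"
      "abelian_group_hom (?H K) (?H (shO C A)) (\<lambda>x. w \<cdot> x)"
      "abelian_group_hom (?H (shO C A)) (?H (shO C B)) (\<lambda>x. shA C u \<cdot> x)"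
      using C.post_comp_hom u1 t(2-4) W by blast+
    show "abelian_group_hom (?H' X) (?H' Y)
        (\<lambda>x. f \<cdot>\<^bsub>C'\<^esub> x)"
      "abelian_group_hom (?H' Y) (?H' Z)
        (\<lambda>x. g \<cdot>\<^bsub>C'\<^esub> x)"
      "abelian_group_hom (?H' Z) (?H' (shO C' X))
        (\<lambda>x. h \<cdot>\<^bsub>C'\<^esub> x)"
      "abelian_group_hom (?H' (shO C' X)) (?H' (shO C' Y))
        (\<lambda>x. shA C' f \<cdot>\<^bsub>C'\<^esub> x)"
      using C'.post_comp_hom f1 t'(2-4) FW by blast+
    show "abelian_group_hom (?H K) (?H' Z)
        (\<lambda>g. c \<cdot>\<^bsub>C'\<^esub> amap F g)"
      using universal_map_hom[OF c t(16) W] .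
    show "bij_betw (\<lambda>g. a \<cdot>\<^bsub>C'\<^esub> amap F g) (carrier (?H A))
        (carrier (?H' X))"
      "bij_betw (\<lambda>g. b \<cdot>\<^bsub>C'\<^esub> amap F g) (carrier (?H B))
        (carrier (?H' Y))"
      "bij_betw (\<lambda>g. (shA C' a \<cdot>\<^bsub>C'\<^esub> \<theta> A) \<cdot>\<^bsub>C'\<^esub> amap F g) (carrier (?H (shO C A)))
        (carrier (?H' (shO C' X)))"
      "bij_betw (\<lambda>g. (shA C' b \<cdot>\<^bsub>C'\<^esub> \<theta> B) \<cdot>\<^bsub>C'\<^esub> amap F g) (carrier (?H (shO C B)))
        (carrier (?H' (shO C' Y)))"
      using universal_bij[OF a W] universal_bij[OF b W] universal_bij[OF a1 W] universal_bij[OF b1 W]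
      by simp_all
  next
    fix x assume "x \<in> carrier (?H A)"
    then have "x \<in> Arr C" "Dom C x = W" "Cod C x = A" by (simp_all add: Hom_iff)
    then show "b \<cdot>\<^bsub>C'\<^esub> amap F (u \<cdot> x) = f \<cdot>\<^bsub>C'\<^esub> (a \<cdot>\<^bsub>C'\<^esub> amap F x)"
      using C'.Comp_reassoc[OF sq(1), of "amap F x"] t t' a' b' by simp
  next
    fix x assume "x \<in> carrier (?H B)"
    then have "x \<in> Arr C" "Dom C x = W" "Cod C x = B" by (simp_all add: Hom_iff)
    then show "c \<cdot>\<^bsub>C'\<^esub> amap F (v \<cdot> x) = g \<cdot>\<^bsub>C'\<^esub> (b \<cdot>\<^bsub>C'\<^esub> amap F x)"
      using C'.Comp_reassoc[OF sq(2), of "amap F x"] t t' c' b' by simp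
  next
    fix x assume "x \<in> carrier (?H K)"
    then have "x \<in> Arr C" "Dom C x = W" "Cod C x = K" by (simp_all add: Hom_iff)
    then show "(shA C' a \<cdot>\<^bsub>C'\<^esub> \<theta> A) \<cdot>\<^bsub>C'\<^esub> amap F (w \<cdot> x) = h \<cdot>\<^bsub>C'\<^esub> (c \<cdot>\<^bsub>C'\<^esub> amap F x)"
      using C'.Comp_reassoc[OF sq(3), of "amap F x"] t t' c' a' by simp
  next
    fix x assume "x \<in> carrier (?H (shO C A))"
    then have "x \<in> Arr C" "Dom C x = W" "Cod C x = shO C A" by (simp_all add: Hom_iff)
    then show "(shA C' b \<cdot>\<^bsub>C'\<^esub> \<theta> B) \<cdot>\<^bsub>C'\<^esub> amap F (shA C u \<cdot> x) =
        shA C' f \<cdot>\<^bsub>C'\<^esub> ((shA C' a \<cdot>\<^bsub>C'\<^esub> \<theta> A) \<cdot>\<^bsub>C'\<^esub> amap F x)"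
      using C'.Comp_reassoc[OF sq4, of "amap F x"] t t' b' a' by simp
  next
    show "(shA C' a \<cdot>\<^bsub>C'\<^esub> \<theta> A) \<cdot>\<^bsub>C'\<^esub> amap F \<zero>\<^bsub>?H (shO C A)\<^esub> =
        \<zero>\<^bsub>?H' (shO C' X)\<^esub>"
      "(shA C' b \<cdot>\<^bsub>C'\<^esub> \<theta> B) \<cdot>\<^bsub>C'\<^esub> amap F \<zero>\<^bsub>?H (shO C B)\<^esub> =
        \<zero>\<^bsub>?H' (shO C' Y)\<^esub>"
      using a' b' W by simp_all
  qed (simp_all add: C.cov_exact[OF T] C.cov_exact'[OF T] C'.cov_exact[OF T'] C'.cov_exact'[OF T'])
  then show "bij_betw (\<lambda>g. c \<cdot>\<^bsub>C'\<^esub> amap F g) (Hom C W K) (Hom C' (omap F W) Z)" by simp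
qed

text \<open>Every test object is a shift \<open>shO C V\<close>. After the bijection
  \<open>shA C\<close>, the map becomes that of \<open>e\<close> at \<open>V\<close> followed by the
  shift of \<open>C'\<close> and composition with the isomorphism \<open>\<theta> V\<close>.\<close>

lemma universal_shift:
  assumes e: "universal_arrow C C' F Y X e"
  shows "universal_arrow C C' F (shO C' Y) (shO C X) (shA C' e \<cdot>\<^bsub>C'\<^esub> \<theta> X)"
  unfolding universal_arrow_def
proof (intro conjI ballI)
  note e' = universalD[OF e]
  show "shO C X \<in> Obj C" "shO C' Y \<in> Obj C'"
    "shA C' e \<cdot>\<^bsub>C'\<^esub> \<theta> X \<in> Hom C' (omap F (shO C X)) (shO C' Y)"
    using e' by (simp_all add: Hom_iff)
  fix W assume W: "W \<in> Obj C"
  then obtain V where V: "V \<in> Obj C" "W = shO C V" using C.shO_surj by blast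
  let ?m = "\<lambda>g. (shA C' e \<cdot>\<^bsub>C'\<^esub> \<theta> X) \<cdot>\<^bsub>C'\<^esub> amap F g"
  have eq: "(?m \<circ> shA C) g = ((\<lambda>k. k \<cdot>\<^bsub>C'\<^esub> \<theta> V) \<circ> (shA C' \<circ> (\<lambda>g. e \<cdot>\<^bsub>C'\<^esub> amap F g))) g"
    if "g \<in> Hom C V X" for g
    using C.HomD[OF that] e' V(1) \<theta>_natural[OF that] by simp
  have "bij_betw (\<lambda>g. e \<cdot>\<^bsub>C'\<^esub> amap F g) (Hom C V X) (Hom C' (omap F V) Y)"
    using universal_bij[OF e V(1)] .
  moreover have "bij_betw (shA C') (Hom C' (omap F V) Y) (Hom C' (shO C' (omap F V)) (shO C' Y))"
    using C'.bij_betw_shA e' V by simp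
  moreover have "bij_betw (\<lambda>k. k \<cdot>\<^bsub>C'\<^esub> \<theta> V) (Hom C' (shO C' (omap F V)) (shO C' Y))
      (Hom C' (omap F W) (shO C' Y))"
    using C'.bij_betw_Iso_Comp[OF \<theta>_Iso[OF V(1)], of "shO C' Y"] e' V by simp
  ultimately have "bij_betw ((\<lambda>k. k \<cdot>\<^bsub>C'\<^esub> \<theta> V) \<circ> (shA C' \<circ> (\<lambda>g. e \<cdot>\<^bsub>C'\<^esub> amap F g)))
      (Hom C V X) (Hom C' (omap F W) (shO C' Y))"
    by (intro bij_betw_trans)
  then have "bij_betw (?m \<circ> shA C) (Hom C V X) (Hom C' (omap F W) (shO C' Y))"
    by (subst bij_betw_cong[OF eq])
  moreover have "bij_betw (shA C) (Hom C V X) (Hom C W (shO C X))"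
    using C.bij_betw_shA V e' by simp
  ultimately show "bij_betw ?m (Hom C W (shO C X)) (Hom C' (omap F W) (shO C' Y))"
    using bij_betw_comp_iff by blast
qed

theorem exact_right_adjoint:
  assumes "is_right_adjoint C C' F G"
  shows "exact_functor C' C G"
proof -
  obtain \<epsilon> where U: "\<And>Y. Y \<in> Obj C' \<Longrightarrow> universal_arrow C C' F Y (omap G Y) (\<epsilon> Y)"
    and nat: "\<And>Y Y' g. g \<in> Hom C' Y Y' \<Longrightarrow> \<epsilon> Y' \<cdot>\<^bsub>C'\<^esub> amap F (amap G g) = g \<cdot>\<^bsub>C'\<^esub> \<epsilon> Y"
    by (rule right_adjoint_counit[OF assms]) blast
  interpret G: functor_between C' C G
    by unfold_locales (use assms in \<open>simp add: is_right_adjoint_def\<close>)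
  note U' = universalD[OF U]
  have add: "additive_functor C' C G"
    unfolding additive_functor_def
  proof (intro conjI ballI)
    fix X Y f g assume X: "X \<in> Obj C'" and Y: "Y \<in> Obj C'" and f: "f \<in> Hom C' X Y" and g: "g \<in> Hom C' X Y"
    note f' = C'.HomD[OF f] and g' = C'.HomD[OF g]
    have fg: "Add C' f g \<in> Hom C' X Y" using f' g' by (simp add: Hom_iff)
    note Gf = C.HomD[OF G.F_Hom[OF f]] and Gg = C.HomD[OF G.F_Hom[OF g]]
    show "amap G (Add C' f g) = Add C (amap G f) (amap G g)"
    proof (rule universal_eq[OF U[OF Y] G.F_Hom[OF fg]])
      show "Add C (amap G f) (amap G g) \<in> Hom C (omap G X) (omap G Y)"
        using Gf Gg by (simp add: Hom_iff)
      show "\<epsilon> Y \<cdot>\<^bsub>C'\<^esub> amap F (amap G (Add C' f g)) = \<epsilon> Y \<cdot>\<^bsub>C'\<^esub> amap F (Add C (amap G f) (amap G g))"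
        using nat[OF fg] nat[OF f] nat[OF g] f' g' Gf Gg U'[OF X] U'[OF Y] by simp
    qed
  qed (use assms in \<open>simp add: is_right_adjoint_def\<close>)
  \<comment> \<open>By \<open>universal_shift\<close>, \<open>a Y\<close> presents the shift of
    \<open>omap G Y\<close> as another value of the adjoint at \<open>shO C' Y\<close>. Uniqueness
    of universal arrows yields the comparison \<open>\<tau>\<close> required of an exact
    functor.\<close>
  define a where "a Y = shA C' (\<epsilon> Y) \<cdot>\<^bsub>C'\<^esub> \<theta> (omap G Y)" for Y
  have a: "universal_arrow C C' F (shO C' Y) (shO C (omap G Y)) (a Y)" if "Y \<in> Obj C'" for Y
    unfolding a_def by (rule universal_shift[OF U[OF that]])
  note a' = universalD[OF a]
  have "\<exists>\<tau>. \<forall>Y \<in> Obj C'. \<tau> Y \<in> Iso C (omap G (shO C' Y)) (shO C (omap G Y)) \<and>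
      a Y \<cdot>\<^bsub>C'\<^esub> amap F (\<tau> Y) = \<epsilon> (shO C' Y)"
    using universal_Iso[OF U a] by (intro bchoice) (simp add: Bex_def)
  then obtain \<tau> where \<tau>_Iso: "\<And>Y. Y \<in> Obj C' \<Longrightarrow> \<tau> Y \<in> Iso C (omap G (shO C' Y)) (shO C (omap G Y))"
    and \<tau>: "\<And>Y. Y \<in> Obj C' \<Longrightarrow> a Y \<cdot>\<^bsub>C'\<^esub> amap F (\<tau> Y) = \<epsilon> (shO C' Y)"
    by blast
  have \<tau>_arr: "\<tau> Y \<in> Arr C" "Dom C (\<tau> Y) = omap G (shO C' Y)" "Cod C (\<tau> Y) = shO C (omap G Y)"
    if "Y \<in> Obj C'" for Y
    using \<tau>_Iso[OF that] by (simp_all add: Iso_def Hom_iff)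
  have a_nat: "a Y' \<cdot>\<^bsub>C'\<^esub> amap F (shA C (amap G g)) = shA C' g \<cdot>\<^bsub>C'\<^esub> a Y" if g: "g \<in> Hom C' Y Y'" for Y Y' g
  proof -
    note g' = C'.HomD[OF g] and Gg = C.HomD[OF G.F_Hom[OF g]]
    have Y: "Y \<in> Obj C'" "Y' \<in> Obj C'" using g' by auto
    have "a Y' \<cdot>\<^bsub>C'\<^esub> amap F (shA C (amap G g)) =
        shA C' (\<epsilon> Y' \<cdot>\<^bsub>C'\<^esub> amap F (amap G g)) \<cdot>\<^bsub>C'\<^esub> \<theta> (omap G Y)"
      using \<theta>_natural[OF G.F_Hom[OF g]] U'[OF Y(1)] U'[OF Y(2)] g' Gg by (simp add: a_def)
    also have "\<dots> = shA C' g \<cdot>\<^bsub>C'\<^esub> a Y"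
      unfolding nat[OF g] using U'[OF Y(1)] g' by (simp add: a_def)
    finally show ?thesis .
  qed
  have \<tau>_nat: "\<tau> Y' \<cdot> amap G (shA C' g) = shA C (amap G g) \<cdot> \<tau> Y" if g: "g \<in> Hom C' Y Y'" for Y Y' g
  proof -
    note g' = C'.HomD[OF g] and Gg = C.HomD[OF G.F_Hom[OF g]]
    have Y: "Y \<in> Obj C'" "Y' \<in> Obj C'" using g' by auto
    have g1: "shA C' g \<in> Hom C' (shO C' Y) (shO C' Y')" using g' by (simp add: Hom_iff)
    note Gg1 = C.HomD[OF G.F_Hom[OF g1]]
    show ?thesis
    proof (rule universal_eq[OF a[OF Y(2)]])
      show "\<tau> Y' \<cdot> amap G (shA C' g) \<in> Hom C (omap G (shO C' Y)) (shO C (omap G Y'))"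
        using \<tau>_arr[OF Y(2)] Gg1 by (simp add: Hom_iff)
      show "shA C (amap G g) \<cdot> \<tau> Y \<in> Hom C (omap G (shO C' Y)) (shO C (omap G Y'))"
        using \<tau>_arr[OF Y(1)] Gg by (simp add: Hom_iff)
      show "a Y' \<cdot>\<^bsub>C'\<^esub> amap F (\<tau> Y' \<cdot> amap G (shA C' g)) =
          a Y' \<cdot>\<^bsub>C'\<^esub> amap F (shA C (amap G g) \<cdot> \<tau> Y)"
        using C'.Comp_reassoc[OF \<tau>[OF Y(2)], of "amap F (amap G (shA C' g))"]
          C'.Comp_reassoc[OF a_nat[OF g], of "amap F (\<tau> Y)"] nat[OF g1] \<tau>[OF Y(1)]
          \<tau>_arr[OF Y(1)] \<tau>_arr[OF Y(2)] Gg Gg1 g' a'[OF Y(1)] a'[OF Y(2)] by simp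
    qed
  qed
  have "(amap G f, amap G g, \<tau> (Dom C' f) \<cdot> amap G h) \<in> Dist C" if D: "(f, g, h) \<in> Dist C'" for f g h
  proof -
    obtain X Y Z where T: "triangle C' X Y Z f g h" using D C'.Dist_iff_triangle by blast
    note t = C'.triangleD[OF T]
    note Gf = C.HomD[OF G.F_Hom[OF t(2)]] and Gg = C.HomD[OF G.F_Hom[OF t(3)]]
      and Gh = C.HomD[OF G.F_Hom[OF t(4)]]
    \<comment> \<open>The image of the triangle under \<open>G\<close> is not yet known to be
      distinguished, so a cone \<open>K\<close> of \<open>amap G f\<close> is compared with it:
      \<open>c\<close> makes \<open>K\<close> universal for \<open>Z\<close>, and \<open>w\<close>
      identifies it with \<open>omap G Z\<close>.\<close>
    obtain K u v where K: "triangle C (omap G X) (omap G Y) K (amap G f) u v"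
      using C.triangle_cone[OF G.F_Hom[OF t(2)]] by blast
    note k = C.triangleD[OF K]
    obtain c where c: "c \<in> Hom C' (omap F K) Z" "c \<cdot>\<^bsub>C'\<^esub> amap F u = g \<cdot>\<^bsub>C'\<^esub> \<epsilon> Y"
      "shA C' (\<epsilon> X) \<cdot>\<^bsub>C'\<^esub> (\<theta> (omap G X) \<cdot>\<^bsub>C'\<^esub> amap F v) = h \<cdot>\<^bsub>C'\<^esub> c"
      using C'.triangle_map[OF F_triangle[OF K] T U'(3)[OF t(14)] U'(3)[OF t(15)]] nat[OF t(2)]
      by blast
    note c' = C'.HomD[OF c(1)]
    have "universal_arrow C C' F Z K c"
      by (rule universal_cone[OF K T U[OF t(14)] U[OF t(15)] universal_shift[OF U[OF t(14)]]
            universal_shift[OF U[OF t(15)]] c(1) nat[OF t(2)] c(2,3)])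
    then obtain w where w: "w \<in> Iso C K (omap G Z)" "\<epsilon> Z \<cdot>\<^bsub>C'\<^esub> amap F w = c"
      using universal_Iso[OF _ U[OF t(16)]] by blast
    have w': "w \<in> Arr C" "Dom C w = K" "Cod C w = omap G Z"
      using w(1) by (simp_all add: Iso_def Hom_iff)
    have wu: "w \<cdot> u = amap G g"
    proof (rule universal_eq[OF U[OF t(16)] _ G.F_Hom[OF t(3)]])
      show "w \<cdot> u \<in> Hom C (omap G Y) (omap G Z)" using w' k by (simp add: Hom_iff)
      show "\<epsilon> Z \<cdot>\<^bsub>C'\<^esub> amap F (w \<cdot> u) = \<epsilon> Z \<cdot>\<^bsub>C'\<^esub> amap F (amap G g)"
        using C'.Comp_reassoc[OF w(2), of "amap F u"] nat[OF t(3)] c(2) w' k U'[OF t(16)] by simp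
    qed
    \<comment> \<open>Both sides are tested against the universal arrow \<open>a X\<close>; the
      third square for \<open>c\<close>, naturality of the counit at \<open>h\<close> and the
      defining equation of \<open>\<tau>\<close> make them agree.\<close>
    have v: "v = \<tau> X \<cdot> amap G h \<cdot> w"
    proof (rule universal_eq[OF a[OF t(14)] k(4)])
      note \<tau>' = \<tau>_arr[OF t(14)]
      show "\<tau> X \<cdot> amap G h \<cdot> w \<in> Hom C K (shO C (omap G X))"
        using \<tau>' Gh w' by (simp add: Hom_iff)
      have "a X \<cdot>\<^bsub>C'\<^esub> amap F (\<tau> X \<cdot> amap G h \<cdot> w) =
          \<epsilon> (shO C' X) \<cdot>\<^bsub>C'\<^esub> (amap F (amap G h) \<cdot>\<^bsub>C'\<^esub> amap F w)"
        using C'.Comp_reassoc[OF \<tau>[OF t(14)], of "amap F (amap G h) \<cdot>\<^bsub>C'\<^esub> amap F w"]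
          \<tau>' Gh w' a'[OF t(14)] by simp
      also have "\<dots> = h \<cdot>\<^bsub>C'\<^esub> c"
        using C'.Comp_reassoc[OF nat[OF t(4)], of "amap F w"] w(2) Gh w' t U'[OF t(16)]
          U'[of "shO C' X"] by simp
      also have "\<dots> = a X \<cdot>\<^bsub>C'\<^esub> amap F v"
        using c(3) k t U'[OF t(14)] by (simp add: a_def)
      finally show "a X \<cdot>\<^bsub>C'\<^esub> amap F v = a X \<cdot>\<^bsub>C'\<^esub> amap F (\<tau> X \<cdot> amap G h \<cdot> w)" by simp
    qed
    have "(amap G f, amap G g, \<tau> X \<cdot> amap G h) \<in> Dist C"
    proof (rule C.TR1_Iso[OF k(1-4)])
      show "amap G f \<in> Hom C (omap G X) (omap G Y)" "amap G g \<in> Hom C (omap G Y) (omap G Z)"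
        using G.F_Hom t(2,3) by blast+
      show "\<tau> X \<cdot> amap G h \<in> Hom C (omap G Z) (shO C (omap G X))"
        using \<tau>_arr[OF t(14)] Gh by (simp add: Hom_iff)
      show "Ide C (omap G X) \<in> Iso C (omap G X) (omap G X)" "Ide C (omap G Y) \<in> Iso C (omap G Y) (omap G Y)"
        using C.Ide_Iso k(14,15) by blast+
      show "w \<in> Iso C K (omap G Z)" by (rule w(1))
      show "Ide C (omap G Y) \<cdot> amap G f = amap G f \<cdot> Ide C (omap G X)" using Gf by simp
      show "w \<cdot> u = amap G g \<cdot> Ide C (omap G Y)" using wu Gg by simp
      show "shA C (Ide C (omap G X)) \<cdot> v = \<tau> X \<cdot> amap G h \<cdot> w" using v k by simp
    qed
    then show ?thesis using t by simp
  qed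
  then show ?thesis
    unfolding exact_functor_def
    using C.triangulated_category_axioms C'.triangulated_category_axioms add \<tau>_Iso \<tau>_nat
    by blast
qed

end

text \<open>\<open>exact_functor\<close> merely asserts that some comparison exists. One is fixed as
  a locale parameter here, so that naturality and triangles refer to the same
  \<open>\<theta>\<close> throughout.\<close>

lemma exact_functorE:
  assumes "exact_functor C C' F"
  obtains \<theta> where "exact_between C C' F \<theta>"
proof -
  interpret C: triangulated_category C using assms by (simp add: exact_functor_def)
  obtain \<theta> where "triangulated_category C" "triangulated_category C'" "additive_functor C C' F"
    "\<forall>X \<in> Obj C. \<theta> X \<in> Iso C' (omap F (shO C X)) (shO C' (omap F X))"
    and nat: "\<forall>X \<in> Obj C. \<forall>Y \<in> Obj C. \<forall>f \<in> Hom C X Y.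
        \<theta> Y \<cdot>\<^bsub>C'\<^esub> amap F (shA C f) = shA C' (amap F f) \<cdot>\<^bsub>C'\<^esub> \<theta> X"
    and "\<forall>f g h. (f, g, h) \<in> Dist C \<longrightarrow>
        (amap F f, amap F g, \<theta> (Dom C f) \<cdot>\<^bsub>C'\<^esub> amap F h) \<in> Dist C'"
    using assms unfolding exact_functor_def by blast
  moreover have "\<theta> Y \<cdot>\<^bsub>C'\<^esub> amap F (shA C f) = shA C' (amap F f) \<cdot>\<^bsub>C'\<^esub> \<theta> X"
    if "f \<in> Hom C X Y" for f X Y
    using nat that C.HomD[OF that] by blast
  ultimately have "exact_between C C' F \<theta>"
    by (simp add: exact_between_def exact_between_axioms_def)
  then show ?thesis using that by blast
qed

section \<open>Coproducts and compact objects\<close>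

lemma small_subset: "\<lbrakk>small U B; A \<subseteq> B\<rbrakk> \<Longrightarrow> small U A"
  unfolding small_def using card_of_mono1 ordLeq_ordLess_trans by blast

lemma small_image: "small U A \<Longrightarrow> small U (f ` A)"
  unfolding small_def using card_of_image ordLeq_ordLess_trans by blast

lemma small_inj:
  assumes "small TYPE('u) I"
  shows "\<exists>e :: 'i \<Rightarrow> 'u. inj_on e (I :: 'i set)"
  using ordLess_imp_ordLeq[of "|I|" "|UNIV :: 'u set|"] assms
  unfolding small_def card_of_ordLeq[symmetric] by blast

lemma small_nat: "universe TYPE('u) \<Longrightarrow> small TYPE('u) (UNIV :: nat set)"
  unfolding universe_def small_def using card_of_nat ordIso_ordLess_trans by blast

text \<open>Here regularity is used: an infinite regular cardinal is stable, which is closure under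
  small disjoint unions.\<close>

lemma small_Sigma:
  assumes U: "universe TYPE('u)" and "small TYPE('u) I" "\<And>i. i \<in> I \<Longrightarrow> small TYPE('u) (A i)"
  shows "small TYPE('u) (Sigma I A)"
proof -
  have "infinite (UNIV :: 'u set)"
    using U ordLess_imp_ordLeq infinite_iff_natLeq_ordLeq unfolding universe_def by blast
  then have "stable |UNIV :: 'u set|"
    using U unfolding universe_def by (intro regularCard_stable card_of_Card_order)
        (simp_all add: Field_card_of)
  then show ?thesis
    using assms(2,3) unfolding small_def by (intro stable_elim) auto
qed

lemma is_coproduct_cong:
  assumes "\<And>i. i \<in> I \<Longrightarrow> X i = X' i" "\<And>i. i \<in> I \<Longrightarrow> \<iota> i = \<iota>' i"
  shows "is_coproduct C I X P \<iota> \<longleftrightarrow> is_coproduct C I X' P \<iota>'"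
  unfolding is_coproduct_def using assms by simp

lemma coproductD:
  assumes "is_coproduct C I X P \<iota>"
  shows "P \<in> Obj C" "i \<in> I \<Longrightarrow> X i \<in> Obj C" "i \<in> I \<Longrightarrow> \<iota> i \<in> Hom C (X i) P"
  using assms by (simp_all add: is_coproduct_def)

lemma coproduct_map_ex:
  assumes "is_coproduct C I X P \<iota>" "Y \<in> Obj C" "\<And>i. i \<in> I \<Longrightarrow> f i \<in> Hom C (X i) Y"
  shows "\<exists>g \<in> Hom C P Y. \<forall>i \<in> I. g \<cdot>\<^bsub>C\<^esub> \<iota> i = f i"
  using assms unfolding is_coproduct_def by blast

lemma (in category) coproduct_map_eq:
  assumes "is_coproduct C I X P \<iota>" "g \<in> Hom C P Y" "h \<in> Hom C P Y"
    "\<And>i. i \<in> I \<Longrightarrow> g \<cdot> \<iota> i = h \<cdot> \<iota> i"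
  shows "g = h"
proof -
  have Y: "Y \<in> Obj C" using HomD[OF assms(2)] by simp
  have "h \<cdot> \<iota> i \<in> Hom C (X i) Y" if "i \<in> I" for i
    using that assms(1,3) Comp_in_Hom unfolding is_coproduct_def by blast
  then obtain k where k: "\<And>k'. \<lbrakk>k' \<in> Hom C P Y; \<forall>i \<in> I. k' \<cdot> \<iota> i = h \<cdot> \<iota> i\<rbrakk> \<Longrightarrow> k' = k"
    using assms(1)[unfolded is_coproduct_def, THEN conjunct2, THEN conjunct2, rule_format,
        OF Y, of "\<lambda>i. h \<cdot> \<iota> i"] by blast
  have "g = k" "h = k" using k[OF assms(2)] k[OF assms(3)] assms(4) by simp_all
  then show ?thesis by simp
qed

text \<open>Small coproducts and compactness are defined over index sets in \<open>'u\<close>, but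
  the constructions below are indexed by natural numbers and by pairs of an object and a morphism.
  Embedding such an index set into \<open>'u\<close> and reindexing bridges the gap.\<close>

lemma is_coproduct_reindex:
  assumes "inj_on e I"
  shows "is_coproduct C (e ` I) X P \<iota> \<longleftrightarrow> is_coproduct C I (\<lambda>i. X (e i)) P (\<lambda>i. \<iota> (e i))"
proof -
  have "(\<forall>f. (\<forall>i \<in> e ` I. f i \<in> Hom C (X i) Y) \<longrightarrow>
        (\<exists>!g. g \<in> Hom C P Y \<and> (\<forall>i \<in> e ` I. g \<cdot>\<^bsub>C\<^esub> \<iota> i = f i))) \<longleftrightarrow>
      (\<forall>f. (\<forall>i \<in> I. f i \<in> Hom C (X (e i)) Y) \<longrightarrow>
        (\<exists>!g. g \<in> Hom C P Y \<and> (\<forall>i \<in> I. g \<cdot>\<^bsub>C\<^esub> \<iota> (e i) = f i)))" (is "?L \<longleftrightarrow> ?R") for Y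
  proof
    assume L: ?L
    show ?R
    proof (intro allI impI)
      fix f assume f: "\<forall>i \<in> I. f i \<in> Hom C (X (e i)) Y"
      have "\<forall>i \<in> e ` I. f (inv_into I e i) \<in> Hom C (X i) Y" using f assms by simp
      then have "\<exists>!g. g \<in> Hom C P Y \<and> (\<forall>i \<in> e ` I. g \<cdot>\<^bsub>C\<^esub> \<iota> i = f (inv_into I e i))"
        by (rule L[THEN spec, THEN mp])
      then show "\<exists>!g. g \<in> Hom C P Y \<and> (\<forall>i \<in> I. g \<cdot>\<^bsub>C\<^esub> \<iota> (e i) = f i)" using assms by simp
    qed
  next
    assume R: ?R
    show ?L
    proof (intro allI impI)
      fix f assume f: "\<forall>i \<in> e ` I. f i \<in> Hom C (X i) Y"
      with R[rule_format, of "\<lambda>i. f (e i)"]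
      show "\<exists>!g. g \<in> Hom C P Y \<and> (\<forall>i \<in> e ` I. g \<cdot>\<^bsub>C\<^esub> \<iota> i = f i)" by simp
    qed
  qed
  then show ?thesis unfolding is_coproduct_def by simp
qed

lemma is_coproduct_reindex':
  assumes "inj_on e I"
  shows "is_coproduct C I X P \<iota> \<longleftrightarrow>
    is_coproduct C (e ` I) (\<lambda>i. X (inv_into I e i)) P (\<lambda>i. \<iota> (inv_into I e i))"
  unfolding is_coproduct_reindex[OF assms]
  by (rule is_coproduct_cong) (use assms in simp_all)

lemma small_coproduct_ex:
  assumes "has_small_coproducts TYPE('u) C" "small TYPE('u) I" "\<And>i. i \<in> I \<Longrightarrow> X i \<in> Obj C"
  shows "\<exists>P \<iota>. is_coproduct C I X P \<iota>"
proof -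
  obtain e :: "_ \<Rightarrow> 'u" where e: "inj_on e I" using small_inj[OF assms(2)] by blast
  have "\<forall>i \<in> e ` I. X (inv_into I e i) \<in> Obj C" using assms(3) e by simp
  then obtain P \<iota> where "is_coproduct C (e ` I) (\<lambda>i. X (inv_into I e i)) P \<iota>"
    using assms(1)[unfolded has_small_coproducts_def, THEN spec[of _ "e ` I"],
        THEN spec[of _ "\<lambda>i. X (inv_into I e i)"]] small_image[OF assms(2), of e] by blast
  then have *: "is_coproduct C I (\<lambda>i. X (inv_into I e (e i))) P (\<lambda>i. \<iota> (e i))"
    unfolding is_coproduct_reindex[OF e] .
  have "is_coproduct C I X P (\<lambda>i. \<iota> (e i))"
    by (rule iffD1[OF is_coproduct_cong *]) (use e in simp_all)
  then show ?thesis by blast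
qed

lemma respects_coproducts_small:
  assumes "respects_coproducts TYPE('u) C C' F" "small TYPE('u) I" "is_coproduct C I X P \<iota>"
  shows "is_coproduct C' I (\<lambda>i. omap F (X i)) (omap F P) (\<lambda>i. amap F (\<iota> i))"
proof -
  obtain e :: "_ \<Rightarrow> 'u" where e: "inj_on e I" using small_inj[OF assms(2)] by blast
  show ?thesis
    using assms(1)[unfolded respects_coproducts_def, THEN spec[of _ "e ` I"],
        THEN spec[of _ "\<lambda>i. X (inv_into I e i)"], THEN spec[of _ P],
        THEN spec[of _ "\<lambda>i. \<iota> (inv_into I e i)"]]
      small_image[OF assms(2)] assms(3)
    unfolding is_coproduct_reindex'[OF e, of C X P \<iota>]
      is_coproduct_reindex'[OF e, of C' "\<lambda>i. omap F (X i)"] by blast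
qed

context additive_category
begin

text \<open>The universal property is applied to the identity on the summand \<open>i\<close> and
  zero on the others.\<close>

lemma coproduct_projection:
  assumes "is_coproduct C I X P \<iota>" "i \<in> I"
  shows "\<exists>p \<in> Hom C P (X i). p \<cdot> \<iota> i = Ide C (X i) \<and> (\<forall>j \<in> I. j \<noteq> i \<longrightarrow> p \<cdot> \<iota> j = Zero C (X j) (X i))"
proof -
  note c = coproductD[OF assms(1)]
  have "\<exists>p \<in> Hom C P (X i). \<forall>j \<in> I. p \<cdot> \<iota> j = (if j = i then Ide C (X i) else Zero C (X j) (X i))"
    by (rule coproduct_map_ex[OF assms(1) c(2)[OF assms(2)]]) (use c(2) assms(2) in \<open>simp add: Hom_iff\<close>)
  then obtain p where "p \<in> Hom C P (X i)"
    "\<forall>j \<in> I. p \<cdot> \<iota> j = (if j = i then Ide C (X i) else Zero C (X j) (X i))" by blast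
  then show ?thesis using assms(2) by (intro bexI[of _ p]) simp_all
qed

lemma finsum_induct:
  assumes "abelian_monoid G" "finite J" "f \<in> J \<rightarrow> carrier G" "Q \<zero>\<^bsub>G\<^esub>"
    "\<And>x y. \<lbrakk>x \<in> carrier G; y \<in> carrier G; Q x; Q y\<rbrakk> \<Longrightarrow> Q (x \<oplus>\<^bsub>G\<^esub> y)"
    "\<And>j. j \<in> J \<Longrightarrow> Q (f j)"
  shows "Q (finsum G f J)"
proof -
  interpret abelian_monoid G by fact
  show ?thesis
    using assms(2,3,6)
  proof (induction J)
    case (insert j J)
    then have "f \<in> J \<rightarrow> carrier G" "f j \<in> carrier G" "Q (f j)" by auto
    with insert assms(5) show ?case by simp
  qed (simp add: assms(4))
qed

text \<open>Compactness makes a morphism into a coproduct a finite sum of morphisms through the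
  summands. Packaged as an induction rule, this spares later proofs the finite sums.\<close>

lemma compact_induct:
  assumes M: "compact_object TYPE('u) C M" and I: "small TYPE('u) I"
    and P: "is_coproduct C I X P \<iota>" and g: "g \<in> Hom C M P"
    and zero: "Q (Zero C M P)"
    and add: "\<And>h h'. \<lbrakk>h \<in> Hom C M P; h' \<in> Hom C M P; Q h; Q h'\<rbrakk> \<Longrightarrow> Q (Add C h h')"
    and inj: "\<And>i f. \<lbrakk>i \<in> I; f \<in> Hom C M (X i)\<rbrakk> \<Longrightarrow> Q (\<iota> i \<cdot> f)"
  shows "Q g"
proof -
  obtain e :: "_ \<Rightarrow> 'u" where e: "inj_on e I" using small_inj[OF I] by blast
  define I' X' \<iota>' where "I' = e ` I" and "X' = (\<lambda>i. X (inv_into I e i))"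
    and "\<iota>' = (\<lambda>i. \<iota> (inv_into I e i))"
  have P': "is_coproduct C I' X' P \<iota>'"
    using P unfolding I'_def X'_def \<iota>'_def is_coproduct_reindex'[OF e, of C X P \<iota>] .
  note c = coproductD[OF P']
  have G: "abelian_group (hom_group C M P)"
    using Hom_abelian_group HomD[OF g] by blast
  have "(\<lambda>f. finsum (hom_group C M P) (\<lambda>i. \<iota>' i \<cdot> f i) {i \<in> I'. f i \<noteq> Zero C M (X' i)}) `
      {f \<in> (\<Pi>\<^sub>E i\<in>I'. Hom C M (X' i)). finite {i \<in> I'. f i \<noteq> Zero C M (X' i)}} = Hom C M P"
    using M P' small_image[OF I, of e] unfolding compact_object_def bij_betw_def I'_def by blast
  with g obtain f where f: "f \<in> (\<Pi>\<^sub>E i\<in>I'. Hom C M (X' i))" "finite {i \<in> I'. f i \<noteq> Zero C M (X' i)}"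
    and gf: "g = finsum (hom_group C M P) (\<lambda>i. \<iota>' i \<cdot> f i) {i \<in> I'. f i \<noteq> Zero C M (X' i)}"
    by blast
  have fi: "f i \<in> Hom C M (X' i)" if "i \<in> I'" for i using f(1) that by (rule PiE_mem)
  show ?thesis
    unfolding gf
  proof (rule finsum_induct[OF _ f(2)])
    show "abelian_monoid (hom_group C M P)" using G by (rule abelian_group.axioms(1))
    show "(\<lambda>i. \<iota>' i \<cdot> f i) \<in> {i \<in> I'. f i \<noteq> Zero C M (X' i)} \<rightarrow> carrier (hom_group C M P)"
      using fi c(3) Comp_in_Hom by fastforce
    fix i assume "i \<in> {i \<in> I'. f i \<noteq> Zero C M (X' i)}"
    then have i: "i \<in> I'" by simp
    then have "inv_into I e i \<in> I" by (simp add: I'_def inv_into_into)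
    then show "Q (\<iota>' i \<cdot> f i)" using inj fi[OF i] by (simp add: X'_def \<iota>'_def)
  qed (use zero add in simp_all)
qed

text \<open>A factorization through a finite subcoproduct, recast in terms of test morphisms so that
  no subcoproduct has to be formed. Supports of sums are united, and a morphism through one summand
  has a singleton support.\<close>

lemma compact_support:
  assumes M: "compact_object TYPE('u) C M" and I: "small TYPE('u) I"
    and P: "is_coproduct C I X P \<iota>" and g: "g \<in> Hom C M P"
  shows "\<exists>J. finite J \<and> J \<subseteq> I \<and>
    (\<forall>W. \<forall>k \<in> Hom C P W. (\<forall>i \<in> J. k \<cdot> \<iota> i = Zero C (X i) W) \<longrightarrow> k \<cdot> g = Zero C M W)"
proof -
  define S where "S J h \<longleftrightarrow> finite J \<and> J \<subseteq> I \<and>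
    (\<forall>W. \<forall>k \<in> Hom C P W. (\<forall>i \<in> J. k \<cdot> \<iota> i = Zero C (X i) W) \<longrightarrow> k \<cdot> h = Zero C M W)" for J h
  have SD: "k \<cdot> h = Zero C M W"
    if "S J h" "k \<in> Hom C P W" "\<And>i. i \<in> J \<Longrightarrow> k \<cdot> \<iota> i = Zero C (X i) W" for J h k W
    using that unfolding S_def by blast
  have M': "M \<in> Obj C" and P': "P \<in> Obj C" using HomD[OF g] by auto
  have "\<exists>J. S J g"
  proof (rule compact_induct[OF M I P g])
    have "S {} (Zero C M P)" unfolding S_def using M' by (simp add: Hom_iff)
    then show "\<exists>J. S J (Zero C M P)" by blast
  next
    fix h h' assume h: "h \<in> Hom C M P" and h': "h' \<in> Hom C M P"
      and "\<exists>J. S J h" "\<exists>J. S J h'"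
    then obtain J J' where J: "S J h" and J': "S J' h'" by blast
    have "k \<cdot> Add C h h' = Zero C M W"
      if "k \<in> Hom C P W" "\<forall>i \<in> J \<union> J'. k \<cdot> \<iota> i = Zero C (X i) W" for k W
      using SD[OF J that(1)] SD[OF J' that(1)] that(2) HomD[OF that(1)] HomD[OF h] HomD[OF h']
      by simp
    then have "S (J \<union> J') (Add C h h')" using J J' unfolding S_def by simp
    then show "\<exists>J. S J (Add C h h')" by blast
  next
    fix i f assume i: "i \<in> I" and f: "f \<in> Hom C M (X i)"
    note \<iota> = HomD[OF coproductD(3)[OF P i]]
    have "k \<cdot> (\<iota> i \<cdot> f) = Zero C M W" if "k \<in> Hom C P W" "k \<cdot> \<iota> i = Zero C (X i) W" for k W
      using Comp_reassoc[OF that(2), of f] HomD[OF that(1)] HomD[OF f] \<iota> by simp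
    then have "S {i} (\<iota> i \<cdot> f)" using i unfolding S_def by simp
    then show "\<exists>J. S J (\<iota> i \<cdot> f)" by blast
  qed
  then show ?thesis unfolding S_def .
qed

text \<open>The support of \<open>g\<close> can be shrunk one index at a time, by correcting test morphisms
  with the projections.\<close>

lemma compact_eq_Zero:
  assumes M: "compact_object TYPE('u) C M" and I: "small TYPE('u) I"
    and P: "is_coproduct C I X P \<iota>" and g: "g \<in> Hom C M P"
    and p: "\<And>i. i \<in> I \<Longrightarrow> p i \<in> Hom C P (X i)" "\<And>i. i \<in> I \<Longrightarrow> p i \<cdot> \<iota> i = Ide C (X i)"
    "\<And>i j. \<lbrakk>i \<in> I; j \<in> I; j \<noteq> i\<rbrakk> \<Longrightarrow> p i \<cdot> \<iota> j = Zero C (X j) (X i)"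
    and pg: "\<And>i. i \<in> I \<Longrightarrow> p i \<cdot> g = Zero C M (X i)"
  shows "g = Zero C M P"
proof -
  note g' = HomD[OF g]
  obtain J where J: "finite J" "J \<subseteq> I" and
    k: "\<And>W k. \<lbrakk>k \<in> Hom C P W; \<forall>i \<in> J. k \<cdot> \<iota> i = Zero C (X i) W\<rbrakk> \<Longrightarrow> k \<cdot> g = Zero C M W"
    using compact_support[OF M I P g] by blast
  from J k show ?thesis
  proof (induction J)
    case empty
    then have "Ide C P \<cdot> g = Zero C M P" using g' by (simp add: Hom_iff)
    then show ?case using g' by simp
  next
    case (insert j J)
    then have j: "j \<in> I" by simp
    note pj = HomD[OF p(1)[OF j]] and \<iota>j = HomD[OF coproductD(3)[OF P j]]
    show ?case
    proof (rule insert.IH)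
      show "J \<subseteq> I" using insert.prems by simp
      fix W k assume k: "k \<in> Hom C P W" and kJ: "\<forall>i \<in> J. k \<cdot> \<iota> i = Zero C (X i) W"
      note k' = HomD[OF k]
      \<comment> \<open>Since \<open>p j \<cdot> g\<close> is zero, the correction leaves the
        composite with \<open>g\<close> unchanged, while it makes the test morphism vanish on the
        summand \<open>j\<close> too.\<close>
      let ?k = "Add C k (Neg C (k \<cdot> (\<iota> j \<cdot> p j)))"
      have "?k \<cdot> \<iota> i = Zero C (X i) W" if i: "i \<in> insert j J" for i
      proof (cases "i = j")
        case True
        then show ?thesis using k' pj \<iota>j p(2)[OF j] by simp
      next
        case False
        then have iJ: "i \<in> J" and iI: "i \<in> I" using i insert.prems by auto
        note \<iota>i = HomD[OF coproductD(3)[OF P iI]]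
        show ?thesis using k' pj \<iota>j \<iota>i p(3)[OF j iI False] kJ iJ by simp
      qed
      moreover have "?k \<in> Hom C P W" using k' pj \<iota>j by (simp add: Hom_iff)
      ultimately have "?k \<cdot> g = Zero C M W" using insert.prems(2)[of ?k W] by blast
      then show "k \<cdot> g = Zero C M W" using k' pj \<iota>j g' pg[OF j] by simp
    qed
  qed
qed

end

section \<open>Brown representability\<close>

context triangulated_category
begin

lemma inv_shO:
  assumes "X \<in> Obj C"
  shows "inv_into (Obj C) (shO C) X \<in> Obj C" "shO C (inv_into (Obj C) (shO C) X) = X"
    "inv_into (Obj C) (shO C) (shO C X) = X"
  using Shift_bij_Obj assms
  by (simp_all add: bij_betw_def inv_into_into f_inv_into_f inv_into_f_f)

lemma shift_by_0 [simp]: "shift_by C 0 X = X"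
  by (simp add: shift_by_def)

lemma shift_by_step:
  assumes "X \<in> Obj C"
  shows "shift_by C (k + 1) X = shO C (shift_by C k X)" "shift_by C k X \<in> Obj C"
proof -
  have up: "(shO C ^^ n) X \<in> Obj C" for n
    by (induction n) (use assms in simp_all)
  have down: "(inv_into (Obj C) (shO C) ^^ n) X \<in> Obj C" for n
    by (induction n) (use assms inv_shO in simp_all)
  show "shift_by C k X \<in> Obj C" using up down by (simp add: shift_by_def)
  show "shift_by C (k + 1) X = shO C (shift_by C k X)"
  proof (cases "0 \<le> k")
    case True
    then have "nat (k + 1) = Suc (nat k)" by simp
    with True show ?thesis by (simp add: shift_by_def)
  next
    case False
    then have "nat (- k) = Suc (nat (- (k + 1)))" by simp
    \<comment> \<open>At \<open>k = - 1\<close> the two branches of \<open>shift_by\<close> meet: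
      the successor already falls into the nonnegative one.\<close>
    with False down show ?thesis
      by (cases "k = - 1") (simp_all add: shift_by_def inv_shO assms)
  qed
qed

lemma shift_by_pred:
  assumes "X \<in> Obj C"
  shows "shO C (shift_by C (k - 1) X) = shift_by C k X"
  using shift_by_step(1)[OF assms, of "k - 1"] by simp

lemma shift_by_shO:
  assumes "X \<in> Obj C"
  shows "shift_by C k (shO C X) = shift_by C (k + 1) X"
proof (induction k rule: int_induct[where k = 0])
  case base
  show ?case using shift_by_step(1)[OF assms, of 0] by simp
next
  case (step1 i)
  then show ?case using shift_by_step(1)[OF assms, of "i + 1"] shift_by_step(1)[of "shO C X" i] assms
    by simp
next
  case (step2 i)
  have "shO C (shift_by C (i - 1) (shO C X)) = shO C (shift_by C (i - 1 + 1) X)"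
    using step2(2) shift_by_pred[of "shO C X" i] assms shift_by_step(1)[OF assms, of i] by simp
  then show ?case by (rule shO_inj) (use assms shift_by_step(2) in simp_all)
qed

text \<open>The shift is invertible, so the properties of interest hold at \<open>k\<close> exactly
  when they hold at \<open>k + 1\<close>; this covers both directions of induction over the integers
  at once.\<close>

lemma shift_by_all:
  assumes "Q 0" "\<And>k. Q k \<longleftrightarrow> Q (k + 1)"
  shows "Q (k :: int)"
proof (induction k rule: int_induct[where k = 0])
  case (step2 i)
  then show ?case using assms(2)[of "i - 1"] by simp
qed (use assms in auto)

lemma isomorphic_shift:
  assumes "isomorphic C X Y" "X \<in> Obj C" "Y \<in> Obj C"
  shows "isomorphic C (shift_by C k X) (shift_by C k Y)"
proof (rule shift_by_all[of "\<lambda>k. isomorphic C (shift_by C k X) (shift_by C k Y)"])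
  have "isomorphic C V W \<longleftrightarrow> isomorphic C (shO C V) (shO C W)" if VW: "V \<in> Obj C" "W \<in> Obj C" for V W
  proof
    assume "isomorphic C V W"
    then obtain a b where ab: "a \<in> Hom C V W" "b \<in> Hom C W V" "b \<cdot> a = Ide C V" "a \<cdot> b = Ide C W"
      by (rule isomorphicE)
    note h = HomD[OF ab(1)] HomD[OF ab(2)]
    show "isomorphic C (shO C V) (shO C W)"
    proof (rule isomorphicI[of "shA C a" _ _ "shA C b"])
      show "shA C b \<cdot> shA C a = Ide C (shO C V)" "shA C a \<cdot> shA C b = Ide C (shO C W)"
        using ab(3,4) h Shift_arr(6)[of a b] Shift_arr(6)[of b a] by simp_all
    qed (use h in \<open>simp_all add: Hom_iff\<close>)
  next
    assume "isomorphic C (shO C V) (shO C W)"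
    then obtain a' b' where ab': "a' \<in> Hom C (shO C V) (shO C W)" "b' \<in> Hom C (shO C W) (shO C V)"
      "b' \<cdot> a' = Ide C (shO C V)" "a' \<cdot> b' = Ide C (shO C W)" by (rule isomorphicE)
    obtain a b where ab: "a \<in> Hom C V W" "a' = shA C a" "b \<in> Hom C W V" "b' = shA C b"
      using shA_surj[OF ab'(1) VW] shA_surj[OF ab'(2) VW(2,1)] by blast
    note h = HomD[OF ab(1)] HomD[OF ab(3)]
    show "isomorphic C V W"
    proof (rule isomorphicI[OF ab(1,3)])
      show "b \<cdot> a = Ide C V" by (rule shA_inj) (use ab ab' h in simp_all)
      show "a \<cdot> b = Ide C W" by (rule shA_inj) (use ab ab' h in simp_all)
    qed
  qed
  then show "isomorphic C (shift_by C k X) (shift_by C k Y) \<longleftrightarrow>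
      isomorphic C (shift_by C (k + 1) X) (shift_by C (k + 1) Y)" for k
    using shift_by_step assms by simp
qed (use assms in simp)

text \<open>Three rotations shift each vertex and change the sign of each map. For this reason
  \<open>triangle_shift\<close> asserts only the existence of maps between the shifted
  vertices.\<close>

lemma triangle_shift_iff:
  assumes f: "f \<in> Hom C X Y" and g: "g \<in> Hom C Y Z" and h: "h \<in> Hom C Z (shO C X)"
  shows "triangle C X Y Z f g h \<longleftrightarrow> triangle C (shO C X) (shO C Y) (shO C Z)
    (Neg C (shA C f)) (Neg C (shA C g)) (Neg C (shA C h))"
proof -
  note d = HomD[OF f] HomD[OF g] HomD[OF h]
  have "Neg C (shA C f) \<in> Hom C (shO C X) (shO C Y)" "Neg C (shA C g) \<in> Hom C (shO C Y) (shO C Z)"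
    using d by (simp_all add: Hom_iff)
  then show ?thesis
    using triangle_rotate_iff f g h by blast
qed

lemma triangle_shift:
  assumes "triangle C X Y Z f g h"
  shows "\<exists>f g h. triangle C (shift_by C k X) (shift_by C k Y) (shift_by C k Z) f g h"
proof (rule shift_by_all[of
      "\<lambda>k. \<exists>f g h. triangle C (shift_by C k X) (shift_by C k Y) (shift_by C k Z) f g h"])
  note t = triangleD[OF assms]
  fix k
  let ?X = "shift_by C k X" and ?Y = "shift_by C k Y" and ?Z = "shift_by C k Z"
  have Ob: "?X \<in> Obj C" "?Y \<in> Obj C" "?Z \<in> Obj C" using shift_by_step(2) t by simp_all
  have "(\<exists>f g h. triangle C ?X ?Y ?Z f g h) \<longleftrightarrow>
      (\<exists>f g h. triangle C (shO C ?X) (shO C ?Y) (shO C ?Z) f g h)"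
  proof
    assume "\<exists>f g h. triangle C ?X ?Y ?Z f g h"
    then obtain f g h where T: "triangle C ?X ?Y ?Z f g h" by blast
    then show "\<exists>f g h. triangle C (shO C ?X) (shO C ?Y) (shO C ?Z) f g h"
      using triangle_shift_iff[OF triangleD(2-4)[OF T]] by blast
  next
    assume "\<exists>f g h. triangle C (shO C ?X) (shO C ?Y) (shO C ?Z) f g h"
    then obtain f g h where T: "triangle C (shO C ?X) (shO C ?Y) (shO C ?Z) f g h" by blast
    note T' = triangleD[OF T]
    obtain f' where f': "f' \<in> Hom C ?X ?Y" "f = shA C f'" using shA_surj[OF T'(2) Ob(1,2)] by blast
    obtain g' where g': "g' \<in> Hom C ?Y ?Z" "g = shA C g'" using shA_surj[OF T'(3) Ob(2,3)] by blast
    obtain h' where h': "h' \<in> Hom C ?Z (shO C ?X)" "h = shA C h'"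
      using shA_surj[OF T'(4) Ob(3)] Ob by auto
    note d = HomD[OF f'(1)] HomD[OF g'(1)] HomD[OF h'(1)]
    have N: "Neg C f' \<in> Hom C ?X ?Y" "Neg C g' \<in> Hom C ?Y ?Z" "Neg C h' \<in> Hom C ?Z (shO C ?X)"
      using d by (simp_all add: Hom_iff)
    have "triangle C ?X ?Y ?Z (Neg C f') (Neg C g') (Neg C h')"
      using T d f' g' h' unfolding triangle_shift_iff[OF N] by simp
    then show "\<exists>f g h. triangle C ?X ?Y ?Z f g h" by blast
  qed
  then show "(\<exists>f g h. triangle C ?X ?Y ?Z f g h) \<longleftrightarrow>
      (\<exists>f g h. triangle C (shift_by C (k + 1) X) (shift_by C (k + 1) Y) (shift_by C (k + 1) Z) f g h)"
    using shift_by_step(1) t by simp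
qed (use assms in auto)

lemma coproduct_shO_iff:
  assumes P: "P \<in> Obj C" and \<iota>: "\<And>i. i \<in> I \<Longrightarrow> \<iota> i \<in> Hom C (X i) P"
  shows "is_coproduct C I X P \<iota> \<longleftrightarrow>
    is_coproduct C I (\<lambda>i. shO C (X i)) (shO C P) (\<lambda>i. shA C (\<iota> i))"
proof -
  have X: "X i \<in> Obj C" if "i \<in> I" for i using HomD[OF \<iota>[OF that]] by simp
  have \<iota>': "\<iota> i \<in> Arr C" "Dom C (\<iota> i) = X i" "Cod C (\<iota> i) = P" if "i \<in> I" for i
    using HomD[OF \<iota>[OF that]] by simp_all
  have 0: "g \<cdot> \<iota> i = f i \<longleftrightarrow> shA C g \<cdot> shA C (\<iota> i) = shA C (f i)"
    if i: "i \<in> I" "g \<in> Hom C P Y" "f i \<in> Hom C (X i) Y" for g f i Y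
  proof -
    note d = \<iota>'[OF i(1)] HomD[OF i(2)] HomD[OF i(3)]
    have "shA C (g \<cdot> \<iota> i) = shA C g \<cdot> shA C (\<iota> i)" using d by simp
    moreover have "g \<cdot> \<iota> i = f i" if "shA C (g \<cdot> \<iota> i) = shA C (f i)"
      by (rule shA_inj[OF that]) (use d in simp_all)
    ultimately show ?thesis by auto
  qed
  have main: "(\<exists>!g. g \<in> Hom C P Y \<and> (\<forall>i \<in> I. g \<cdot> \<iota> i = f i)) \<longleftrightarrow>
      (\<exists>!g. g \<in> Hom C (shO C P) (shO C Y) \<and> (\<forall>i \<in> I. g \<cdot> shA C (\<iota> i) = shA C (f i)))"
    if Y: "Y \<in> Obj C" and f: "\<forall>i \<in> I. f i \<in> Hom C (X i) Y" for f Y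
  proof -
    have *: "bij_betw (shA C) {g \<in> Hom C P Y. \<forall>i \<in> I. g \<cdot> \<iota> i = f i}
        {g \<in> Hom C (shO C P) (shO C Y). \<forall>i \<in> I. g \<cdot> shA C (\<iota> i) = shA C (f i)}"
      by (rule bij_betw_Collect[OF bij_betw_shA[OF P Y]]) (use 0 f in blast)
    \<comment> \<open>Unique existence becomes cardinality one, which any bijection of solution sets
      preserves.\<close>
    have "(\<exists>!g. g \<in> S) \<longleftrightarrow> card S = Suc 0" for S :: "'m set"
      by (auto simp: card_1_singleton_iff)
    then have "(\<exists>!g. g \<in> S) \<longleftrightarrow> (\<exists>!g. g \<in> S')" if "bij_betw (shA C) S S'" for S S'
      using bij_betw_same_card[OF that] by simp
    from this[OF *] show ?thesis by simp
  qed
  show ?thesis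
  proof
    assume L: "is_coproduct C I X P \<iota>"
    show "is_coproduct C I (\<lambda>i. shO C (X i)) (shO C P) (\<lambda>i. shA C (\<iota> i))"
      unfolding is_coproduct_def
    proof (intro conjI ballI allI impI)
      fix Z f assume Z: "Z \<in> Obj C" and f: "\<forall>i \<in> I. f i \<in> Hom C (shO C (X i)) Z"
      obtain Y where Y: "Y \<in> Obj C" "Z = shO C Y" using shO_surj[OF Z] by blast
      have "\<forall>i \<in> I. \<exists>k \<in> Hom C (X i) Y. f i = shA C k"
        using f shA_surj X Y by blast
      then obtain k where k: "\<forall>i \<in> I. k i \<in> Hom C (X i) Y \<and> f i = shA C (k i)"
        by (metis (no_types))
      have "\<exists>!g. g \<in> Hom C P Y \<and> (\<forall>i \<in> I. g \<cdot> \<iota> i = k i)"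
        using L[unfolded is_coproduct_def] Y k by blast
      with main[OF Y(1), of k] k
      show "\<exists>!g. g \<in> Hom C (shO C P) Z \<and> (\<forall>i \<in> I. g \<cdot> shA C (\<iota> i) = f i)"
        unfolding Y(2) by simp
    qed (use P X \<iota>' in \<open>simp_all add: Hom_iff\<close>)
  next
    assume R: "is_coproduct C I (\<lambda>i. shO C (X i)) (shO C P) (\<lambda>i. shA C (\<iota> i))"
    show "is_coproduct C I X P \<iota>"
      unfolding is_coproduct_def
    proof (intro conjI ballI allI impI)
      fix Y f assume Y: "Y \<in> Obj C" and f: "\<forall>i \<in> I. f i \<in> Hom C (X i) Y"
      have "\<forall>i \<in> I. shA C (f i) \<in> Hom C (shO C (X i)) (shO C Y)"
        using f bij_betw_apply[OF bij_betw_shA[OF X Y]] by blast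
      then have "\<exists>!g. g \<in> Hom C (shO C P) (shO C Y) \<and> (\<forall>i \<in> I. g \<cdot> shA C (\<iota> i) = shA C (f i))"
        using R[unfolded is_coproduct_def, THEN conjunct2, THEN conjunct2, THEN bspec[of _ _ "shO C Y"],
            THEN spec[of _ "\<lambda>i. shA C (f i)"]] Y by simp
      then show "\<exists>!g. g \<in> Hom C P Y \<and> (\<forall>i \<in> I. g \<cdot> \<iota> i = f i)"
        using main[OF Y f] by blast
    qed (use P X \<iota> in simp_all)
  qed
qed

lemma coproduct_shift:
  assumes "is_coproduct C I X P \<iota>"
  shows "\<exists>\<iota>. is_coproduct C I (\<lambda>i. shift_by C k (X i)) (shift_by C k P) \<iota>"
proof (rule shift_by_all[of
      "\<lambda>k. \<exists>\<iota>. is_coproduct C I (\<lambda>i. shift_by C k (X i)) (shift_by C k P) \<iota>"])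
  note c = coproductD[OF assms]
  fix k
  let ?X = "\<lambda>i. shift_by C k (X i)" and ?P = "shift_by C k P"
  have Ob: "?P \<in> Obj C" "\<And>i. i \<in> I \<Longrightarrow> ?X i \<in> Obj C" using shift_by_step(2) c(1,2) by simp_all
  have "(\<exists>\<iota>. is_coproduct C I ?X ?P \<iota>) \<longleftrightarrow>
      (\<exists>\<iota>. is_coproduct C I (\<lambda>i. shO C (?X i)) (shO C ?P) \<iota>)"
  proof
    assume "\<exists>\<iota>. is_coproduct C I ?X ?P \<iota>"
    then obtain \<iota> where \<iota>: "is_coproduct C I ?X ?P \<iota>" by blast
    have "is_coproduct C I (\<lambda>i. shO C (?X i)) (shO C ?P) (\<lambda>i. shA C (\<iota> i))"
      using iffD1[OF coproduct_shO_iff[OF Ob(1) coproductD(3)[OF \<iota>]] \<iota>] .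
    then show "\<exists>\<iota>. is_coproduct C I (\<lambda>i. shO C (?X i)) (shO C ?P) \<iota>" by blast
  next
    assume "\<exists>\<iota>. is_coproduct C I (\<lambda>i. shO C (?X i)) (shO C ?P) \<iota>"
    then obtain \<iota> where \<iota>: "is_coproduct C I (\<lambda>i. shO C (?X i)) (shO C ?P) \<iota>" by blast
    have "\<forall>i \<in> I. \<exists>k \<in> Hom C (?X i) ?P. \<iota> i = shA C k"
      using shA_surj[OF coproductD(3)[OF \<iota>]] Ob by blast
    then obtain \<kappa> where \<kappa>: "\<forall>i \<in> I. \<kappa> i \<in> Hom C (?X i) ?P \<and> \<iota> i = shA C (\<kappa> i)"
      by (metis (no_types))
    have "is_coproduct C I (\<lambda>i. shO C (?X i)) (shO C ?P) (\<lambda>i. shA C (\<kappa> i))"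
      by (rule iffD1[OF is_coproduct_cong \<iota>]) (use \<kappa> in simp_all)
    then have "is_coproduct C I ?X ?P \<kappa>"
      by (rule iffD2[OF coproduct_shO_iff[OF Ob(1)], rotated]) (use \<kappa> in blast)
    then show "\<exists>\<iota>. is_coproduct C I ?X ?P \<iota>" by blast
  qed
  moreover have "is_coproduct C I (\<lambda>i. shift_by C (k + 1) (X i)) (shift_by C (k + 1) P) \<iota> \<longleftrightarrow>
      is_coproduct C I (\<lambda>i. shO C (?X i)) (shO C ?P) \<iota>" for \<iota>
    unfolding shift_by_step(1)[OF c(1)]
    by (rule is_coproduct_cong) (use c(2) shift_by_step(1) in simp_all)
  ultimately show "(\<exists>\<iota>. is_coproduct C I ?X ?P \<iota>) \<longleftrightarrow>
      (\<exists>\<iota>. is_coproduct C I (\<lambda>i. shift_by C (k + 1) (X i)) (shift_by C (k + 1) P) \<iota>)" by simp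
qed (use assms in auto)

end

section \<open>Construction of the representing object\<close>

context exact_between
begin

text \<open>The summands are indexed by all pairs \<open>(M, z)\<close>, one copy of
  \<open>M\<close> for each \<open>z\<close>, so that the map with component \<open>z\<close> there
  hits every \<open>z\<close> through an inclusion. Local smallness of \<open>C'\<close> keeps the
  index set small.\<close>

lemma brown_cover:
  assumes U: "universe TYPE('u)" "has_small_coproducts TYPE('u) C" "locally_small TYPE('u) C'"
    "respects_coproducts TYPE('u) C C' F"
    and S0: "small TYPE('u) S0" "S0 \<subseteq> Obj C" and N: "N \<in> Obj C'"
  shows "\<exists>X \<in> Obj C. \<exists>x \<in> Hom C' (omap F X) N.
    \<forall>M \<in> S0. \<forall>z \<in> Hom C' (omap F M) N. \<exists>f \<in> Hom C M X. x \<cdot>\<^bsub>C'\<^esub> amap F f = z"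
proof -
  let ?I = "Sigma S0 (\<lambda>M. Hom C' (omap F M) N)"
  have M: "M \<in> Obj C" if "M \<in> S0" for M using S0(2) that by blast
  have I: "small TYPE('u) ?I"
  proof (rule small_Sigma[OF U(1) S0(1)])
    show "small TYPE('u) (Hom C' (omap F M) N)" if "M \<in> S0" for M
      using U(3) N F_Obj[OF M[OF that]] unfolding locally_small_def by blast
  qed
  obtain X \<iota> where X: "is_coproduct C ?I fst X \<iota>"
    using small_coproduct_ex[OF U(2) I, of fst] M by force
  obtain x where x: "x \<in> Hom C' (omap F X) N" "\<forall>i \<in> ?I. x \<cdot>\<^bsub>C'\<^esub> amap F (\<iota> i) = snd i"
    using coproduct_map_ex[OF respects_coproducts_small[OF U(4) I X] N, of snd] by auto
  have "\<exists>f \<in> Hom C M X. x \<cdot>\<^bsub>C'\<^esub> amap F f = z"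
    if "M \<in> S0" "z \<in> Hom C' (omap F M) N" for M z
    using x(2) coproductD(3)[OF X, of "(M, z)"] that by (intro bexI[of _ "\<iota> (M, z)"]) simp_all
  then show ?thesis using coproductD(1)[OF X] x(1) by blast
qed

text \<open>\<open>X'\<close> is the cone of the map to \<open>X\<close> from the coproduct over all
  pairs \<open>(M, f)\<close> with \<open>f\<close> to be killed. Composing with \<open>x\<close>
  gives zero on each summand, so \<open>x\<close> extends to the cone, and every such
  \<open>f\<close> dies there because it factors through the coproduct.\<close>

lemma brown_step:
  assumes U: "universe TYPE('u)" "has_small_coproducts TYPE('u) C" "locally_small TYPE('u) C"
    "respects_coproducts TYPE('u) C C' F"
    and S0: "small TYPE('u) S0" "S0 \<subseteq> Obj C"
    and X: "X \<in> Obj C" and x: "x \<in> Hom C' (omap F X) N"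
  shows "\<exists>X' \<in> Obj C. \<exists>x' \<in> Hom C' (omap F X') N. \<exists>j \<in> Hom C X X'. x' \<cdot>\<^bsub>C'\<^esub> amap F j = x \<and>
    (\<forall>M \<in> S0. \<forall>f \<in> Hom C M X. x \<cdot>\<^bsub>C'\<^esub> amap F f = Zero C' (omap F M) N \<longrightarrow> j \<cdot> f = Zero C M X')"
proof -
  let ?K = "\<lambda>M. {f \<in> Hom C M X. x \<cdot>\<^bsub>C'\<^esub> amap F f = Zero C' (omap F M) N}"
  let ?I = "Sigma S0 ?K"
  have M: "M \<in> Obj C" if "M \<in> S0" for M using S0(2) that by blast
  have I: "small TYPE('u) ?I"
  proof (rule small_Sigma[OF U(1) S0(1)])
    fix M assume "M \<in> S0"
    then have "small TYPE('u) (Hom C M X)"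
      using U(3) X M unfolding locally_small_def by blast
    then show "small TYPE('u) (?K M)" by (rule small_subset) blast
  qed
  obtain P \<iota> where P: "is_coproduct C ?I fst P \<iota>"
    using small_coproduct_ex[OF U(2) I, of fst] M by force
  obtain k where k: "k \<in> Hom C P X" "\<forall>i \<in> ?I. k \<cdot> \<iota> i = snd i"
    using coproduct_map_ex[OF P X, of snd] by auto
  obtain X' j h where T: "triangle C P X X' k j h" using C.triangle_cone[OF k(1)] by blast
  note t = C.triangleD[OF T] and x' = C'.HomD[OF x]
  have "x \<cdot>\<^bsub>C'\<^esub> amap F k = Zero C' (omap F P) N"
  proof (rule C'.coproduct_map_eq[OF respects_coproducts_small[OF U(4) I P]])
    show "x \<cdot>\<^bsub>C'\<^esub> amap F k \<in> Hom C' (omap F P) N" "Zero C' (omap F P) N \<in> Hom C' (omap F P) N"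
      using x' t by (simp_all add: Hom_iff)
    fix i assume i: "i \<in> ?I"
    then obtain M f where Mf: "i = (M, f)" "M \<in> S0" "f \<in> Hom C M X"
      "x \<cdot>\<^bsub>C'\<^esub> amap F f = Zero C' (omap F M) N" by blast
    have \<iota>: "\<iota> i \<in> Arr C" "Dom C (\<iota> i) = M" "Cod C (\<iota> i) = P"
      using C.HomD[OF coproductD(3)[OF P i]] Mf(1) by simp_all
    have "amap F k \<cdot>\<^bsub>C'\<^esub> amap F (\<iota> i) = amap F f"
      using bspec[OF k(2) i] \<iota> t Mf(1) F_Comp[of "\<iota> i" k] by simp
    then show "x \<cdot>\<^bsub>C'\<^esub> amap F k \<cdot>\<^bsub>C'\<^esub> amap F (\<iota> i) = Zero C' (omap F P) N \<cdot>\<^bsub>C'\<^esub> amap F (\<iota> i)"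
      using Mf(4) \<iota> t x' by simp
  qed
  then obtain x1 where x1: "x1 \<in> Hom C' (omap F X') N" "x1 \<cdot>\<^bsub>C'\<^esub> amap F j = x"
    using F_contra_exact(1)[OF T x] by blast
  have "j \<cdot> f = Zero C M X'"
    if "M \<in> S0" "f \<in> Hom C M X" "x \<cdot>\<^bsub>C'\<^esub> amap F f = Zero C' (omap F M) N" for M f
  proof -
    have i: "(M, f) \<in> ?I" using that by simp
    note \<iota> = C.HomD[OF coproductD(3)[OF P i]]
    have "j \<cdot> (k \<cdot> \<iota> (M, f)) = Zero C P X' \<cdot> \<iota> (M, f)"
      by (rule C.Comp_reassoc[OF C.triangle_Comp_Zero[OF T]]) (use t \<iota> in simp_all)
    then show ?thesis using bspec[OF k(2) i] \<iota> t by simp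
  qed
  with t(3,16) x1 show ?thesis by blast
qed

text \<open>The cone of \<open>1 - shift\<close> on \<open>\<Coprod> X n\<close>; compact objects see it as the colimit of the
  \<open>X n\<close>.\<close>

lemma telescope:
  assumes U: "universe TYPE('u)" "has_small_coproducts TYPE('u) C" "respects_coproducts TYPE('u) C C' F"
    and X: "\<And>n. X n \<in> Obj C" and j: "\<And>n :: nat. j n \<in> Hom C (X n) (X (Suc n))"
  obtains L q where "L \<in> Obj C" "\<And>n. q n \<in> Hom C (X n) L" "\<And>n. q (Suc n) \<cdot> j n = q n"
    "\<And>x N. \<forall>n. x n \<in> Hom C' (omap F (X n)) N \<and> x (Suc n) \<cdot>\<^bsub>C'\<^esub> amap F (j n) = x n
      \<Longrightarrow> \<exists>y \<in> Hom C' (omap F L) N. \<forall>n. y \<cdot>\<^bsub>C'\<^esub> amap F (q n) = x n"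
    "\<And>M f. \<lbrakk>compact_object TYPE('u) C M; compact_object TYPE('u) C (shO C M); f \<in> Hom C (shO C M) L\<rbrakk>
      \<Longrightarrow> \<exists>n. \<exists>f' \<in> Hom C (shO C M) (X n). q n \<cdot> f' = f"
proof -
  obtain P \<iota> where P: "is_coproduct C (UNIV :: nat set) X P \<iota>"
    using small_coproduct_ex[OF U(2) small_nat[OF U(1)], of X] X by blast
  note c = coproductD[OF P]
  have \<iota>: "\<iota> n \<in> Arr C" "Dom C (\<iota> n) = X n" "Cod C (\<iota> n) = P" for n
    using C.HomD[OF c(3)[of n]] by simp_all
  have j': "j n \<in> Arr C" "Dom C (j n) = X n" "Cod C (j n) = X (Suc n)" for n
    using C.HomD[OF j] by simp_all
  have \<iota>j: "Add C (\<iota> n) (Neg C (\<iota> (Suc n) \<cdot> j n)) \<in> Hom C (X n) P" for n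
    using \<iota> j' by (simp add: Hom_iff)
  obtain \<phi> where \<phi>: "\<phi> \<in> Hom C P P" "\<And>n. \<phi> \<cdot> \<iota> n = Add C (\<iota> n) (Neg C (\<iota> (Suc n) \<cdot> j n))"
    using coproduct_map_ex[OF P c(1), of "\<lambda>n. Add C (\<iota> n) (Neg C (\<iota> (Suc n) \<cdot> j n))"] \<iota>j by blast
  obtain L r h where T: "triangle C P P L \<phi> r h" using C.triangle_cone[OF \<phi>(1)] by blast
  note t = C.triangleD[OF T]
  define q where "q n = r \<cdot> \<iota> n" for n
  have q: "q n \<in> Arr C" "Dom C (q n) = X n" "Cod C (q n) = L" for n
    using \<iota> t by (simp_all add: q_def)
  \<comment> \<open>Consecutive maps of a triangle compose to zero; on the summand \<open>n\<close>
    this reads as compatibility of \<open>q\<close> with \<open>j\<close>.\<close>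
  have qj: "q (Suc n) \<cdot> j n = q n" for n
  proof -
    have "r \<cdot> (\<phi> \<cdot> \<iota> n) = Zero C P L \<cdot> \<iota> n"
      by (rule C.Comp_reassoc[OF C.triangle_Comp_Zero[OF T]]) (use t \<iota> in simp_all)
    then have "Add C (q n) (Neg C (q (Suc n) \<cdot> j n)) = Zero C (X n) L"
      using \<iota> t j' \<phi>(2) by (simp add: q_def)
    then have "q n = q (Suc n) \<cdot> j n"
      using C.eq_if_diff_Zero[of "q n" "q (Suc n) \<cdot> j n"] q j' by simp
    then show ?thesis by simp
  qed
  have ext: "\<exists>y \<in> Hom C' (omap F L) N. \<forall>n. y \<cdot>\<^bsub>C'\<^esub> amap F (q n) = x n"
    if x: "\<And>n. x n \<in> Hom C' (omap F (X n)) N" and xj: "\<And>n. x (Suc n) \<cdot>\<^bsub>C'\<^esub> amap F (j n) = x n"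
    for x N
  proof -
    have N: "N \<in> Obj C'" using C'.HomD[OF x] by simp
    have FP: "is_coproduct C' UNIV (\<lambda>n. omap F (X n)) (omap F P) (\<lambda>n. amap F (\<iota> n))"
      by (rule respects_coproducts_small[OF U(3) small_nat[OF U(1)] P])
    obtain y where y: "y \<in> Hom C' (omap F P) N" "\<And>n. y \<cdot>\<^bsub>C'\<^esub> amap F (\<iota> n) = x n"
      using coproduct_map_ex[OF FP N, of x] x by blast
    note y' = C'.HomD[OF y(1)]
    have "y \<cdot>\<^bsub>C'\<^esub> amap F \<phi> = Zero C' (omap F P) N"
    proof (rule C'.coproduct_map_eq[OF FP])
      show "y \<cdot>\<^bsub>C'\<^esub> amap F \<phi> \<in> Hom C' (omap F P) N" "Zero C' (omap F P) N \<in> Hom C' (omap F P) N"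
        using y' t by (simp_all add: Hom_iff)
      fix n
      have "y \<cdot>\<^bsub>C'\<^esub> amap F \<phi> \<cdot>\<^bsub>C'\<^esub> amap F (\<iota> n) = y \<cdot>\<^bsub>C'\<^esub> amap F (\<phi> \<cdot> \<iota> n)"
        using y' t \<iota> by simp
      also have "\<dots> = Add C' (x n) (Neg C' (x (Suc n) \<cdot>\<^bsub>C'\<^esub> amap F (j n)))"
        unfolding \<phi>(2) using y' \<iota> j' y(2)[of n]
          C'.Comp_reassoc[OF y(2)[of "Suc n"], of "amap F (j n)"] by simp
      also have "\<dots> = Zero C' (omap F P) N \<cdot>\<^bsub>C'\<^esub> amap F (\<iota> n)"
        unfolding xj using C'.HomD[OF x[of n]] N \<iota> t by simp
      finally show "y \<cdot>\<^bsub>C'\<^esub> amap F \<phi> \<cdot>\<^bsub>C'\<^esub> amap F (\<iota> n) =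
          Zero C' (omap F P) N \<cdot>\<^bsub>C'\<^esub> amap F (\<iota> n)" .
    qed
    then obtain z where z: "z \<in> Hom C' (omap F L) N" "y = z \<cdot>\<^bsub>C'\<^esub> amap F r"
      using F_contra_exact(1)[OF T y(1)] by blast
    note z' = C'.HomD[OF z(1)]
    have "z \<cdot>\<^bsub>C'\<^esub> amap F (q n) = x n" for n
      using y(2)[of n] z' t \<iota> unfolding z(2) by (simp add: q_def)
    then show ?thesis using z(1) by blast
  qed
  \<comment> \<open>The projections of the coproduct will turn the vanishing of
    \<open>\<phi> \<cdot> g\<close> into a recursion on components: \<open>p0\<close> and
    \<open>pS\<close> are the rows of 1 - shift.\<close>
  have "\<exists>p. \<forall>n. p n \<in> Hom C P (X n) \<and> p n \<cdot> \<iota> n = Ide C (X n) \<and>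
      (\<forall>m. m \<noteq> n \<longrightarrow> p n \<cdot> \<iota> m = Zero C (X m) (X n))"
    using C.coproduct_projection[OF P] by (intro choice allI) auto
  then obtain p where p: "\<And>n. p n \<in> Hom C P (X n)" "\<And>n. p n \<cdot> \<iota> n = Ide C (X n)"
    "\<And>n m. m \<noteq> n \<Longrightarrow> p n \<cdot> \<iota> m = Zero C (X m) (X n)" by blast
  have p': "p n \<in> Arr C" "Dom C (p n) = P" "Cod C (p n) = X n" for n
    using C.HomD[OF p(1)] by simp_all
  have p\<phi>\<iota>: "(p n \<cdot> \<phi>) \<cdot> \<iota> m = Add C (p n \<cdot> \<iota> m) (Neg C (p n \<cdot> (\<iota> (Suc m) \<cdot> j m)))" for n m
    using \<phi>(2)[of m] t \<iota> j' p' by simp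
  have p\<iota>j: "p n \<cdot> (\<iota> m \<cdot> e) = Zero C (Dom C e) (X n)"
    if "m \<noteq> n" "e \<in> Arr C" "Cod C e = X m" for n m e
    using C.Comp_reassoc[OF p(3)[OF that(1)], of e] that p' \<iota> X by simp
  have p0: "p 0 \<cdot> \<phi> = p 0"
  proof (rule C.coproduct_map_eq[OF P])
    show "p 0 \<cdot> \<phi> \<in> Hom C P (X 0)" "p 0 \<in> Hom C P (X 0)" using p' t by (simp_all add: Hom_iff)
    fix m show "(p 0 \<cdot> \<phi>) \<cdot> \<iota> m = p 0 \<cdot> \<iota> m"
      unfolding p\<phi>\<iota> using p\<iota>j[of "Suc m" 0 "j m"] p' \<iota> j' X by simp
  qed
  have pS: "p (Suc n) \<cdot> \<phi> = Add C (p (Suc n)) (Neg C (j n \<cdot> p n))" for n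
  proof (rule C.coproduct_map_eq[OF P])
    show "p (Suc n) \<cdot> \<phi> \<in> Hom C P (X (Suc n))"
      "Add C (p (Suc n)) (Neg C (j n \<cdot> p n)) \<in> Hom C P (X (Suc n))"
      using p' t j' by (simp_all add: Hom_iff)
    fix m
    have "p (Suc n) \<cdot> (\<iota> (Suc m) \<cdot> j m) = j n \<cdot> (p n \<cdot> \<iota> m)"
    proof (cases "m = n")
      case True
      then show ?thesis
        using C.Comp_reassoc[OF p(2)[of "Suc n"], of "j n"] p(2)[of n] p' \<iota> j' X by simp
    next
      case False
      then show ?thesis using p\<iota>j[of "Suc m" "Suc n" "j m"] p(3)[of m n] p' \<iota> j' X by simp
    qed
    then show "(p (Suc n) \<cdot> \<phi>) \<cdot> \<iota> m = Add C (p (Suc n)) (Neg C (j n \<cdot> p n)) \<cdot> \<iota> m"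
      unfolding p\<phi>\<iota> using p' \<iota> j' by simp
  qed
  \<comment> \<open>The obstruction to lifting \<open>f\<close> along \<open>r\<close> is
    \<open>h \<cdot> f\<close>, a morphism to the shifted coproduct. Desuspended it becomes
    \<open>g\<close> from \<open>M\<close>, killed by \<open>\<phi>\<close>; by induction its
    components vanish, and compactness of \<open>M\<close> makes \<open>g\<close> itself
    vanish.\<close>
  have lift: "\<exists>n. \<exists>f' \<in> Hom C (shO C M) (X n). q n \<cdot> f' = f"
    if M: "compact_object TYPE('u) C M" "compact_object TYPE('u) C (shO C M)"
      and f: "f \<in> Hom C (shO C M) L" for M f
  proof -
    have Ob: "M \<in> Obj C" using M(1) by (simp add: compact_object_def)
    note f' = C.HomD[OF f]
    have hf: "h \<cdot> f \<in> Hom C (shO C M) (shO C P)" using f' t by (simp add: Hom_iff)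
    obtain g where g: "g \<in> Hom C M P" "h \<cdot> f = shA C g" using C.shA_surj[OF hf Ob c(1)] by blast
    note g' = C.HomD[OF g(1)]
    have "shA C \<phi> \<cdot> (h \<cdot> f) = Zero C (shO C M) (shO C P)"
      using C.cov_exact'(2)[OF T hf] f by blast
    then have "shA C (\<phi> \<cdot> g) = Zero C (shO C M) (shO C P)" using g g' t by simp
    then have \<phi>g: "\<phi> \<cdot> g = Zero C M P"
      by (rule C.shA_eq_Zero[rotated]) (use g' t in \<open>simp add: Hom_iff\<close>)
    have pg: "p n \<cdot> g = Zero C M (X n)" for n
    proof (induction n)
      case 0
      have "p 0 \<cdot> (\<phi> \<cdot> g) = p 0 \<cdot> g"
        by (rule C.Comp_reassoc[OF p0]) (use p' t g' in simp_all)
      then show ?case unfolding \<phi>g using p'(1)[of 0] p'(2)[of 0] p'(3)[of 0] Ob by simp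
    next
      case (Suc n)
      have "p (Suc n) \<cdot> (\<phi> \<cdot> g) = Add C (p (Suc n)) (Neg C (j n \<cdot> p n)) \<cdot> g"
        by (rule C.Comp_reassoc[OF pS]) (use p' t g' in simp_all)
      then show ?case unfolding \<phi>g using p' Ob Suc j' g' X by simp
    qed
    have "g = Zero C M P"
      by (rule C.compact_eq_Zero[OF M(1) small_nat[OF U(1)] P g(1), of p])
        (use p pg in simp_all)
    then have "h \<cdot> f = Zero C (shO C M) (shO C P)" using g Ob c(1) by simp
    then obtain k where k: "k \<in> Hom C (shO C M) P" "f = r \<cdot> k"
      using C.cov_exact'(1)[OF T f] by blast
    \<comment> \<open>The finitely many components of \<open>k\<close> live at different stages;
      pushing them along \<open>j\<close> to a common stage allows them to be added.\<close>
    have up: "\<exists>e \<in> Hom C (shO C M) (X m). q m \<cdot> e = q n \<cdot> d"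
      if "n \<le> m" "d \<in> Hom C (shO C M) (X n)" for n m d
      using that
    proof (induction m rule: dec_induct)
      case (step m)
      then obtain e where e: "e \<in> Hom C (shO C M) (X m)" "q m \<cdot> e = q n \<cdot> d" by blast
      note e' = C.HomD[OF e(1)]
      have "q (Suc m) \<cdot> (j m \<cdot> e) = q m \<cdot> e"
        by (rule C.Comp_reassoc[OF qj]) (use e' j' q in simp_all)
      moreover have "j m \<cdot> e \<in> Hom C (shO C M) (X (Suc m))" using e' j' by (simp add: Hom_iff)
      ultimately show ?case using e(2) by metis
    qed blast
    have "\<exists>n. \<exists>d \<in> Hom C (shO C M) (X n). q n \<cdot> d = r \<cdot> k"
    proof (rule C.compact_induct[OF M(2) small_nat[OF U(1)] P k(1)])
      show "\<exists>n. \<exists>d \<in> Hom C (shO C M) (X n). q n \<cdot> d = r \<cdot> Zero C (shO C M) P"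
        by (rule exI[of _ 0], rule bexI[of _ "Zero C (shO C M) (X 0)"])
          (use q t Ob X in \<open>simp_all add: Hom_iff\<close>)
    next
      fix a b assume a: "a \<in> Hom C (shO C M) P" and b: "b \<in> Hom C (shO C M) P"
        and "\<exists>n. \<exists>d \<in> Hom C (shO C M) (X n). q n \<cdot> d = r \<cdot> a"
        and "\<exists>n. \<exists>d \<in> Hom C (shO C M) (X n). q n \<cdot> d = r \<cdot> b"
      then obtain n m da db where da: "da \<in> Hom C (shO C M) (X n)" "q n \<cdot> da = r \<cdot> a"
        and db: "db \<in> Hom C (shO C M) (X m)" "q m \<cdot> db = r \<cdot> b" by blast
      obtain ea where ea: "ea \<in> Hom C (shO C M) (X (max n m))" "q (max n m) \<cdot> ea = r \<cdot> a"
        using up[of n "max n m" da] da by auto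
      obtain eb where eb: "eb \<in> Hom C (shO C M) (X (max n m))" "q (max n m) \<cdot> eb = r \<cdot> b"
        using up[of m "max n m" db] db by auto
      note e' = C.HomD[OF ea(1)] C.HomD[OF eb(1)] C.HomD[OF a] C.HomD[OF b]
      have "q (max n m) \<cdot> Add C ea eb = r \<cdot> Add C a b" using e' q t ea(2) eb(2) by simp
      moreover have "Add C ea eb \<in> Hom C (shO C M) (X (max n m))" using e' by (simp add: Hom_iff)
      ultimately show "\<exists>n. \<exists>d \<in> Hom C (shO C M) (X n). q n \<cdot> d = r \<cdot> Add C a b" by blast
    next
      fix i d assume d: "d \<in> Hom C (shO C M) (X i)"
      then have "q i \<cdot> d = r \<cdot> (\<iota> i \<cdot> d)" using C.HomD[OF d] \<iota> t by (simp add: q_def)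
      then show "\<exists>n. \<exists>da \<in> Hom C (shO C M) (X n). q n \<cdot> da = r \<cdot> (\<iota> i \<cdot> d)" using d by blast
    qed
    then show ?thesis unfolding k(2) .
  qed
  show ?thesis
    by (rule that[of L q]) (use t q qj ext lift in \<open>simp_all add: Hom_iff\<close>)
qed

text \<open>Precomposition with an isomorphism, and with its image under \<open>F\<close>, are
  bijections that intertwine the maps at \<open>V\<close> and \<open>W\<close>.\<close>

lemma universal_map_isomorphic:
  assumes e: "e \<in> Hom C' (omap F X) N" and X: "X \<in> Obj C" and "isomorphic C V W"
    and bij: "bij_betw (\<lambda>g. e \<cdot>\<^bsub>C'\<^esub> amap F g) (Hom C V X) (Hom C' (omap F V) N)"
  shows "bij_betw (\<lambda>g. e \<cdot>\<^bsub>C'\<^esub> amap F g) (Hom C W X) (Hom C' (omap F W) N)"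
proof -
  obtain a b where ab: "a \<in> Hom C V W" "b \<in> Hom C W V" "b \<cdot> a = Ide C V" "a \<cdot> b = Ide C W"
    using assms(3) by (rule C.isomorphicE)
  note a = C.HomD[OF ab(1)] and b = C.HomD[OF ab(2)] and e' = C'.HomD[OF e]
  have "amap F a \<in> Iso C' (omap F V) (omap F W)"
  proof (rule C'.IsoI[OF F_Hom[OF ab(1)] F_Hom[OF ab(2)]])
    show "amap F b \<cdot>\<^bsub>C'\<^esub> amap F a = Ide C' (omap F V)"
      using F_Comp[of a b] ab(3) a b by simp
    show "amap F a \<cdot>\<^bsub>C'\<^esub> amap F b = Ide C' (omap F W)"
      using F_Comp[of b a] ab(4) a b by simp
  qed
  then have Fa: "bij_betw (\<lambda>y. y \<cdot>\<^bsub>C'\<^esub> amap F a) (Hom C' (omap F W) N) (Hom C' (omap F V) N)"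
    using C'.bij_betw_Iso_Comp e' by blast
  have "a \<in> Iso C V W" by (rule C.IsoI[OF ab])
  then have "bij_betw (\<lambda>g. g \<cdot> a) (Hom C W X) (Hom C V X)"
    using C.bij_betw_Iso_Comp X by blast
  from bij_betw_trans[OF this bij]
  have "bij_betw ((\<lambda>g. e \<cdot>\<^bsub>C'\<^esub> amap F g) \<circ> (\<lambda>g. g \<cdot> a)) (Hom C W X) (Hom C' (omap F V) N)" .
  moreover have "((\<lambda>g. e \<cdot>\<^bsub>C'\<^esub> amap F g) \<circ> (\<lambda>g. g \<cdot> a)) g =
      ((\<lambda>y. y \<cdot>\<^bsub>C'\<^esub> amap F a) \<circ> (\<lambda>g. e \<cdot>\<^bsub>C'\<^esub> amap F g)) g" if "g \<in> Hom C W X" for g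
    using C.HomD[OF that] a e' by simp
  ultimately have "bij_betw ((\<lambda>y. y \<cdot>\<^bsub>C'\<^esub> amap F a) \<circ> (\<lambda>g. e \<cdot>\<^bsub>C'\<^esub> amap F g)) (Hom C W X)
      (Hom C' (omap F V) N)"
    using bij_betw_cong by blast
  moreover have "(\<lambda>g. e \<cdot>\<^bsub>C'\<^esub> amap F g) ` Hom C W X \<subseteq> Hom C' (omap F W) N"
  proof (rule image_subsetI)
    fix g assume "g \<in> Hom C W X"
    from C.HomD[OF this] show "e \<cdot>\<^bsub>C'\<^esub> amap F g \<in> Hom C' (omap F W) N"
      using e' by (simp add: Hom_iff)
  qed
  ultimately show ?thesis using bij_betw_comp_iff2[OF Fa] by blast
qed

text \<open>On both sides a morphism out of the coproduct is a family of morphisms out of the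
  summands, as \<open>F\<close> preserves the coproduct; bijectivity is checked
  componentwise.\<close>

lemma universal_map_coproduct:
  assumes e: "e \<in> Hom C' (omap F X) N" and X: "X \<in> Obj C"
    and P: "is_coproduct C I Y P \<iota>"
    and FP: "is_coproduct C' I (\<lambda>i. omap F (Y i)) (omap F P) (\<lambda>i. amap F (\<iota> i))"
    and bij: "\<And>i. i \<in> I \<Longrightarrow>
      bij_betw (\<lambda>g. e \<cdot>\<^bsub>C'\<^esub> amap F g) (Hom C (Y i) X) (Hom C' (omap F (Y i)) N)"
  shows "bij_betw (\<lambda>g. e \<cdot>\<^bsub>C'\<^esub> amap F g) (Hom C P X) (Hom C' (omap F P) N)"
proof -
  note e' = C'.HomD[OF e] and c = coproductD[OF P]
  have in_Hom: "e \<cdot>\<^bsub>C'\<^esub> amap F g \<in> Hom C' (omap F P) N" if "g \<in> Hom C P X" for g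
    using C.HomD[OF that] e' by (simp add: Hom_iff)
  have "inj_on (\<lambda>g. e \<cdot>\<^bsub>C'\<^esub> amap F g) (Hom C P X)"
  proof (rule inj_onI)
    fix g h
    assume g: "g \<in> Hom C P X" and h: "h \<in> Hom C P X"
      and eq: "e \<cdot>\<^bsub>C'\<^esub> amap F g = e \<cdot>\<^bsub>C'\<^esub> amap F h"
    show "g = h"
    proof (rule C.coproduct_map_eq[OF P g h])
      fix i assume i: "i \<in> I"
      note g' = C.HomD[OF g] and h' = C.HomD[OF h] and \<iota> = C.HomD[OF c(3)[OF i]]
      show "g \<cdot> \<iota> i = h \<cdot> \<iota> i"
      proof (rule inj_onD[OF bij_betw_imp_inj_on[OF bij[OF i]]])
        show "g \<cdot> \<iota> i \<in> Hom C (Y i) X" "h \<cdot> \<iota> i \<in> Hom C (Y i) X"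
          using g' h' \<iota> by (simp_all add: Hom_iff)
        show "e \<cdot>\<^bsub>C'\<^esub> amap F (g \<cdot> \<iota> i) = e \<cdot>\<^bsub>C'\<^esub> amap F (h \<cdot> \<iota> i)"
          using C'.Comp_reassoc[OF eq, of "amap F (\<iota> i)"] g' h' \<iota> e' by simp
      qed
    qed
  qed
  moreover have "z \<in> (\<lambda>g. e \<cdot>\<^bsub>C'\<^esub> amap F g) ` Hom C P X" if z: "z \<in> Hom C' (omap F P) N" for z
  proof -
    note z' = C'.HomD[OF z]
    have "\<forall>i \<in> I. \<exists>k. k \<in> Hom C (Y i) X \<and> e \<cdot>\<^bsub>C'\<^esub> amap F k = z \<cdot>\<^bsub>C'\<^esub> amap F (\<iota> i)"
    proof
      fix i assume i: "i \<in> I"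
      have "z \<cdot>\<^bsub>C'\<^esub> amap F (\<iota> i) \<in> Hom C' (omap F (Y i)) N"
        using z' C.HomD[OF c(3)[OF i]] by (simp add: Hom_iff)
      then have "z \<cdot>\<^bsub>C'\<^esub> amap F (\<iota> i) \<in> (\<lambda>g. e \<cdot>\<^bsub>C'\<^esub> amap F g) ` Hom C (Y i) X"
        using bij_betw_imp_surj_on[OF bij[OF i]] by simp
      then obtain k where "k \<in> Hom C (Y i) X" "z \<cdot>\<^bsub>C'\<^esub> amap F (\<iota> i) = e \<cdot>\<^bsub>C'\<^esub> amap F k"
        by blast
      then show "\<exists>k. k \<in> Hom C (Y i) X \<and> e \<cdot>\<^bsub>C'\<^esub> amap F k = z \<cdot>\<^bsub>C'\<^esub> amap F (\<iota> i)"
        by (intro exI[of _ k]) simp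
    qed
    then obtain k where k: "\<forall>i \<in> I. k i \<in> Hom C (Y i) X \<and> e \<cdot>\<^bsub>C'\<^esub> amap F (k i) = z \<cdot>\<^bsub>C'\<^esub> amap F (\<iota> i)"
      by (elim bchoice[THEN exE])
    obtain g where g: "g \<in> Hom C P X" "\<forall>i \<in> I. g \<cdot> \<iota> i = k i"
      using coproduct_map_ex[OF P X, of k] k by blast
    note g' = C.HomD[OF g(1)]
    have "e \<cdot>\<^bsub>C'\<^esub> amap F g = z"
    proof (rule C'.coproduct_map_eq[OF FP in_Hom[OF g(1)] z])
      fix i assume i: "i \<in> I"
      have "e \<cdot>\<^bsub>C'\<^esub> amap F g \<cdot>\<^bsub>C'\<^esub> amap F (\<iota> i) = e \<cdot>\<^bsub>C'\<^esub> amap F (g \<cdot> \<iota> i)"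
        using e' g' C.HomD[OF c(3)[OF i]] by simp
      then show "e \<cdot>\<^bsub>C'\<^esub> amap F g \<cdot>\<^bsub>C'\<^esub> amap F (\<iota> i) = z \<cdot>\<^bsub>C'\<^esub> amap F (\<iota> i)"
        using bspec[OF g(2) i] bspec[OF k i] by simp
    qed
    then show ?thesis using g(1) by blast
  qed
  ultimately show ?thesis unfolding bij_betw_def using in_Hom by blast
qed

text \<open>Surjectivity comes from the cover at stage 0. For injectivity, a morphism to
  \<open>L\<close> that becomes zero lifts to a stage \<open>n\<close> and is killed by the next
  transition map. The compactness hypothesis concerns pairs \<open>M\<close>, \<open>shO C M\<close>
  because that is what lifting through the telescope consumes.\<close>

lemma brown_compact:
  assumes U: "universe TYPE('u)" "locally_small TYPE('u) C" "has_small_coproducts TYPE('u) C"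
    "locally_small TYPE('u) C'" "respects_coproducts TYPE('u) C C' F"
    and S0: "small TYPE('u) S0" "S0 \<subseteq> Obj C" and N: "N \<in> Obj C'"
    and S0_compact: "\<And>M. \<lbrakk>M \<in> Obj C; shO C M \<in> S0\<rbrakk>
      \<Longrightarrow> compact_object TYPE('u) C M \<and> compact_object TYPE('u) C (shO C M)"
  obtains L e where "L \<in> Obj C" "e \<in> Hom C' (omap F L) N"
    "\<And>M. M \<in> S0 \<Longrightarrow> bij_betw (\<lambda>g. e \<cdot>\<^bsub>C'\<^esub> amap F g) (Hom C M L) (Hom C' (omap F M) N)"
proof -
  obtain X0 x0 where X0: "X0 \<in> Obj C" "x0 \<in> Hom C' (omap F X0) N"
    and cover: "\<And>M z. \<lbrakk>M \<in> S0; z \<in> Hom C' (omap F M) N\<rbrakk> \<Longrightarrow> \<exists>f \<in> Hom C M X0. x0 \<cdot>\<^bsub>C'\<^esub> amap F f = z"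
    using brown_cover[OF U(1,3,4,5) S0 N] by blast
  define ok where "ok s \<longleftrightarrow> fst s \<in> Obj C \<and> snd s \<in> Hom C' (omap F (fst s)) N" for s
  define step where "step s s' j \<longleftrightarrow> j \<in> Hom C (fst s) (fst s') \<and> snd s' \<cdot>\<^bsub>C'\<^esub> amap F j = snd s \<and>
      (\<forall>M \<in> S0. \<forall>f \<in> Hom C M (fst s). snd s \<cdot>\<^bsub>C'\<^esub> amap F f = Zero C' (omap F M) N \<longrightarrow>
        j \<cdot> f = Zero C M (fst s'))" for s s' j
  \<comment> \<open>States are pairs of an object and its map to \<open>N\<close>. The clause for
    \<open>n = 0\<close> pins the sequence to the covering pair, as dependent choice by itself would
    only give some admissible start.\<close>
  have "\<exists>s. \<forall>n. (ok (s n) \<and> (n = 0 \<longrightarrow> s n = (X0, x0))) \<and> (\<exists>j. step (s n) (s (Suc n)) j)"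
  proof (rule dependent_nat_choice)
    show "\<exists>s. ok s \<and> ((0 :: nat) = 0 \<longrightarrow> s = (X0, x0))" using X0 by (simp add: ok_def)
    fix s and n :: nat assume "ok s \<and> (n = 0 \<longrightarrow> s = (X0, x0))"
    then have s: "fst s \<in> Obj C" "snd s \<in> Hom C' (omap F (fst s)) N" by (simp_all add: ok_def)
    obtain X' x' j where "X' \<in> Obj C" "x' \<in> Hom C' (omap F X') N" "step s (X', x') j"
      using brown_step[OF U(1,3,2,5) S0 s] unfolding step_def fst_conv snd_conv by blast
    then show "\<exists>s'. (ok s' \<and> (Suc n = 0 \<longrightarrow> s' = (X0, x0))) \<and> (\<exists>j. step s s' j)"
      by (intro exI[of _ "(X', x')"]) (auto simp: ok_def)
  qed
  then obtain s where s: "\<And>n. ok (s n)" "s 0 = (X0, x0)" "\<forall>n. \<exists>j. step (s n) (s (Suc n)) j"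
    by blast
  obtain j where j: "\<And>n. step (s n) (s (Suc n)) (j n)" using choice[OF s(3)] by blast
  define X x where "X n = fst (s n)" and "x n = snd (s n)" for n
  have X: "X n \<in> Obj C" and x: "x n \<in> Hom C' (omap F (X n)) N" for n
    using s(1)[of n] by (simp_all add: X_def x_def ok_def)
  have X00: "X 0 = X0" "x 0 = x0" using s(2) by (simp_all add: X_def x_def)
  have jH: "j n \<in> Hom C (X n) (X (Suc n))" and xj: "x (Suc n) \<cdot>\<^bsub>C'\<^esub> amap F (j n) = x n"
    and kill: "\<lbrakk>M \<in> S0; f \<in> Hom C M (X n); x n \<cdot>\<^bsub>C'\<^esub> amap F f = Zero C' (omap F M) N\<rbrakk>
      \<Longrightarrow> j n \<cdot> f = Zero C M (X (Suc n))" for n M f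
    using j[of n] by (simp_all add: X_def x_def step_def)
  obtain L q where L: "L \<in> Obj C" and q: "\<And>n. q n \<in> Hom C (X n) L" and qj: "\<And>n. q (Suc n) \<cdot> j n = q n"
    and ext: "\<And>x N. \<forall>n. x n \<in> Hom C' (omap F (X n)) N \<and> x (Suc n) \<cdot>\<^bsub>C'\<^esub> amap F (j n) = x n
      \<Longrightarrow> \<exists>y \<in> Hom C' (omap F L) N. \<forall>n. y \<cdot>\<^bsub>C'\<^esub> amap F (q n) = x n"
    and lift: "\<And>M f. \<lbrakk>compact_object TYPE('u) C M; compact_object TYPE('u) C (shO C M); f \<in> Hom C (shO C M) L\<rbrakk>
      \<Longrightarrow> \<exists>n. \<exists>f' \<in> Hom C (shO C M) (X n). q n \<cdot> f' = f"
    by (rule telescope[where X = X and j = j, OF U(1,3,5) X jH]) (rule that)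
  obtain e where e: "e \<in> Hom C' (omap F L) N" "\<And>n. e \<cdot>\<^bsub>C'\<^esub> amap F (q n) = x n"
    using ext[of x N] x xj by blast
  note e' = C'.HomD[OF e(1)]
  have q': "q n \<in> Arr C" "Dom C (q n) = X n" "Cod C (q n) = L" for n
    using C.HomD[OF q[of n]] by simp_all
  have eq: "e \<cdot>\<^bsub>C'\<^esub> amap F (q n \<cdot> f) = x n \<cdot>\<^bsub>C'\<^esub> amap F f" if "f \<in> Hom C M (X n)" for n M f
    using C'.Comp_reassoc[OF e(2)[of n], of "amap F f"] C.HomD[OF that] q'[of n] e' by simp
  have "bij_betw (\<lambda>g. e \<cdot>\<^bsub>C'\<^esub> amap F g) (Hom C M L) (Hom C' (omap F M) N)" if M: "M \<in> S0" for M
  proof -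
    have Ob: "M \<in> Obj C" using M S0(2) by blast
    obtain M' where M': "M' \<in> Obj C" "M = shO C M'" using C.shO_surj[OF Ob] by blast
    have "inj_on (\<lambda>g. e \<cdot>\<^bsub>C'\<^esub> amap F g) (carrier (hom_group C M L))"
    proof (rule abelian_group_hom_inj_on[OF universal_map_hom[OF e(1) L Ob]])
      fix f assume "f \<in> carrier (hom_group C M L)"
        and "e \<cdot>\<^bsub>C'\<^esub> amap F f = \<zero>\<^bsub>hom_group C' (omap F M) N\<^esub>"
      then have f: "f \<in> Hom C M L" "e \<cdot>\<^bsub>C'\<^esub> amap F f = Zero C' (omap F M) N" by simp_all
      obtain n f' where f': "f' \<in> Hom C M (X n)" "q n \<cdot> f' = f"
        using lift[of M' f] S0_compact[OF M'(1)] f(1) M M'(2) by blast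
      have "x n \<cdot>\<^bsub>C'\<^esub> amap F f' = Zero C' (omap F M) N" using eq[OF f'(1)] f'(2) f(2) by simp
      then have jf: "j n \<cdot> f' = Zero C M (X (Suc n))" using kill[OF M f'(1)] by blast
      have "q (Suc n) \<cdot> (j n \<cdot> f') = q n \<cdot> f'"
        by (rule C.Comp_reassoc[OF qj]) (use C.HomD[OF f'(1)] C.HomD[OF jH[of n]] q' in simp_all)
      then have "f = Zero C M L" unfolding jf f'(2) using q'[of "Suc n"] Ob by simp
      then show "f = \<zero>\<^bsub>hom_group C M L\<^esub>" by simp
    qed
    moreover have "z \<in> (\<lambda>g. e \<cdot>\<^bsub>C'\<^esub> amap F g) ` Hom C M L" if z: "z \<in> Hom C' (omap F M) N" for z
    proof -
      obtain f where f: "f \<in> Hom C M (X 0)" "x 0 \<cdot>\<^bsub>C'\<^esub> amap F f = z"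
        using cover[OF M z] X00 by auto
      have "q 0 \<cdot> f \<in> Hom C M L" using C.HomD[OF f(1)] q' by (simp add: Hom_iff)
      then show ?thesis using eq[OF f(1)] f(2) by (intro image_eqI[of _ _ "q 0 \<cdot> f"]) simp_all
    qed
    moreover have "e \<cdot>\<^bsub>C'\<^esub> amap F g \<in> Hom C' (omap F M) N" if "g \<in> Hom C M L" for g
      using C.HomD[OF that] e' by (simp add: Hom_iff)
    ultimately show ?thesis unfolding bij_betw_def by auto
  qed
  then show ?thesis using that L e(1) by blast
qed

theorem brown_representability:
  assumes U: "universe TYPE('u)" "locally_small TYPE('u) C" "has_small_coproducts TYPE('u) C"
    "locally_small TYPE('u) C'" "respects_coproducts TYPE('u) C C' F"
    and \<T>: "triangulated_subcategory C \<T>" "essentially_small TYPE('u) C \<T>"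
      "\<And>M. M \<in> \<T> \<Longrightarrow> compact_object TYPE('u) C M"
    and generated: "Obj C = coproduct_closure TYPE('u) C \<T>"
    and N: "N \<in> Obj C'"
  shows "\<exists>L e. universal_arrow C C' F N L e"
proof -
  have \<T>_Obj: "M \<in> Obj C" if "M \<in> \<T>" for M using \<T>(3)[OF that] by (simp add: compact_object_def)
  have \<T>_shift: "X \<in> \<T> \<longleftrightarrow> shO C X \<in> \<T>" if "X \<in> Obj C" for X
    using \<T>(1) that unfolding triangulated_subcategory_def by blast
  have \<T>_ne: "\<T> \<noteq> {}" using \<T>(1) unfolding triangulated_subcategory_def by blast
  \<comment> \<open>\<open>\<T>\<close> need not be small as a set, so the coproducts run over
    representatives \<open>S0\<close> of its isomorphism classes; \<open>B_iso\<close> carries the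
    result over to \<open>\<T>\<close>.\<close>
  obtain S0 where S0: "S0 \<subseteq> \<T>" "small TYPE('u) S0" "\<And>X. X \<in> \<T> \<Longrightarrow> \<exists>Y \<in> S0. isomorphic C X Y"
    using \<T>(2) unfolding essentially_small_def by blast
  have S0_Obj: "S0 \<subseteq> Obj C" using S0(1) \<T>_Obj by blast
  have "compact_object TYPE('u) C M \<and> compact_object TYPE('u) C (shO C M)"
    if "M \<in> Obj C" "shO C M \<in> S0" for M
    using \<T>(3) \<T>_shift[OF that(1)] that(2) S0(1) by blast
  then obtain L e where L: "L \<in> Obj C" and e: "e \<in> Hom C' (omap F L) N"
    and bij: "\<And>M. M \<in> S0 \<Longrightarrow> bij_betw (\<lambda>g. e \<cdot>\<^bsub>C'\<^esub> amap F g) (Hom C M L) (Hom C' (omap F M) N)"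
    using brown_compact[OF U S0(2) S0_Obj N] by blast
  define B where "B W \<longleftrightarrow> bij_betw (\<lambda>g. e \<cdot>\<^bsub>C'\<^esub> amap F g) (Hom C W L) (Hom C' (omap F W) N)" for W
  have B_iso: "B W" if "B V" "isomorphic C V W" for V W
    using universal_map_isomorphic[OF e L that(2)] that(1) unfolding B_def .
  \<comment> \<open>Demanding all shifts makes the class stable under the shift and its inverse, and
    it provides the neighbouring terms for the five lemma when a cone is added.\<close>
  define \<L> where "\<L> = {W \<in> Obj C. \<forall>k. B (shift_by C k W)}"
  have \<T>_\<L>: "\<T> \<subseteq> \<L>"
  proof
    fix M assume M: "M \<in> \<T>"
    have "shift_by C k M \<in> \<T>" for k
    proof (rule C.shift_by_all[of "\<lambda>k. shift_by C k M \<in> \<T>"])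
      show "shift_by C 0 M \<in> \<T>" using M by simp
      show "shift_by C k M \<in> \<T> \<longleftrightarrow> shift_by C (k + 1) M \<in> \<T>" for k
        using \<T>_shift C.shift_by_step[OF \<T>_Obj[OF M]] by simp
    qed
    then have "B (shift_by C k M)" for k
      using S0(3) B_iso bij C.isomorphic_sym unfolding B_def by blast
    then show "M \<in> \<L>" using \<T>_Obj[OF M] by (simp add: \<L>_def)
  qed
  have "triangulated_subcategory C \<L>"
    unfolding triangulated_subcategory_def
  proof (intro conjI ballI allI impI)
    show "strictly_full C \<L>"
      unfolding strictly_full_def
    proof (intro conjI ballI impI)
      show "\<L> \<subseteq> Obj C" by (auto simp: \<L>_def)
      fix X Y assume "X \<in> \<L>" "Y \<in> Obj C" "isomorphic C X Y"
      then show "Y \<in> \<L>"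
        unfolding \<L>_def using B_iso C.isomorphic_shift by blast
    qed
    show "\<L> \<noteq> {}" using \<T>_ne \<T>_\<L> by blast
  next
    fix X assume X: "X \<in> Obj C"
    have "(\<forall>k. B (shift_by C (k + 1) X)) \<longleftrightarrow> (\<forall>k. B (shift_by C k X))"
      by (metis diff_add_cancel)
    then show "X \<in> \<L> \<longleftrightarrow> shO C X \<in> \<L>"
      using X by (simp add: \<L>_def C.shift_by_shO)
  next
    fix f g h assume D: "(f, g, h) \<in> Dist C \<and> Dom C f \<in> \<L> \<and> Cod C f \<in> \<L>"
    obtain X Y Z where T: "triangle C X Y Z f g h" using D C.Dist_iff_triangle by blast
    note t = C.triangleD[OF T]
    have XY: "X \<in> \<L>" "Y \<in> \<L>" using D t by simp_all
    have "B (shift_by C k Z)" for k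
    proof -
      obtain f' g' h' where "triangle C (shift_by C k X) (shift_by C k Y) (shift_by C k Z) f' g' h'"
        using C.triangle_shift[OF T] by blast
      then show ?thesis
        unfolding B_def
      proof (rule universal_cone_contra[OF _ e L])
        fix W assume "W \<in> {shift_by C k X, shift_by C k Y, shO C (shift_by C k X), shO C (shift_by C k Y)}"
        then have "W = shift_by C k X \<or> W = shift_by C k Y \<or> W = shift_by C (k + 1) X \<or>
            W = shift_by C (k + 1) Y"
          using C.shift_by_step(1) t by simp
        then show "bij_betw (\<lambda>g. e \<cdot>\<^bsub>C'\<^esub> amap F g) (Hom C W L) (Hom C' (omap F W) N)"
          using XY unfolding B_def[symmetric] \<L>_def by blast
      qed
    qed
    then show "Cod C g \<in> \<L>" using t by (simp add: \<L>_def)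
  qed
  moreover have "coproduct_closed TYPE('u) C \<L>"
    unfolding coproduct_closed_def
  proof (intro allI impI)
    fix I :: "'u set" and X P \<iota>
    assume *: "small TYPE('u) I \<and> (\<forall>i \<in> I. X i \<in> \<L>) \<and> is_coproduct C I X P \<iota>"
    then have P: "is_coproduct C I X P \<iota>" and X: "\<And>i. i \<in> I \<Longrightarrow> X i \<in> \<L>" by simp_all
    have "B (shift_by C k P)" for k
    proof -
      obtain \<kappa> where \<kappa>: "is_coproduct C I (\<lambda>i. shift_by C k (X i)) (shift_by C k P) \<kappa>"
        using C.coproduct_shift[OF P] by blast
      have "bij_betw (\<lambda>g. e \<cdot>\<^bsub>C'\<^esub> amap F g) (Hom C (shift_by C k (X i)) L)
          (Hom C' (omap F (shift_by C k (X i))) N)" if "i \<in> I" for i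
        using X[OF that] by (simp add: \<L>_def B_def)
      then show ?thesis
        unfolding B_def
        using universal_map_coproduct[OF e L \<kappa> respects_coproducts_small[OF U(5) _ \<kappa>]] * by blast
    qed
    then show "P \<in> \<L>" using coproductD(1)[OF P] by (simp add: \<L>_def)
  qed
  ultimately have "Obj C \<subseteq> \<L>" unfolding generated coproduct_closure_def using \<T>_\<L> by blast
  then have "B W" if "W \<in> Obj C" for W
    using that C.shift_by_0[of W] unfolding \<L>_def by (metis (no_types, lifting) mem_Collect_eq subsetD)
  then have "universal_arrow C C' F N L e"
    unfolding universal_arrow_def B_def using L N e by blast
  then show ?thesis by blast
qed

end

section \<open>Graded modules\<close>

lemma linear_mapsD:
  assumes "f \<in> linear_maps R M N"
  shows "x \<in> carrier M \<Longrightarrow> f x \<in> carrier N"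
    "\<lbrakk>x \<in> carrier M; y \<in> carrier M\<rbrakk> \<Longrightarrow> f (x \<oplus>\<^bsub>M\<^esub> y) = f x \<oplus>\<^bsub>N\<^esub> f y"
    "\<lbrakk>r \<in> carrier R; x \<in> carrier M\<rbrakk> \<Longrightarrow> f (r \<odot>\<^bsub>M\<^esub> x) = r \<odot>\<^bsub>N\<^esub> f x"
  using assms by (auto simp: linear_maps_def)

lemma linear_maps_zero:
  assumes "f \<in> linear_maps R M N" "module R M" "module R N"
  shows "f \<zero>\<^bsub>M\<^esub> = \<zero>\<^bsub>N\<^esub>"
proof -
  interpret M: module R M by fact
  interpret N: module R N by fact
  have "f \<zero>\<^bsub>M\<^esub> \<oplus>\<^bsub>N\<^esub> f \<zero>\<^bsub>M\<^esub> = f \<zero>\<^bsub>M\<^esub>"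
    using linear_mapsD(2)[OF assms(1) M.zero_closed M.zero_closed] by simp
  then show ?thesis using linear_mapsD(1)[OF assms(1) M.zero_closed] by simp
qed

lemma linear_maps_comp:
  assumes "f \<in> linear_maps R M N" "g \<in> linear_maps R N P"
  shows "(\<lambda>x. g (f x)) \<in> linear_maps R M P"
  using linear_mapsD[OF assms(1)] linear_mapsD[OF assms(2)] by (simp add: linear_maps_def)

lemma linear_maps_inv:
  assumes f: "f \<in> linear_maps R M N" and M: "module R M" and b: "bij_betw f (carrier M) (carrier N)"
  shows "inv_into (carrier M) f \<in> linear_maps R N M"
proof -
  interpret M: module R M by fact
  let ?g = "inv_into (carrier M) f"
  have g: "?g y \<in> carrier M" "f (?g y) = y" if "y \<in> carrier N" for y
    using b that by (auto simp: bij_betw_def inv_into_into f_inv_into_f)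
  have gI: "?g (f x) = x" if "x \<in> carrier M" for x
    using b that by (simp add: bij_betw_def inv_into_f_f)
  have "?g (x \<oplus>\<^bsub>N\<^esub> y) = ?g x \<oplus>\<^bsub>M\<^esub> ?g y" if "x \<in> carrier N" "y \<in> carrier N" for x y
    using gI[of "?g x \<oplus>\<^bsub>M\<^esub> ?g y"] linear_mapsD(2)[OF f, of "?g x" "?g y"] g that by simp
  moreover have "?g (r \<odot>\<^bsub>N\<^esub> x) = r \<odot>\<^bsub>M\<^esub> ?g x" if "r \<in> carrier R" "x \<in> carrier N" for r x
    using gI[of "r \<odot>\<^bsub>M\<^esub> ?g x"] linear_mapsD(3)[OF f, of r "?g x"] g that by simp
  ultimately show ?thesis using g by (simp add: linear_maps_def)
qed

text \<open>\<open>N\<close> is only required to be a raw structure here, so that the lemma covers transport along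
  a bijection as well as images of linear maps.\<close>

lemma module_image:
  assumes M: "module R M" and f: "f \<in> linear_maps R M N" and zero: "f \<zero>\<^bsub>M\<^esub> = \<zero>\<^bsub>N\<^esub>"
  shows "module R (N\<lparr>carrier := f ` carrier M\<rparr>)"
proof -
  interpret M: module R M by fact
  let ?N = "N\<lparr>carrier := f ` carrier M\<rparr>"
  note f' = linear_mapsD[OF f]
  show ?thesis
  proof (rule moduleI)
    show "cring R" by unfold_locales
    show "abelian_group ?N"
    proof (rule abelian_groupI)
      fix x assume "x \<in> carrier ?N"
      then obtain a where a: "a \<in> carrier M" "x = f a" by auto
      show "\<zero>\<^bsub>?N\<^esub> \<oplus>\<^bsub>?N\<^esub> x = x"
        using a f'(2)[of "\<zero>\<^bsub>M\<^esub>" a] zero by simp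
      show "\<exists>y \<in> carrier ?N.
          y \<oplus>\<^bsub>?N\<^esub> x = \<zero>\<^bsub>?N\<^esub>"
        using a f'(2)[of "\<ominus>\<^bsub>M\<^esub> a" a] zero
        by (intro bexI[of _ "f (\<ominus>\<^bsub>M\<^esub> a)"]) (simp_all add: M.l_neg)
      fix y assume "y \<in> carrier ?N"
      then obtain b where b: "b \<in> carrier M" "y = f b" by auto
      show "x \<oplus>\<^bsub>?N\<^esub> y \<in> carrier ?N"
        using a b by (simp flip: f'(2))
      show "x \<oplus>\<^bsub>?N\<^esub> y = y \<oplus>\<^bsub>?N\<^esub> x"
        using a b by (simp add: M.a_comm flip: f'(2))
      fix z assume "z \<in> carrier ?N"
      then obtain c where c: "c \<in> carrier M" "z = f c" by auto
      show "x \<oplus>\<^bsub>?N\<^esub> y \<oplus>\<^bsub>?N\<^esub> z =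
          x \<oplus>\<^bsub>?N\<^esub> (y \<oplus>\<^bsub>?N\<^esub> z)"
        using a b c by (simp add: M.a_assoc flip: f'(2))
    next
      show "\<zero>\<^bsub>?N\<^esub> \<in> carrier ?N"
        using zero[symmetric] by simp
    qed
  next
    fix x r assume "x \<in> carrier ?N" and r: "r \<in> carrier R"
    then obtain a where a: "a \<in> carrier M" "x = f a" by auto
    show "r \<odot>\<^bsub>?N\<^esub> x \<in> carrier ?N"
      using a r by (simp flip: f'(3))
    fix q assume q: "q \<in> carrier R"
    show "(r \<oplus>\<^bsub>R\<^esub> q) \<odot>\<^bsub>?N\<^esub> x =
        r \<odot>\<^bsub>?N\<^esub> x \<oplus>\<^bsub>?N\<^esub>
        q \<odot>\<^bsub>?N\<^esub> x"
      using a r q by (simp add: M.smult_l_distr flip: f'(2,3))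
    show "(r \<otimes>\<^bsub>R\<^esub> q) \<odot>\<^bsub>?N\<^esub> x =
        r \<odot>\<^bsub>?N\<^esub> (q \<odot>\<^bsub>?N\<^esub> x)"
      using a r q by (simp add: M.smult_assoc1 flip: f'(3))
  next
    fix r x y assume r: "r \<in> carrier R" and "x \<in> carrier ?N"
      "y \<in> carrier ?N"
    then obtain a b where a: "a \<in> carrier M" "x = f a" "b \<in> carrier M" "y = f b" by auto
    show "r \<odot>\<^bsub>?N\<^esub> (x \<oplus>\<^bsub>?N\<^esub> y) =
        r \<odot>\<^bsub>?N\<^esub> x \<oplus>\<^bsub>?N\<^esub>
        r \<odot>\<^bsub>?N\<^esub> y"
      using a r by (simp add: M.smult_r_distr flip: f'(2,3))
  next
    fix x assume "x \<in> carrier ?N"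
    then obtain a where a: "a \<in> carrier M" "x = f a" by auto
    then show "\<one>\<^bsub>R\<^esub> \<odot>\<^bsub>?N\<^esub> x = x"
      by (simp flip: f'(3))
  qed
qed

text \<open>Members of \<open>A\<close> are carried by \<open>'u\<close> whereas hom groups are
  carried by morphism types; a small module on another type has to be copied into \<open>'u\<close>
  before closure properties of \<open>A\<close> can speak about it.\<close>

lemma small_module_copy:
  fixes M :: "('r, 'a) module"
  assumes M: "module R M" and "small TYPE('u) (carrier M)"
  shows "\<exists>N :: ('r, 'u) module. module R N \<and> small TYPE('u) (carrier N) \<and>
    (\<exists>f \<in> linear_maps R M N. bij_betw f (carrier M) (carrier N))"
proof -
  interpret M: module R M by fact
  obtain e :: "'a \<Rightarrow> 'u" where e: "inj_on e (carrier M)" using small_inj[OF assms(2)] by blast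
  let ?i = "inv_into (carrier M) e"
  define N0 :: "('r, 'u) module" where "N0 = \<lparr>carrier = e ` carrier M, mult = undefined, one = undefined,
    zero = e \<zero>\<^bsub>M\<^esub>, add = \<lambda>x y. e (?i x \<oplus>\<^bsub>M\<^esub> ?i y), smult = \<lambda>r x. e (r \<odot>\<^bsub>M\<^esub> ?i x)\<rparr>"
  have lin: "e \<in> linear_maps R M N0"
    using e by (simp add: linear_maps_def N0_def inv_into_f_f)
  have N0_carrier: "carrier N0 = e ` carrier M" by (simp add: N0_def)
  have "module R N0"
    using module_image[OF M lin] unfolding N0_carrier[symmetric] by (simp add: N0_def)
  moreover have "small TYPE('u) (carrier N0)"
    unfolding N0_carrier by (rule small_image[OF assms(2)])
  moreover have "bij_betw e (carrier M) (carrier N0)"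
    using e by (simp add: bij_betw_def N0_carrier)
  ultimately show ?thesis using lin by blast
qed

lemma graded_isomorphic_iff:
  "graded_isomorphic R M N \<longleftrightarrow>
    (\<exists>f. \<forall>i. f i \<in> linear_maps R (M i) (N i) \<and> bij_betw (f i) (carrier (M i)) (carrier (N i)))"
  by (simp add: graded_isomorphic_def graded_maps_def graded_inj_def graded_surj_def bij_betw_def
    Bex_def all_conj_distrib)

lemma graded_isomorphic_trans:
  assumes "graded_isomorphic R L M" "graded_isomorphic R M N"
  shows "graded_isomorphic R L N"
proof -
  obtain f g where f: "\<And>i. f i \<in> linear_maps R (L i) (M i)" "\<And>i. bij_betw (f i) (carrier (L i)) (carrier (M i))"
    and g: "\<And>i. g i \<in> linear_maps R (M i) (N i)" "\<And>i. bij_betw (g i) (carrier (M i)) (carrier (N i))"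
    using assms unfolding graded_isomorphic_iff by blast
  have "(\<lambda>x. g i (f i x)) \<in> linear_maps R (L i) (N i)"
    "bij_betw (\<lambda>x. g i (f i x)) (carrier (L i)) (carrier (N i))" for i
    using linear_maps_comp[OF f(1) g(1)] bij_betw_trans[OF f(2) g(2), unfolded comp_def] .
  then show ?thesis unfolding graded_isomorphic_iff by (intro exI[of _ "\<lambda>i x. g i (f i x)"]) blast
qed

lemma graded_isomorphic_sym:
  assumes "graded_isomorphic R M N" "\<And>i. module R (M i)"
  shows "graded_isomorphic R N M"
proof -
  obtain f where f: "\<And>i. f i \<in> linear_maps R (M i) (N i)" "\<And>i. bij_betw (f i) (carrier (M i)) (carrier (N i))"
    using assms unfolding graded_isomorphic_iff by blast
  show ?thesis
    unfolding graded_isomorphic_iff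
    using linear_maps_inv[OF f(1) assms(2) f(2)] bij_betw_inv_into[OF f(2)]
    by (intro exI[of _ "\<lambda>i. inv_into (carrier (M i)) (f i)"]) blast
qed

lemma belongs_to_iso:
  "\<lbrakk>graded_isomorphic R S S'; belongs_to R S' A\<rbrakk> \<Longrightarrow> belongs_to R S A"
  unfolding belongs_to_def using graded_isomorphic_trans by blast

text \<open>Shift stability is stated for graded modules carried by \<open>'u\<close>; for one on
  another type the isomorphic copy is shifted and the isomorphism reindexed.\<close>

lemma belongs_to_shift:
  assumes A: "A \<subseteq> graded_modules R" and st: "shift_stable R A"
  shows "belongs_to R (\<lambda>i. S (i + 1)) A \<longleftrightarrow> belongs_to R S A"
proof
  assume "belongs_to R S A"
  then obtain B where B: "B \<in> A" "graded_isomorphic R S B" unfolding belongs_to_def by blast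
  have "(\<lambda>i. B (i + 1)) \<in> A" using st A B(1) unfolding shift_stable_def by blast
  moreover have "graded_isomorphic R (\<lambda>i. S (i + 1)) (\<lambda>i. B (i + 1))"
  proof -
    obtain f where "\<And>i. f i \<in> linear_maps R (S i) (B i) \<and> bij_betw (f i) (carrier (S i)) (carrier (B i))"
      using B(2) unfolding graded_isomorphic_iff by blast
    then show ?thesis unfolding graded_isomorphic_iff by (intro exI[of _ "\<lambda>i. f (i + 1)"]) simp
  qed
  ultimately show "belongs_to R (\<lambda>i. S (i + 1)) A" unfolding belongs_to_def by blast
next
  assume "belongs_to R (\<lambda>i. S (i + 1)) A"
  then obtain B f where B: "B \<in> A" and f: "\<And>i. f i \<in> linear_maps R (S (i + 1)) (B i)"
    "\<And>i. bij_betw (f i) (carrier (S (i + 1))) (carrier (B i))"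
    unfolding belongs_to_def graded_isomorphic_iff by blast
  let ?B = "\<lambda>i. B (i - 1)"
  have "?B \<in> graded_modules R" using A B unfolding graded_modules_def by auto
  then have "?B \<in> A" using st B unfolding shift_stable_def by simp
  moreover have "graded_isomorphic R S ?B"
    unfolding graded_isomorphic_iff using f[of "_ - 1"] by (intro exI[of _ "\<lambda>i. f (i - 1)"]) simp
  ultimately show "belongs_to R S A" unfolding belongs_to_def by blast
qed

text \<open>Conjugating by the bijections carries image and kernel along: being linear and
  injective, \<open>\<phi>3\<close> reflects zero, so the kernel is respected.\<close>

lemma exact_at_transport:
  assumes M: "module R M2" "module R M3" "module R B3"
    and f: "f1 \<in> linear_maps R M1 M2" "f2 \<in> linear_maps R M2 M3"
    and b: "bij_betw \<phi>1 (carrier M1) (carrier B1)" "bij_betw \<phi>2 (carrier M2) (carrier B2)"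
      "bij_betw \<phi>3 (carrier M3) (carrier B3)"
    and \<phi>3: "\<phi>3 \<in> linear_maps R M3 B3"
    and ex: "f1 ` carrier M1 = {y \<in> carrier M2. f2 y = \<zero>\<^bsub>M3\<^esub>}"
  shows "(\<lambda>x. \<phi>2 (f1 (inv_into (carrier M1) \<phi>1 x))) ` carrier B1 =
    {y \<in> carrier B2. \<phi>3 (f2 (inv_into (carrier M2) \<phi>2 y)) = \<zero>\<^bsub>B3\<^esub>}"
proof -
  interpret M3: module R M3 by fact
  have 1: "inv_into (carrier M1) \<phi>1 ` carrier B1 = carrier M1"
    using bij_betw_inv_into[OF b(1)] by (simp add: bij_betw_def)
  have 3: "\<phi>3 x = \<zero>\<^bsub>B3\<^esub> \<longleftrightarrow> x = \<zero>\<^bsub>M3\<^esub>" if "x \<in> carrier M3" for x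
    using linear_maps_zero[OF \<phi>3 M(2,3)] inj_on_eq_iff[OF bij_betw_imp_inj_on[OF b(3)] that M3.zero_closed]
    by simp
  have "(\<lambda>x. \<phi>2 (f1 (inv_into (carrier M1) \<phi>1 x))) ` carrier B1 = \<phi>2 ` f1 ` carrier M1"
    by (subst 1[symmetric]) (simp add: image_image)
  also have "\<dots> = \<phi>2 ` {y \<in> carrier M2. f2 y = \<zero>\<^bsub>M3\<^esub>}" by (simp add: ex)
  also have "\<dots> = {y \<in> carrier B2. \<phi>3 (f2 (inv_into (carrier M2) \<phi>2 y)) = \<zero>\<^bsub>B3\<^esub>}"
  proof (rule Set.set_eqI, rule iffI)
    fix y assume "y \<in> \<phi>2 ` {y \<in> carrier M2. f2 y = \<zero>\<^bsub>M3\<^esub>}"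
    then obtain x where x: "x \<in> carrier M2" "f2 x = \<zero>\<^bsub>M3\<^esub>" "y = \<phi>2 x" by blast
    then show "y \<in> {y \<in> carrier B2. \<phi>3 (f2 (inv_into (carrier M2) \<phi>2 y)) = \<zero>\<^bsub>B3\<^esub>}"
      using b(2) 3[of "\<zero>\<^bsub>M3\<^esub>"] bij_betw_inv_into_left[OF b(2) x(1)] bij_betw_apply[OF b(2) x(1)] by simp
  next
    fix y assume "y \<in> {y \<in> carrier B2. \<phi>3 (f2 (inv_into (carrier M2) \<phi>2 y)) = \<zero>\<^bsub>B3\<^esub>}"
    then have y: "y \<in> carrier B2" "\<phi>3 (f2 (inv_into (carrier M2) \<phi>2 y)) = \<zero>\<^bsub>B3\<^esub>" by simp_all
    have x: "inv_into (carrier M2) \<phi>2 y \<in> carrier M2"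
      using bij_betw_apply[OF bij_betw_inv_into[OF b(2)] y(1)] .
    then have "f2 (inv_into (carrier M2) \<phi>2 y) = \<zero>\<^bsub>M3\<^esub>"
      using y(2) 3 linear_mapsD(1)[OF f(2)] by simp
    then show "y \<in> \<phi>2 ` {y \<in> carrier M2. f2 y = \<zero>\<^bsub>M3\<^esub>}"
      using x bij_betw_inv_into_right[OF b(2) y(1)]
      by (intro image_eqI[of _ _ "inv_into (carrier M2) \<phi>2 y"]) simp_all
  qed
  finally show ?thesis .
qed

text \<open>Quotient modules are avoided: the cokernel of the first map is realized as an image in the
  third term, the kernel of the last map as an image in the fourth.\<close>

lemma exact_abelian_subcategory_five_term:
  fixes A :: "(int \<Rightarrow> ('r, 'u) module) set"
  assumes A: "exact_abelian_subcategory R A"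
    and B: "B1 \<in> A" "B2 \<in> A" "B4 \<in> A" "B5 \<in> A" and B3: "B3 \<in> graded_modules R"
    and g: "g1 \<in> graded_maps R B1 B2" "g2 \<in> graded_maps R B2 B3" "g3 \<in> graded_maps R B3 B4"
      "g4 \<in> graded_maps R B4 B5"
    and ex: "graded_exact_at B1 B2 B3 g1 g2" "graded_exact_at B2 B3 B4 g2 g3"
      "graded_exact_at B3 B4 B5 g3 g4"
  shows "B3 \<in> A"
proof -
  have AG: "A \<subseteq> graded_modules R"
    and ker: "\<And>M N K k f. \<lbrakk>M \<in> A; N \<in> A; K \<in> graded_modules R; k \<in> graded_maps R K M; f \<in> graded_maps R M N;
        graded_inj K k; graded_exact_at K M N k f\<rbrakk> \<Longrightarrow> K \<in> A"
    and coker: "\<And>M N Q f q. \<lbrakk>M \<in> A; N \<in> A; Q \<in> graded_modules R; f \<in> graded_maps R M N; q \<in> graded_maps R N Q;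
        graded_exact_at M N Q f q; graded_surj N Q q\<rbrakk> \<Longrightarrow> Q \<in> A"
    and ext: "\<And>M N E f g. \<lbrakk>M \<in> A; N \<in> A; E \<in> graded_modules R; f \<in> graded_maps R M E; g \<in> graded_maps R E N;
        graded_inj M f; graded_exact_at M E N f g; graded_surj E N g\<rbrakk> \<Longrightarrow> E \<in> A"
    using A unfolding exact_abelian_subcategory_def by blast+
  have mod: "module R (B2 i)" "module R (B3 i)" "module R (B4 i)"
    and sm: "small TYPE('u) (carrier (B2 i))" "small TYPE('u) (carrier (B3 i))" for i
    using AG B B3 unfolding graded_modules_def by blast+
  have g': "g2 i \<in> linear_maps R (B2 i) (B3 i)" "g3 i \<in> linear_maps R (B3 i) (B4 i)" for i
    using g by (simp_all add: graded_maps_def)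
  define Q where "Q i = (B3 i)\<lparr>carrier := g2 i ` carrier (B2 i)\<rparr>" for i
  define K where "K i = (B4 i)\<lparr>carrier := g3 i ` carrier (B3 i)\<rparr>" for i
  have "module R (Q i)" for i
    unfolding Q_def by (rule module_image[OF mod(1) g'(1) linear_maps_zero[OF g'(1) mod(1,2)]])
  moreover have "small TYPE('u) (carrier (Q i))" for i
    using small_image[OF sm(1), of "g2 i" i] by (simp add: Q_def)
  ultimately have Q: "Q \<in> graded_modules R" by (simp add: graded_modules_def)
  have "module R (K i)" for i
    unfolding K_def by (rule module_image[OF mod(2) g'(2) linear_maps_zero[OF g'(2) mod(2,3)]])
  moreover have "small TYPE('u) (carrier (K i))" for i
    using small_image[OF sm(2), of "g3 i" i] by (simp add: K_def)
  ultimately have K: "K \<in> graded_modules R" by (simp add: graded_modules_def)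
  have QA: "Q \<in> A"
  proof (rule coker[OF B(1,2) Q g(1)])
    show "g2 \<in> graded_maps R B2 Q"
      using g(2) by (simp add: graded_maps_def linear_maps_def Q_def)
    show "graded_exact_at B1 B2 Q g1 g2" using ex(1) by (simp add: graded_exact_at_def Q_def)
    show "graded_surj B2 Q g2" by (simp add: graded_surj_def Q_def)
  qed
  have KA: "K \<in> A"
  proof (rule ker[OF B(3,4) K])
    show "(\<lambda>i x. x) \<in> graded_maps R K B4"
      using linear_mapsD(1)[OF g'(2)] by (auto simp: graded_maps_def linear_maps_def K_def)
    show "graded_inj K (\<lambda>i x. x)" by (simp add: graded_inj_def)
    show "graded_exact_at K B4 B5 (\<lambda>i x. x) g4" using ex(3) by (simp add: graded_exact_at_def K_def)
  qed (rule g(4))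
  show ?thesis
  proof (rule ext[OF QA KA B3])
    show "(\<lambda>i x. x) \<in> graded_maps R Q B3"
      using linear_mapsD(1)[OF g'(1)] by (auto simp: graded_maps_def linear_maps_def Q_def)
    show "g3 \<in> graded_maps R B3 K"
      using g(3) by (simp add: graded_maps_def linear_maps_def K_def)
    show "graded_inj Q (\<lambda>i x. x)" by (simp add: graded_inj_def)
    show "graded_exact_at Q B3 K (\<lambda>i x. x) g3"
      using ex(2) by (simp add: graded_exact_at_def Q_def K_def)
    show "graded_surj B3 K g3" by (simp add: graded_surj_def K_def)
  qed
qed

text \<open>Four terms have models in \<open>A\<close>, and the middle one gets a small copy. The
  maps are conjugated to these models, so that closure of \<open>A\<close> is applied there and the
  result transferred back.\<close>

lemma belongs_to_five_term:
  fixes A :: "(int \<Rightarrow> ('r, 'u) module) set" and M3 :: "int \<Rightarrow> ('r, 'a) module"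
  assumes A: "exact_abelian_subcategory R A"
    and mod: "\<And>i. module R (M1 i)" "\<And>i. module R (M2 i)" "\<And>i. module R (M3 i)"
      "\<And>i. module R (M4 i)" "\<And>i. module R (M5 i)"
    and bel: "belongs_to R M1 A" "belongs_to R M2 A" "belongs_to R M4 A" "belongs_to R M5 A"
    and sm: "\<And>i. small TYPE('u) (carrier (M3 i))"
    and f: "f1 \<in> graded_maps R M1 M2" "f2 \<in> graded_maps R M2 M3" "f3 \<in> graded_maps R M3 M4"
      "f4 \<in> graded_maps R M4 M5"
    and ex: "graded_exact_at M1 M2 M3 f1 f2" "graded_exact_at M2 M3 M4 f2 f3"
      "graded_exact_at M3 M4 M5 f3 f4"
  shows "belongs_to R M3 A"
proof -
  obtain B1 p1 where B1: "B1 \<in> A" "\<And>i. p1 i \<in> linear_maps R (M1 i) (B1 i)"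
    "\<And>i. bij_betw (p1 i) (carrier (M1 i)) (carrier (B1 i))"
    using bel(1) unfolding belongs_to_def graded_isomorphic_iff by blast
  obtain B2 p2 where B2: "B2 \<in> A" "\<And>i. p2 i \<in> linear_maps R (M2 i) (B2 i)"
    "\<And>i. bij_betw (p2 i) (carrier (M2 i)) (carrier (B2 i))"
    using bel(2) unfolding belongs_to_def graded_isomorphic_iff by blast
  obtain B4 p4 where B4: "B4 \<in> A" "\<And>i. p4 i \<in> linear_maps R (M4 i) (B4 i)"
    "\<And>i. bij_betw (p4 i) (carrier (M4 i)) (carrier (B4 i))"
    using bel(3) unfolding belongs_to_def graded_isomorphic_iff by blast
  obtain B5 p5 where B5: "B5 \<in> A" "\<And>i. p5 i \<in> linear_maps R (M5 i) (B5 i)"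
    "\<And>i. bij_betw (p5 i) (carrier (M5 i)) (carrier (B5 i))"
    using bel(4) unfolding belongs_to_def graded_isomorphic_iff by blast
  have "\<forall>i. \<exists>N :: ('r, 'u) module. \<exists>f. module R N \<and> small TYPE('u) (carrier N) \<and>
      f \<in> linear_maps R (M3 i) N \<and> bij_betw f (carrier (M3 i)) (carrier N)"
    using small_module_copy[OF mod(3) sm] by blast
  then obtain B3 :: "int \<Rightarrow> ('r, 'u) module" where "\<forall>i. \<exists>f. module R (B3 i) \<and>
      small TYPE('u) (carrier (B3 i)) \<and> f \<in> linear_maps R (M3 i) (B3 i) \<and>
      bij_betw f (carrier (M3 i)) (carrier (B3 i))"
    by (rule choice[THEN exE])
  then obtain p3 where "\<forall>i. module R (B3 i) \<and>
      small TYPE('u) (carrier (B3 i)) \<and> p3 i \<in> linear_maps R (M3 i) (B3 i) \<and>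
      bij_betw (p3 i) (carrier (M3 i)) (carrier (B3 i))"
    by (rule choice[THEN exE])
  then have B3: "\<And>i. module R (B3 i)" "\<And>i. small TYPE('u) (carrier (B3 i))"
    "\<And>i. p3 i \<in> linear_maps R (M3 i) (B3 i)" "\<And>i. bij_betw (p3 i) (carrier (M3 i)) (carrier (B3 i))"
    by simp_all
  have "A \<subseteq> graded_modules R" using A unfolding exact_abelian_subcategory_def by blast
  then have mB: "module R (B4 i)" "module R (B5 i)" for i
    using B4(1) B5(1) unfolding graded_modules_def by blast+
  have f': "f1 i \<in> linear_maps R (M1 i) (M2 i)" "f2 i \<in> linear_maps R (M2 i) (M3 i)"
    "f3 i \<in> linear_maps R (M3 i) (M4 i)" "f4 i \<in> linear_maps R (M4 i) (M5 i)" for i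
    using f by (simp_all add: graded_maps_def)
  have ex': "f1 i ` carrier (M1 i) = {y \<in> carrier (M2 i). f2 i y = \<zero>\<^bsub>M3 i\<^esub>}"
    "f2 i ` carrier (M2 i) = {y \<in> carrier (M3 i). f3 i y = \<zero>\<^bsub>M4 i\<^esub>}"
    "f3 i ` carrier (M3 i) = {y \<in> carrier (M4 i). f4 i y = \<zero>\<^bsub>M5 i\<^esub>}" for i
    using ex by (simp_all add: graded_exact_at_def)
  define g1 where "g1 i x = p2 i (f1 i (inv_into (carrier (M1 i)) (p1 i) x))" for i x
  define g2 where "g2 i x = p3 i (f2 i (inv_into (carrier (M2 i)) (p2 i) x))" for i x
  define g3 where "g3 i x = p4 i (f3 i (inv_into (carrier (M3 i)) (p3 i) x))" for i x
  define g4 where "g4 i x = p5 i (f4 i (inv_into (carrier (M4 i)) (p4 i) x))" for i x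
  have "B3 \<in> A"
  proof (rule exact_abelian_subcategory_five_term[OF A B1(1) B2(1) B4(1) B5(1)])
    show "B3 \<in> graded_modules R" using B3 by (simp add: graded_modules_def)
    show "g1 \<in> graded_maps R B1 B2"
      unfolding graded_maps_def g1_def
      using linear_maps_comp[OF linear_maps_comp[OF linear_maps_inv[OF B1(2) mod(1) B1(3)] f'(1)] B2(2)]
      by blast
    show "g2 \<in> graded_maps R B2 B3"
      unfolding graded_maps_def g2_def
      using linear_maps_comp[OF linear_maps_comp[OF linear_maps_inv[OF B2(2) mod(2) B2(3)] f'(2)] B3(3)]
      by blast
    show "g3 \<in> graded_maps R B3 B4"
      unfolding graded_maps_def g3_def
      using linear_maps_comp[OF linear_maps_comp[OF linear_maps_inv[OF B3(3) mod(3) B3(4)] f'(3)] B4(2)]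
      by blast
    show "g4 \<in> graded_maps R B4 B5"
      unfolding graded_maps_def g4_def
      using linear_maps_comp[OF linear_maps_comp[OF linear_maps_inv[OF B4(2) mod(4) B4(3)] f'(4)] B5(2)]
      by blast
    show "graded_exact_at B1 B2 B3 g1 g2"
      unfolding graded_exact_at_def g1_def g2_def
      using exact_at_transport[OF mod(2,3) B3(1) f'(1,2) B1(3) B2(3) B3(4) B3(3) ex'(1)] by blast
    show "graded_exact_at B2 B3 B4 g2 g3"
      unfolding graded_exact_at_def g2_def g3_def
      using exact_at_transport[OF mod(3,4) mB(1) f'(2,3) B2(3) B3(4) B4(3) B4(2) ex'(2)] by blast
    show "graded_exact_at B3 B4 B5 g3 g4"
      unfolding graded_exact_at_def g3_def g4_def
      using exact_at_transport[OF mod(4,5) mB(2) f'(3,4) B3(4) B4(3) B5(3) B5(2) ex'(3)] by blast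
  qed
  moreover have "graded_isomorphic R M3 B3"
    unfolding graded_isomorphic_iff using B3 by blast
  ultimately show ?thesis unfolding belongs_to_def by blast
qed

section \<open>The adjoint\<close>

lemma hom_module_simps [simp]:
  "carrier (hom_module C s X Y) = Hom C X Y"
  "zero (hom_module C s X Y) = Zero C X Y"
  "add (hom_module C s X Y) = Add C"
  "smult (hom_module C s X Y) = s"
  by (simp_all add: hom_module_def)

section \<open>The graded modules of morphisms\<close>

context linear_triangulated_category
begin

lemma linear_post_comp:
  assumes "g \<in> Hom C Y Z" "X \<in> Obj C"
  shows "(\<lambda>f. g \<cdot>\<^bsub>C\<^esub> f) \<in> linear_maps R (hom_module C s X Y) (hom_module C s X Z)"
proof -
  have "g \<cdot>\<^bsub>C\<^esub> s r f = s r (g \<cdot>\<^bsub>C\<^esub> f)" if "r \<in> carrier R" "f \<in> Hom C X Y" for r f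
    using Comp_smult_right[OF that assms(1)] .
  moreover have "g \<cdot>\<^bsub>C\<^esub> Add C f f' = Add C (g \<cdot>\<^bsub>C\<^esub> f) (g \<cdot>\<^bsub>C\<^esub> f')"
    if "f \<in> Hom C X Y" "f' \<in> Hom C X Y" for f f'
    using Comp_Add_right[OF that assms(1)] .
  moreover have "g \<cdot>\<^bsub>C\<^esub> f \<in> Hom C X Z" if "f \<in> Hom C X Y" for f
    using Comp_in_Hom[OF that assms(1)] .
  ultimately show ?thesis by (simp add: linear_maps_def)
qed

lemma S_mod_module:
  assumes "N \<in> Obj C" "M \<in> Obj C"
  shows "module R (S_mod C s N M i)"
  unfolding S_mod_def using Hom_module shift_by_step(2)[OF assms(2)] assms(1) by blast

lemma S_mod_isomorphic:
  assumes "isomorphic C N N'" "M \<in> Obj C"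
  shows "graded_isomorphic R (S_mod C s N M) (S_mod C s N' M)"
proof -
  obtain a where a: "a \<in> Iso C N N'" using assms(1) by (auto simp: isomorphic_def)
  then have "a \<in> Hom C N N'" by (simp add: Iso_def)
  then show ?thesis
    unfolding graded_isomorphic_iff S_mod_def
    using linear_post_comp bij_betw_Comp_Iso[OF a] shift_by_step(2)[OF assms(2)]
    by (intro exI[of _ "\<lambda>i f. a \<cdot>\<^bsub>C\<^esub> f"]) simp
qed

text \<open>In degree i + 1 the left side consists of morphisms from M[-i-1] to N, and the shift
  turns them into morphisms from M[-i] to N[1]. Shifting the object thus shifts the grading, which
  is where stability of \<open>A\<close> under shifts enters.\<close>

lemma S_mod_shift:
  assumes N: "N \<in> Obj C" and M: "M \<in> Obj C"
  shows "graded_isomorphic R (\<lambda>i. S_mod C s N M (i + 1)) (S_mod C s (shO C N) M)"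
  unfolding graded_isomorphic_iff S_mod_def
proof (intro exI[of _ "\<lambda>i. shA C"] allI conjI)
  fix i
  let ?X = "shift_by C (- (i + 1)) M"
  have X: "?X \<in> Obj C" "shO C ?X = shift_by C (- i) M"
    using shift_by_step[OF M, of "- (i + 1)"] by simp_all
  have "shA C (Add C f g) = Add C (shA C f) (shA C g)"
    if "f \<in> Hom C ?X N" "g \<in> Hom C ?X N" for f g
    using HomD[OF that(1)] HomD[OF that(2)] by simp
  moreover have "shA C f \<in> Hom C (shO C ?X) (shO C N)" if "f \<in> Hom C ?X N" for f
    using bij_betw_apply[OF bij_betw_shA[OF X(1) N] that] .
  ultimately show "shA C \<in> linear_maps R (hom_module C s ?X N)
      (hom_module C s (shift_by C (- i) M) (shO C N))"
    unfolding X(2)[symmetric] by (simp add: linear_maps_def Shift_smult)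
  show "bij_betw (shA C) (carrier (hom_module C s ?X N))
      (carrier (hom_module C s (shift_by C (- i) M) (shO C N)))"
    using bij_betw_shA[OF X(1) N] unfolding X(2) by simp
qed

text \<open>For a cone, each \<open>K\<close> in \<open>\<T>\<close> gives five terms of a long
  exact sequence, of which the outer four belong to \<open>A\<close> by assumption and shift
  stability. The inclusion of the nonempty \<open>\<T>\<close> makes the subcategory
  nonempty.\<close>

lemma triangulated_T_sub:
  fixes A :: "(int \<Rightarrow> ('r, 'u) module) set"
  assumes ls: "locally_small TYPE('u) C" and \<T>: "\<T> \<subseteq> Obj C" "\<T> \<noteq> {}"
    and A: "exact_abelian_subcategory R A" "shift_stable R A" and sub: "\<T> \<subseteq> T_sub R C s \<T> A"
  shows "triangulated_subcategory C (T_sub R C s \<T> A)"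
proof -
  let ?TA = "T_sub R C s \<T> A"
  have AG: "A \<subseteq> graded_modules R" using A(1) unfolding exact_abelian_subcategory_def by blast
  have M: "M \<in> Obj C" if "M \<in> \<T>" for M using \<T>(1) that by blast
  have iff: "N \<in> ?TA \<longleftrightarrow> N \<in> Obj C \<and> (\<forall>M \<in> \<T>. belongs_to R (S_mod C s N M) A)" for N
    by (simp add: T_sub_def)
  have shift: "N \<in> ?TA \<longleftrightarrow> shO C N \<in> ?TA" if N: "N \<in> Obj C" for N
  proof -
    have "belongs_to R (S_mod C s N K) A \<longleftrightarrow> belongs_to R (S_mod C s (shO C N) K) A" if "K \<in> \<T>" for K
    proof -
      note iso = S_mod_shift[OF N M[OF that]]
      have "graded_isomorphic R (S_mod C s (shO C N) K) (\<lambda>i. S_mod C s N K (i + 1))"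
        using graded_isomorphic_sym[OF iso] S_mod_module[OF N M[OF that]] by blast
      then show ?thesis
        using belongs_to_iso iso belongs_to_shift[OF AG A(2), of "S_mod C s N K"] by blast
    qed
    then show ?thesis using iff N by simp
  qed
  show ?thesis
    unfolding triangulated_subcategory_def
  proof (intro conjI ballI allI impI)
    show "strictly_full C ?TA"
      unfolding strictly_full_def
    proof (intro conjI ballI impI)
      show "?TA \<subseteq> Obj C" by (simp add: T_sub_def)
      fix X Y assume X: "X \<in> ?TA" and Y: "Y \<in> Obj C" and "isomorphic C X Y"
      then have "graded_isomorphic R (S_mod C s Y K) (S_mod C s X K)" if "K \<in> \<T>" for K
        using S_mod_isomorphic[OF isomorphic_sym M[OF that]] by blast
      then show "Y \<in> ?TA" using belongs_to_iso X Y unfolding iff by blast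
    qed
    show "?TA \<noteq> {}" using \<T>(2) sub by blast
    show "X \<in> ?TA \<longleftrightarrow> shO C X \<in> ?TA" if "X \<in> Obj C" for X using shift that .
  next
    fix f g h assume D: "(f, g, h) \<in> Dist C \<and> Dom C f \<in> ?TA \<and> Cod C f \<in> ?TA"
    then obtain X Y Z where T: "triangle C X Y Z f g h" using Dist_iff_triangle by blast
    note t = triangleD[OF T]
    have XY: "X \<in> ?TA" "Y \<in> ?TA" using D t by simp_all
    then have XY1: "shO C X \<in> ?TA" "shO C Y \<in> ?TA" using shift t by simp_all
    have f1: "shA C f \<in> Hom C (shO C X) (shO C Y)" using t by (simp add: Hom_iff)
    have "belongs_to R (S_mod C s Z K) A" if K: "K \<in> \<T>" for K
    proof (rule belongs_to_five_term[OF A(1)])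
      have W: "shift_by C j K \<in> Obj C" for j using shift_by_step(2)[OF M[OF K]] .
      show "module R (S_mod C s X K i)" "module R (S_mod C s Y K i)" "module R (S_mod C s Z K i)"
        "module R (S_mod C s (shO C X) K i)" "module R (S_mod C s (shO C Y) K i)" for i
        using S_mod_module M[OF K] t by simp_all
      show "belongs_to R (S_mod C s X K) A" "belongs_to R (S_mod C s Y K) A"
        "belongs_to R (S_mod C s (shO C X) K) A" "belongs_to R (S_mod C s (shO C Y) K) A"
        using XY XY1 K by (simp_all add: iff)
      show "small TYPE('u) (carrier (S_mod C s Z K i))" for i
        using ls W t(16) by (simp add: S_mod_def locally_small_def)
      show "(\<lambda>i x. f \<cdot>\<^bsub>C\<^esub> x) \<in> graded_maps R (S_mod C s X K) (S_mod C s Y K)"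
        "(\<lambda>i x. g \<cdot>\<^bsub>C\<^esub> x) \<in> graded_maps R (S_mod C s Y K) (S_mod C s Z K)"
        "(\<lambda>i x. h \<cdot>\<^bsub>C\<^esub> x) \<in> graded_maps R (S_mod C s Z K) (S_mod C s (shO C X) K)"
        "(\<lambda>i x. shA C f \<cdot>\<^bsub>C\<^esub> x) \<in> graded_maps R (S_mod C s (shO C X) K) (S_mod C s (shO C Y) K)"
        using linear_post_comp[OF _ W] t(2-4) f1 by (simp_all add: graded_maps_def S_mod_def)
      \<comment> \<open>The hom sequences characterize kernel elements as image elements; the set
        equation in \<open>graded_exact_at\<close> needs in addition that the image lies in the
        middle hom set.\<close>
      have im: "(\<lambda>x. k \<cdot>\<^bsub>C\<^esub> x) ` Hom C V X' = {y \<in> Hom C V Y'. l \<cdot>\<^bsub>C\<^esub> y = Zero C V Z'}"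
        if "k \<in> Hom C X' Y'" "\<And>y. y \<in> Hom C V Y' \<Longrightarrow> l \<cdot>\<^bsub>C\<^esub> y = Zero C V Z' \<longleftrightarrow> y \<in> (\<lambda>x. k \<cdot>\<^bsub>C\<^esub> x) ` Hom C V X'"
        for k l V X' Y' Z'
      proof -
        have "(\<lambda>x. k \<cdot>\<^bsub>C\<^esub> x) ` Hom C V X' \<subseteq> Hom C V Y'" using Comp_in_Hom that(1) by blast
        then show ?thesis using that(2) by blast
      qed
      show "graded_exact_at (S_mod C s X K) (S_mod C s Y K) (S_mod C s Z K)
          (\<lambda>i x. f \<cdot>\<^bsub>C\<^esub> x) (\<lambda>i x. g \<cdot>\<^bsub>C\<^esub> x)"
        unfolding graded_exact_at_def S_mod_def hom_module_simps
        using im[OF t(2) cov_exact[OF T]] by blast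
      show "graded_exact_at (S_mod C s Y K) (S_mod C s Z K) (S_mod C s (shO C X) K)
          (\<lambda>i x. g \<cdot>\<^bsub>C\<^esub> x) (\<lambda>i x. h \<cdot>\<^bsub>C\<^esub> x)"
        unfolding graded_exact_at_def S_mod_def hom_module_simps
        using im[OF t(3) cov_exact'(1)[OF T]] by blast
      show "graded_exact_at (S_mod C s Z K) (S_mod C s (shO C X) K) (S_mod C s (shO C Y) K)
          (\<lambda>i x. h \<cdot>\<^bsub>C\<^esub> x) (\<lambda>i x. shA C f \<cdot>\<^bsub>C\<^esub> x)"
        unfolding graded_exact_at_def S_mod_def hom_module_simps
        using im[OF t(4) cov_exact'(2)[OF T]] by blast
    qed
    then show "Cod C g \<in> ?TA" using t by (simp add: iff)
  qed
qed

text \<open>Bijectivity is required on the shifts of one \<open>M\<close>. In this form the lemma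
  applies both to universal arrows in \<open>D\<close> and to those tested on the smaller category
  \<open>\<T>\<^sub>A\<close>.\<close>

lemma S_mod_universal:
  assumes F: "exact_between C C' F \<theta>" and e: "e \<in> Hom C' (omap F L) N" and L: "L \<in> Obj C"
    and M: "M \<in> Obj C"
    and bij: "\<And>k. bij_betw (\<lambda>g. e \<cdot>\<^bsub>C'\<^esub> amap F g) (Hom C (shift_by C k M) L)
      (Hom C' (omap F (shift_by C k M)) N)"
  shows "graded_isomorphic R (S_mod C s L M) (S'_mod C s C' F N M)"
  unfolding graded_isomorphic_iff
proof (intro exI[of _ "\<lambda>i g. e \<cdot>\<^bsub>C'\<^esub> amap F g"] allI conjI)
  interpret F: exact_between C C' F \<theta> by fact
  fix i
  let ?W = "shift_by C (- i) M"
  have W: "?W \<in> Obj C" using shift_by_step(2)[OF M] .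
  note e' = F.C'.HomD[OF e]
  show "bij_betw (\<lambda>g. e \<cdot>\<^bsub>C'\<^esub> amap F g) (carrier (S_mod C s L M i)) (carrier (S'_mod C s C' F N M i))"
    using bij by (simp add: S_mod_def S'_mod_def F_hom_module_def)
  have "e \<cdot>\<^bsub>C'\<^esub> amap F g \<in> Hom C' (omap F ?W) N" if "g \<in> Hom C ?W L" for g
    using bij_betw_apply[OF bij that] .
  moreover have "e \<cdot>\<^bsub>C'\<^esub> amap F (Add C g g') = Add C' (e \<cdot>\<^bsub>C'\<^esub> amap F g) (e \<cdot>\<^bsub>C'\<^esub> amap F g')"
    if "g \<in> Hom C ?W L" "g' \<in> Hom C ?W L" for g g'
    using HomD[OF that(1)] HomD[OF that(2)] e' by simp
  \<comment> \<open>A multiple \<open>s r g\<close> equals \<open>g\<close> precomposed with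
    \<open>s r (Ide C ?W)\<close>, so \<open>F\<close> carries the scalars of \<open>C\<close> to
    the precomposition action in \<open>F_hom_module\<close>.\<close>
  moreover have "e \<cdot>\<^bsub>C'\<^esub> amap F (s r g) = e \<cdot>\<^bsub>C'\<^esub> amap F g \<cdot>\<^bsub>C'\<^esub> amap F (s r (Ide C ?W))"
    if r: "r \<in> carrier R" and g: "g \<in> Hom C ?W L" for r g
  proof -
    note g' = HomD[OF g]
    interpret W: module R "hom_module C s ?W ?W" using Hom_module[OF W W] .
    have I: "Ide C ?W \<in> Hom C ?W ?W" using W by (rule Ide_in_Hom)
    have "s r (Ide C ?W) \<in> Hom C ?W ?W" using W.smult_closed[OF r] I by simp
    note rI = HomD[OF this]
    have "s r g = g \<cdot>\<^bsub>C\<^esub> s r (Ide C ?W)" using Comp_smult_right[OF r I g] g' by simp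
    then show ?thesis using g' rI e' by simp
  qed
  ultimately show "(\<lambda>g. e \<cdot>\<^bsub>C'\<^esub> amap F g) \<in> linear_maps R (S_mod C s L M i) (S'_mod C s C' F N M i)"
    by (simp add: linear_maps_def S_mod_def S'_mod_def F_hom_module_def)
qed

end

text \<open>The same \<open>\<theta>\<close> works, since morphisms and triangles of a full
  subcategory are those of the ambient category between its objects.\<close>

lemma exact_between_full_sub:
  fixes C :: "('o, 'm) tricat" and C' :: "('p, 'n) tricat"
  assumes F: "exact_between C C' F \<theta>" and S: "triangulated_subcategory C S"
    and S': "triangulated_subcategory C' S'" and FS: "\<And>X. X \<in> S \<Longrightarrow> omap F X \<in> S'"
  shows "exact_between (full_sub C S) (full_sub C' S') F \<theta>"
proof -
  interpret F: exact_between C C' F \<theta> by fact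
  interpret S: triangulated_subcat C S by unfold_locales (rule S)
  interpret S': triangulated_subcat C' S' by unfold_locales (rule S')
  interpret FSC: triangulated_category "full_sub C S" by (rule S.triangulated_full_sub)
  interpret FSC': triangulated_category "full_sub C' S'" by (rule S'.triangulated_full_sub)
  have "additive_functor (full_sub C S) (full_sub C' S') F"
    unfolding additive_functor_def is_functor_def
    by (auto simp: Hom_full_sub_iff FS Hom_iff)
  moreover have "\<theta> X \<in> Iso (full_sub C' S') (omap F (shO (full_sub C S) X)) (shO (full_sub C' S') (omap F X))"
    if "X \<in> Obj (full_sub C S)" for X
    using that F.\<theta>_Iso[of X] FS by (simp add: Iso_full_sub_iff)
  moreover have "\<theta> Y \<cdot>\<^bsub>full_sub C' S'\<^esub> amap F (shA (full_sub C S) f) =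
      shA (full_sub C' S') (amap F f) \<cdot>\<^bsub>full_sub C' S'\<^esub> \<theta> X"
    if "f \<in> Hom (full_sub C S) X Y" for f X Y
    using that F.\<theta>_natural[of f X Y] by (simp add: Hom_full_sub_iff)
  moreover have "(amap F f, amap F g, \<theta> (Dom (full_sub C S) f) \<cdot>\<^bsub>full_sub C' S'\<^esub> amap F h)
      \<in> Dist (full_sub C' S')"
    if "(f, g, h) \<in> Dist (full_sub C S)" for f g h
  proof -
    have D: "(f, g, h) \<in> Dist C" "Dom C f \<in> S" "Cod C f \<in> S" "Cod C g \<in> S" using that by auto
    obtain X Y Z where "triangle C X Y Z f g h" using D(1) F.C.Dist_iff_triangle by blast
    note t = F.C.triangleD[OF this]
    show ?thesis using F.F_Dist[OF D(1)] D(2-4) FS t by simp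
  qed
  ultimately show ?thesis
    by (intro exact_between.intro exact_between_axioms.intro FSC.triangulated_category_axioms
        FSC'.triangulated_category_axioms)
qed

theorem corollary3p1p3:
  fixes R :: "'r ring"
    and D :: "('o, 'm) tricat" and s :: "'r \<Rightarrow> 'm \<Rightarrow> 'm"
    and D' :: "('p, 'n) tricat"
    and F :: "('o, 'm, 'p, 'n) func"
    and \<T> LO RO :: "'o set"
    and A :: "(int \<Rightarrow> ('r, 'u) module) set"
    and T :: "'p set"
  assumes universe: "universe TYPE('u)"
    and D: "linear_triangulated_category R D s"
      "locally_small TYPE('u) D" "has_small_coproducts TYPE('u) D"
    and \<T>: "triangulated_subcategory D \<T>" "essentially_small TYPE('u) D \<T>"
      "\<And>M. M \<in> \<T> \<Longrightarrow> compact_object TYPE('u) D M"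
    and generated: "Obj D = coproduct_closure TYPE('u) D \<T>"
    and sod: "semi_orthogonal_decomposition (full_sub D \<T>) LO RO"
    and A: "exact_abelian_subcategory R A" "shift_stable R A"
    and D': "triangulated_category D'" "locally_small TYPE('u) D'"
    and F: "exact_functor D D' F" "respects_coproducts TYPE('u) D D' F"
    and \<T>_sub: "\<T> \<subseteq> T_sub R D s \<T> A"
    and T: "strictly_full D' T" "essential_image D' F (T_sub R D s \<T> A) \<subseteq> T"
  shows "((\<exists>G. is_right_adjoint (full_sub D (T_sub R D s \<T> A)) (full_sub D' T) F G) \<longleftrightarrow>
           (\<forall>M \<in> \<T>. \<forall>N \<in> T. belongs_to R (S'_mod D s D' F N M) A))
       \<and> (triangulated_subcategory D' T \<longrightarrow>
           (\<forall>G. is_right_adjoint (full_sub D (T_sub R D s \<T> A)) (full_sub D' T) F G \<longrightarrow>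
             exact_functor (full_sub D' T) (full_sub D (T_sub R D s \<T> A)) G))"
proof -
  let ?TA = "T_sub R D s \<T> A"
  let ?C = "full_sub D ?TA" and ?C' = "full_sub D' T"
  interpret linear_triangulated_category R D s by fact
  obtain \<theta> where \<theta>: "exact_between D D' F \<theta>" using exact_functorE[OF F(1)] .
  interpret F: exact_between D D' F \<theta> by (rule \<theta>)
  have \<T>_Obj: "M \<in> Obj D" if "M \<in> \<T>" for M using \<T>(3)[OF that] by (simp add: compact_object_def)
  have \<T>_shift: "shift_by D k M \<in> \<T>" if "M \<in> \<T>" for M k
  proof (rule shift_by_all[of "\<lambda>k. shift_by D k M \<in> \<T>"])
    show "shift_by D 0 M \<in> \<T>" using that by simp
    show "shift_by D k M \<in> \<T> \<longleftrightarrow> shift_by D (k + 1) M \<in> \<T>" for k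
      using \<T>(1) shift_by_step[OF \<T>_Obj[OF that]] unfolding triangulated_subcategory_def by simp
  qed
  have TA: "triangulated_subcategory D ?TA"
    using triangulated_T_sub[OF D(2) _ _ A \<T>_sub] \<T>_Obj \<T>(1)
    unfolding triangulated_subcategory_def by blast
  have TA_Obj: "?TA \<subseteq> Obj D" by (simp add: T_sub_def)
  have T_Obj: "N \<in> Obj D'" if "N \<in> T" for N using T(1) that unfolding strictly_full_def by blast
  have FT: "omap F X \<in> T" if "X \<in> ?TA" for X
  proof -
    have X: "X \<in> Obj D" using TA_Obj that by blast
    have "Ide D' (omap F X) \<in> Iso D' (omap F X) (omap F X)" using F.C'.Ide_Iso X by simp
    then have "omap F X \<in> essential_image D' F ?TA"
      unfolding essential_image_def isomorphic_def using that X F.F_Obj by blast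
    then show ?thesis using T(2) by blast
  qed
  have Obj_C: "Obj ?C = ?TA" "Obj ?C' = T" using TA_Obj T_Obj by auto
  interpret FF: functor_between ?C ?C' F
  proof (intro functor_between.intro functor_between_axioms.intro)
    show "category ?C" "category ?C'"
      using category_full_sub category_axioms F.C'.category_axioms by blast+
    show "is_functor ?C ?C' F"
      unfolding is_functor_def by (auto simp: Hom_full_sub_iff FT Hom_iff)
  qed
  \<comment> \<open>Full subcategories have the ambient hom sets, so what distinguishes universality
    here from that in \<open>D\<close> is the range of the test objects \<open>W\<close>.\<close>
  have universal_iff: "universal_arrow ?C ?C' F N L e \<longleftrightarrow> L \<in> ?TA \<and> N \<in> T \<and> e \<in> Hom D' (omap F L) N \<and>
      (\<forall>W \<in> ?TA. bij_betw (\<lambda>g. e \<cdot>\<^bsub>D'\<^esub> amap F g) (Hom D W L) (Hom D' (omap F W) N))" for N L e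
    unfolding universal_arrow_def Obj_C using FT by (auto simp: Hom_full_sub)
  have S_iso: "graded_isomorphic R (S_mod D s L M) (S'_mod D s D' F N M)"
    if "e \<in> Hom D' (omap F L) N" "L \<in> Obj D"
      "\<forall>W \<in> \<T>. bij_betw (\<lambda>g. e \<cdot>\<^bsub>D'\<^esub> amap F g) (Hom D W L) (Hom D' (omap F W) N)" "M \<in> \<T>" for L N e M
    using S_mod_universal[OF \<theta> that(1,2) \<T>_Obj[OF that(4)]] that(3) \<T>_shift[OF that(4)] by blast
  show ?thesis
  proof (intro conjI iffI impI allI ballI)
    fix M N assume "\<exists>G. is_right_adjoint ?C ?C' F G" and M: "M \<in> \<T>" and N: "N \<in> T"
    then obtain G where G: "is_right_adjoint ?C ?C' F G" by blast
    obtain e where "universal_arrow ?C ?C' F N (omap G N) e"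
      by (rule FF.right_adjoint_counit[OF G]) (use N Obj_C in blast)
    then have L: "omap G N \<in> ?TA" "e \<in> Hom D' (omap F (omap G N)) N"
      "\<forall>W \<in> ?TA. bij_betw (\<lambda>g. e \<cdot>\<^bsub>D'\<^esub> amap F g) (Hom D W (omap G N)) (Hom D' (omap F W) N)"
      unfolding universal_iff by blast+
    have L_Obj: "omap G N \<in> Obj D" using L(1) TA_Obj by blast
    \<comment> \<open>The arrow is universal only against objects of \<open>\<T>\<^sub>A\<close>;
      the inclusion \<open>\<T>_sub\<close> makes the shifts of \<open>M\<close> admissible test
      objects.\<close>
    have "graded_isomorphic R (S_mod D s (omap G N) M) (S'_mod D s D' F N M)"
      using S_iso[OF L(2) L_Obj _ M] L(3) \<T>_sub by blast
    then have "graded_isomorphic R (S'_mod D s D' F N M) (S_mod D s (omap G N) M)"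
      using graded_isomorphic_sym S_mod_module[OF L_Obj \<T>_Obj[OF M]] by blast
    moreover have "belongs_to R (S_mod D s (omap G N) M) A"
      using L(1) M by (simp add: T_sub_def)
    ultimately show "belongs_to R (S'_mod D s D' F N M) A" by (rule belongs_to_iso)
  next
    assume bel: "\<forall>M \<in> \<T>. \<forall>N \<in> T. belongs_to R (S'_mod D s D' F N M) A"
    show "\<exists>G. is_right_adjoint ?C ?C' F G"
    proof (rule FF.right_adjoint_ex)
      fix N assume "N \<in> Obj ?C'"
      then have N: "N \<in> T" "N \<in> Obj D'" by simp_all
      obtain L e where U: "universal_arrow D D' F N L e"
        using F.brown_representability[OF universe D(2,3) D'(2) F(2) \<T> generated N(2)] by blast
      note U' = F.universalD[OF U]
      have bij: "bij_betw (\<lambda>g. e \<cdot>\<^bsub>D'\<^esub> amap F g) (Hom D W L) (Hom D' (omap F W) N)" if "W \<in> Obj D" for W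
        using F.universal_bij[OF U that] .
      have "belongs_to R (S_mod D s L M) A" if M: "M \<in> \<T>" for M
        using belongs_to_iso[OF S_iso[OF U'(3,1) _ M]] bij \<T>_Obj bel M N(1) by blast
      then have "L \<in> ?TA" using U'(1) by (simp add: T_sub_def)
      then have "universal_arrow ?C ?C' F N L e"
        unfolding universal_iff using N(1) U'(3) bij TA_Obj by blast
      then show "\<exists>L e. universal_arrow ?C ?C' F N L e" by blast
    qed
  next
    fix G assume "triangulated_subcategory D' T" and G: "is_right_adjoint ?C ?C' F G"
    then interpret FFe: exact_between ?C ?C' F \<theta>
      using exact_between_full_sub[OF \<theta> TA _ FT] by blast
    show "exact_functor ?C' ?C G" by (rule FFe.exact_right_adjoint[OF G])
  qed
qed

end
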